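(* Let $T$ be an affine-index monomial operator with $T(x^n)=c_nx^{p_n}$, $p_n=an+b$, where $a,b>0$. Then $T$ is compact if and only if the associated function $h$ satisfies the condition that for each $\epsilon>0$ there is an $M>0$ such that $$\int_{(t-L)/a}^{(t+L)/a}|h(iy)|^2\,dy<\epsilon L$$ for all real $t$ with $|t|\ge M$ and all $L\ge b/2$. This holds whenever $h\in L^2(i\mathbb R)$.
   Context: $\mathbb C_+=\{s\in\mathbb C:\operatorname{Re}s>0\}$, and $H^2(\mathbb C_+)$ is the Hardy space of holomorphic functions $f$ on $\mathbb C_+$ with $\sup_{x>0}\int_{\mathbb R}|f(x+iy)|^2dy<\infty$. A monomial operator is a bounded linear operator $T$ on $L^2(0,1)$ with $T(x^n)=c_nx^{p_n}$ for each $n=0,1,2,\dots$, where $c_n,p_n\in\mathbb C$ and $\operatorname{Re}p_n>-1/2$; it has affine index if $p_n=an+b$ for real constants $a,b\ge0$. By the substitution $x=e^{-t}$ and the Laplace transform, $T$ is unitarily equivalent to an operator $T_0$ on $H^2(\mathbb C_+)$ mapping $1/(s+n+\frac12)$ to $c_n/(s+p_n+\frac12)$. Its adjoint is the weighted composition operator $T_0^*G=h\cdot(G\circ\varphi)$, where $h(n+\frac12)=\overline{c_n}$ and $\varphi(n+\frac12)=p_n+\frac12=an+b+\frac12$ for all $n\ge0$. The function $h$, holomorphic on $\mathbb C_+$, is the function associated with $T$; $h(iy)$ denotes its boundary values on $i\mathbb R$, and $h\in L^2(i\mathbb R)$ means $\int_{\mathbb R}|h(iy)|^2dy<\infty$.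
   Formalization: The case a = 2b+1 is excluded: there φ maps the imaginary axis to itself and the criterion fails, e.g. T(x^n) = x^{3n+1}/(n+3/2) is bounded and not compact although h(s) = 1/(s+1) lies in L²(iR) and satisfies the integral condition. *)

theory Defs
  imports "HOL-Complex_Analysis.Complex_Analysis"
begin

section \<open>Operators on $L^2(0,1)$\<close>

text \<open>
  Elements of $L^2(0,1)$ are handled through Borel measurable representatives; their values
  outside the open unit interval are irrelevant, and equality in $L^2(0,1)$ is equality almost
  everywhere with respect to the measure below.
\<close>

abbreviation unit_interval :: "real measure" where
  "unit_interval \<equiv> restrict_space lborel {0<..<1}"

definition L2 :: "(real \<Rightarrow> complex) set" where
  "L2 = {f \<in> borel_measurable unit_interval. integrable unit_interval (\<lambda>x. (cmod (f x))\<^sup>2)}"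

definition L2_norm :: "(real \<Rightarrow> complex) \<Rightarrow> real" where
  "L2_norm f = sqrt (\<integral>x. (cmod (f x))\<^sup>2 \<partial>unit_interval)"

text \<open>
  An operator acts on representatives. It need not be assumed to respect equality almost
  everywhere: if $f = g$ almost everywhere then $T(f-g)$ has norm at most $K \cdot 0$, and
  additivity gives $Tf = Tg$ almost everywhere.
\<close>

definition bounded_operator_L2 :: "((real \<Rightarrow> complex) \<Rightarrow> (real \<Rightarrow> complex)) \<Rightarrow> bool" where
  "bounded_operator_L2 T \<longleftrightarrow>
     (\<forall>f\<in>L2. T f \<in> L2) \<and>
     (\<forall>f\<in>L2. \<forall>g\<in>L2. AE x in unit_interval. T (\<lambda>u. f u + g u) x = T f x + T g x) \<and>
     (\<forall>k. \<forall>f\<in>L2. AE x in unit_interval. T (\<lambda>u. k * f u) x = k * T f x) \<and>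
     (\<exists>K. \<forall>f\<in>L2. L2_norm (T f) \<le> K * L2_norm f)"

definition compact_operator_L2 :: "((real \<Rightarrow> complex) \<Rightarrow> (real \<Rightarrow> complex)) \<Rightarrow> bool" where
  "compact_operator_L2 T \<longleftrightarrow>
     (\<forall>f :: nat \<Rightarrow> real \<Rightarrow> complex.
        (\<forall>k. f k \<in> L2) \<and> (\<exists>B. \<forall>k. L2_norm (f k) \<le> B) \<longrightarrow>
        (\<exists>r g. strict_mono r \<and> g \<in> L2 \<and>
           (\<lambda>k. L2_norm (\<lambda>x. T (f (r k)) x - g x)) \<longlonglongrightarrow> 0))"

definition monomial_operator ::
  "((real \<Rightarrow> complex) \<Rightarrow> (real \<Rightarrow> complex)) \<Rightarrow> (nat \<Rightarrow> complex) \<Rightarrow> (nat \<Rightarrow> complex) \<Rightarrow> bool" where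
  "monomial_operator T c p \<longleftrightarrow>
     bounded_operator_L2 T \<and>
     (\<forall>n. Re (p n) > - 1 / 2) \<and>
     (\<forall>n. AE x in unit_interval.
        T (\<lambda>u. of_real u ^ n) x = c n * of_real x powr p n)"

definition affine_index :: "(nat \<Rightarrow> complex) \<Rightarrow> real \<Rightarrow> real \<Rightarrow> bool" where
  "affine_index p a b \<longleftrightarrow> a \<ge> 0 \<and> b \<ge> 0 \<and> (\<forall>n. p n = of_real (a * real n + b))"


section \<open>The Hardy space of the right half-plane\<close>

abbreviation RHP :: "complex set" where
  "RHP \<equiv> {s. Re s > 0}"

text \<open>
  Elements of the Hardy space are total functions of which only the values on the half-plane
  matter.
\<close>

definition H2 :: "(complex \<Rightarrow> complex) set" where
  "H2 = {F. F holomorphic_on RHP \<and>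
     (SUP x\<in>{0<..}. \<integral>\<^sup>+y. ennreal ((cmod (F (Complex x y)))\<^sup>2) \<partial>lborel) < \<infinity>}"

text \<open>
  The integrals of $|F(x+iy)|^2$ increase as $x$ decreases to $0$, so the supremum defining the
  norm is a limit, and polarisation gives the inner product as the limit below. The factor
  $1/(2\pi)$ makes the Laplace transform of $L^2(0,\infty)$ onto the Hardy space unitary.
\<close>

definition H2_inner :: "(complex \<Rightarrow> complex) \<Rightarrow> (complex \<Rightarrow> complex) \<Rightarrow> complex" where
  "H2_inner F G = Lim (at_right 0)
     (\<lambda>x::real. of_real (1 / (2 * pi)) *
        (\<integral>y. F (Complex x y) * cnj (G (Complex x y)) \<partial>lborel))"

text \<open>
  The substitution $x = e^{-t}$ is the unitary map taking $f \in L^2(0,1)$ to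
  $t \mapsto e^{-t/2} f(e^{-t})$ in $L^2(0,\infty)$. Followed by the Laplace transform it sends
  $x^n$ to $1/(s+n+\frac12)$.
\<close>

definition laplace_L2 :: "(real \<Rightarrow> complex) \<Rightarrow> complex \<Rightarrow> complex" where
  "laplace_L2 f s = (LBINT t:{0<..}. exp (- s * of_real t) * (of_real (exp (- t / 2)) * f (exp (- t))))"

text \<open>
  The operator $T_0 = U T U^{-1}$ with $U$ the map just defined. By the Paley--Wiener theorem
  every $F$ in the Hardy space is $Uf$ for some $f \in L^2(0,1)$; this $f$ is unique up to
  equality almost everywhere, so the choice does not affect the values on the half-plane.
\<close>

definition hardy_transfer ::
  "((real \<Rightarrow> complex) \<Rightarrow> (real \<Rightarrow> complex)) \<Rightarrow> (complex \<Rightarrow> complex) \<Rightarrow> (complex \<Rightarrow> complex)" where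
  "hardy_transfer T F = laplace_L2 (T (SOME f. f \<in> L2 \<and> (\<forall>s\<in>RHP. laplace_L2 f s = F s)))"


section \<open>The associated function\<close>

text \<open>
  The affine map with $n + \frac12 \mapsto an + b + \frac12$. It sends the imaginary axis to the
  line of real part $b + \frac12(1-a)$. When $a = 2b+1$ this is the imaginary axis itself and the
  compactness criterion below fails: $T(x^n) = x^{3n+1}/(n+\frac32)$ is bounded with
  $h(s) = 1/(s+1)$ square integrable on the axis, but $T$ is the isometry
  $f \mapsto \sqrt3\, x f(x^3)$ applied to $3^{-1/2}M$, where $M(x^z) = x^z/(z+\frac32)$ for all
  $z$ of real part above $-\frac12$, and $M$ has too many eigenvalues to be compact.
\<close>

definition affine_symbol :: "real \<Rightarrow> real \<Rightarrow> complex \<Rightarrow> complex" where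
  "affine_symbol a b s = of_real a * (s - 1 / 2) + of_real b + 1 / 2"

lemma affine_symbol_interpolates:
  "affine_symbol a b (of_nat n + 1 / 2) = of_real (a * real n + b) + 1 / 2"
  by (simp add: affine_symbol_def)

definition weighted_composition ::
  "(complex \<Rightarrow> complex) \<Rightarrow> (complex \<Rightarrow> complex) \<Rightarrow> (complex \<Rightarrow> complex) \<Rightarrow> (complex \<Rightarrow> complex)" where
  "weighted_composition h \<phi> G = (\<lambda>s. h s * G (\<phi> s))"

definition H2_adjoint ::
  "((complex \<Rightarrow> complex) \<Rightarrow> (complex \<Rightarrow> complex)) \<Rightarrow> ((complex \<Rightarrow> complex) \<Rightarrow> (complex \<Rightarrow> complex)) \<Rightarrow> bool" where
  "H2_adjoint A B \<longleftrightarrow>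
     (\<forall>G\<in>H2. B G \<in> H2 \<and> (\<forall>F\<in>H2. H2_inner (A F) G = H2_inner F (B G)))"

definition associated_function ::
  "((real \<Rightarrow> complex) \<Rightarrow> (real \<Rightarrow> complex)) \<Rightarrow> (nat \<Rightarrow> complex) \<Rightarrow> real \<Rightarrow> real \<Rightarrow> (complex \<Rightarrow> complex) \<Rightarrow> bool" where
  "associated_function T c a b h \<longleftrightarrow>
     h holomorphic_on RHP \<and>
     (\<forall>n. h (of_nat n + 1 / 2) = cnj (c n)) \<and>
     H2_adjoint (hardy_transfer T) (weighted_composition h (affine_symbol a b))"

text \<open>
  Boundary values on the imaginary axis as horizontal limits. For an associated function these
  exist almost everywhere and agree with the nontangential ones, since $h$ is then a quotient of a
  function of the Hardy space by the reciprocal of an affine function. The value at the remaining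
  points is unspecified and does not influence the integrals.
\<close>

definition boundary_value :: "(complex \<Rightarrow> complex) \<Rightarrow> real \<Rightarrow> complex" where
  "boundary_value h y = Lim (at_right 0) (\<lambda>x::real. h (Complex x y))"

text \<open>
  The integrals are taken in the extended nonnegative reals, so that a divergent integral counts
  as infinite and not as zero.
\<close>

definition vanishing_mean_condition :: "real \<Rightarrow> real \<Rightarrow> (complex \<Rightarrow> complex) \<Rightarrow> bool" where
  "vanishing_mean_condition a b h \<longleftrightarrow>
     (\<forall>\<epsilon>>0. \<exists>M>0. \<forall>t L. \<bar>t\<bar> \<ge> M \<and> L \<ge> b / 2 \<longrightarrow>
        (\<integral>\<^sup>+y\<in>{(t - L) / a..(t + L) / a}. ennreal ((cmod (boundary_value h y))\<^sup>2) \<partial>lborel)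
          < ennreal (\<epsilon> * L))"

definition square_integrable_boundary :: "(complex \<Rightarrow> complex) \<Rightarrow> bool" where
  "square_integrable_boundary h \<longleftrightarrow>
     (\<integral>\<^sup>+y. ennreal ((cmod (boundary_value h y))\<^sup>2) \<partial>lborel) < \<infinity>"

end

theory Submission
  imports Defs
begin

text \<open>
  Write $\beta = b + (1-a)/2$, so that the symbol is $\varphi(s) = as + \beta$. If $\beta < 0$, the symbol leaves
  the half-plane; elements of the Hardy space are total functions with arbitrary values off the
  half-plane, and this forces $h = 0$.

  If $\beta > 0$, let $G$ be the transform of $g$. Then
  $\|T^*g\|^2 = \frac{1}{2\pi}\int |h(iy)|^2 |G(\beta + iay)|^2 dy$. For necessity, take for $G$ the normalised
  kernels $\sqrt{2L}/(s + L - it)$: they tend weakly to $0$ as $|t| \to \infty$, whatever $L \ge b/2$, so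
  $\|T^*g\|^2 = \langle TT^*g, g\rangle$ tends to $0$ if $T$ is compact. For sufficiency,
  $\|Tf\|^2 \le \|f\| \|T^*Tf\|$, and the integral above is split: the part near $0$ is controlled by Montel's
  theorem, the tail by comparing the Poisson kernel of height $\beta$ with its averages over windows
  of width $b$.

  The transform is isometric on the span of the powers $u^z$ by Cauchy's formula, hence everywhere
  by density, and projecting onto this span gives the Paley--Wiener theorem. The boundary
  limits exist by a maximal inequality obtained from Vitali's covering lemma.
\<close>

section \<open>Square integrable functions\<close>

text \<open>The sign of \<beta> decides everything because the symbol sends the imaginary axis to
  the line of real part \<beta>. For \<beta> > 0 the transform of g is read at interior points,
  where it is a Poisson average of its boundary function. At the scale \<beta> such an average sees
  only the windowed masses of |h|^2, which is why a condition on windows can suffice. For \<beta> =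
  0 the smoothing is absent, and this is the case that \<open>a \<noteq> 2 * b + 1\<close> excludes.
  The bound b/2 on L serves both directions: it gives \<beta> + L \<le> (1 + 2\<beta>/b) L, so that
  the lower estimate for the test kernels is uniform in L, and windows with L = b/2 alone already
  control the tail. The norm identity concerns the adjoint while compactness is asked of T; applying
  it to g = Tf bridges the two. The condition on h speaks of limits as x tends to 0 through all
  positive values. Convergence in mean square yields pointwise limits along subsequences only, hence
  the maximal inequality.\<close>

definition Lsq :: "'a measure \<Rightarrow> ('a \<Rightarrow> complex) set" where
  "Lsq M = {f \<in> borel_measurable M. integrable M (\<lambda>x. (cmod (f x))\<^sup>2)}"

text \<open>The square of the norm: the parallelogram law, the isometry and Fatou's lemma then
  involve no roots.\<close>

definition sqnorm :: "'a measure \<Rightarrow> ('a \<Rightarrow> complex) \<Rightarrow> real" where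
  "sqnorm M f = (\<integral>x. (cmod (f x))\<^sup>2 \<partial>M)"

definition ip :: "'a measure \<Rightarrow> ('a \<Rightarrow> complex) \<Rightarrow> ('a \<Rightarrow> complex) \<Rightarrow> complex" where
  "ip M f g = (\<integral>x. f x * cnj (g x) \<partial>M)"

lemma L2_eq_Lsq: "L2 = Lsq unit_interval"
  by (simp add: L2_def Lsq_def)

lemma L2_norm_eq_sqnorm: "L2_norm f = sqrt (sqnorm unit_interval f)"
  by (simp add: L2_norm_def sqnorm_def)

lemma Lsq_measurable [measurable_dest]: "f \<in> Lsq M \<Longrightarrow> f \<in> borel_measurable M"
  by (simp add: Lsq_def)

lemma Lsq_integrable: "f \<in> Lsq M \<Longrightarrow> integrable M (\<lambda>x. (cmod (f x))\<^sup>2)"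
  by (simp add: Lsq_def)

lemma sqnorm_nonneg [simp]: "0 \<le> sqnorm M f"
  by (simp add: sqnorm_def)

lemma sqnorm_eq_nn_integral:
  assumes "f \<in> Lsq M"
  shows "(\<integral>\<^sup>+x. ennreal ((cmod (f x))\<^sup>2) \<partial>M) = ennreal (sqnorm M f)"
  unfolding sqnorm_def using assms by (intro nn_integral_eq_integral Lsq_integrable) auto

lemma Lsq_iff_nn_integral:
  "f \<in> Lsq M \<longleftrightarrow> f \<in> borel_measurable M \<and> (\<integral>\<^sup>+x. ennreal ((cmod (f x))\<^sup>2) \<partial>M) < \<infinity>"
  by (auto simp: Lsq_def integrable_iff_bounded)

lemma sqnorm_le_nn_integral:
  assumes "f \<in> borel_measurable M" "(\<integral>\<^sup>+x. ennreal ((cmod (f x))\<^sup>2) \<partial>M) \<le> ennreal K" "0 \<le> K"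
  shows "f \<in> Lsq M" "sqnorm M f \<le> K"
proof -
  show f: "f \<in> Lsq M"
    using assms by (auto simp: Lsq_iff_nn_integral intro: le_less_trans)
  show "sqnorm M f \<le> K"
    using sqnorm_eq_nn_integral[OF f] assms by simp
qed

lemma Lsq_mono:
  assumes "g \<in> Lsq M" "f \<in> borel_measurable M" "\<And>x. x \<in> space M \<Longrightarrow> cmod (f x) \<le> cmod (g x)"
  shows "f \<in> Lsq M" "sqnorm M f \<le> sqnorm M g"
proof -
  have "(\<integral>\<^sup>+x. ennreal ((cmod (f x))\<^sup>2) \<partial>M) \<le> (\<integral>\<^sup>+x. ennreal ((cmod (g x))\<^sup>2) \<partial>M)"
    by (intro nn_integral_mono ennreal_leI power_mono assms) auto
  also have "\<dots> = ennreal (sqnorm M g)"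
    by (rule sqnorm_eq_nn_integral[OF assms(1)])
  finally have *: "(\<integral>\<^sup>+x. ennreal ((cmod (f x))\<^sup>2) \<partial>M) \<le> ennreal (sqnorm M g)" .
  show "f \<in> Lsq M" "sqnorm M f \<le> sqnorm M g"
    using sqnorm_le_nn_integral[OF assms(2) *] by auto
qed

lemma Lsq_cong_AE:
  assumes "f \<in> Lsq M" "g \<in> borel_measurable M" "AE x in M. f x = g x"
  shows "g \<in> Lsq M"
proof -
  note [measurable] = Lsq_measurable[OF assms(1)] assms(2)
  have "(\<integral>\<^sup>+x. ennreal ((cmod (g x))\<^sup>2) \<partial>M) = (\<integral>\<^sup>+x. ennreal ((cmod (f x))\<^sup>2) \<partial>M)"
    using assms(3) by (intro nn_integral_cong_AE) auto
  with assms show ?thesis by (simp add: Lsq_iff_nn_integral)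
qed

lemma sqnorm_cong_AE:
  assumes "f \<in> borel_measurable M" "g \<in> borel_measurable M" "AE x in M. f x = g x"
  shows "sqnorm M f = sqnorm M g"
  unfolding sqnorm_def
proof (rule integral_cong_AE)
  show "(\<lambda>x. (cmod (f x))\<^sup>2) \<in> borel_measurable M" "(\<lambda>x. (cmod (g x))\<^sup>2) \<in> borel_measurable M"
    using assms(1,2) by measurable
qed (use assms(3) in auto)

lemma sqnorm_eq_0_imp_AE:
  assumes "f \<in> Lsq M" "sqnorm M f = 0"
  shows "AE x in M. f x = 0"
  using integral_nonneg_eq_0_iff_AE[OF Lsq_integrable[OF assms(1)]] assms(2)
  by (simp add: sqnorm_def)

lemma Lsq_zero [simp]: "(\<lambda>x. 0) \<in> Lsq M"
  by (simp add: Lsq_def)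

lemma sqnorm_zero [simp]: "sqnorm M (\<lambda>x. 0) = 0"
  by (simp add: sqnorm_def)

lemma Lsq_scale:
  assumes "f \<in> Lsq M" shows "(\<lambda>x. k * f x) \<in> Lsq M"
proof -
  note [measurable] = Lsq_measurable[OF assms]
  have "integrable M (\<lambda>x. (cmod k)\<^sup>2 * (cmod (f x))\<^sup>2)"
    using Lsq_integrable[OF assms] by simp
  then show ?thesis
    by (simp add: Lsq_def norm_mult power_mult_distrib)
qed

lemma sqnorm_scale: "sqnorm M (\<lambda>x. k * f x) = (cmod k)\<^sup>2 * sqnorm M f"
  by (simp add: sqnorm_def norm_mult power_mult_distrib)

lemma Lsq_uminus: "f \<in> Lsq M \<Longrightarrow> (\<lambda>x. - f x) \<in> Lsq M"
  using Lsq_scale[of f M "-1"] by simp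

lemma cmod_add_sq_le: "(cmod (a + b))\<^sup>2 \<le> 2 * (cmod a)\<^sup>2 + 2 * (cmod b)\<^sup>2"
proof -
  have "(cmod (a + b))\<^sup>2 \<le> (cmod a + cmod b)\<^sup>2"
    by (intro power_mono norm_triangle_ineq) auto
  also have "\<dots> \<le> 2 * (cmod a)\<^sup>2 + 2 * (cmod b)\<^sup>2"
    using sum_squares_bound[of "cmod a" "cmod b"] by (simp add: power2_sum)
  finally show ?thesis .
qed

lemma Lsq_add:
  assumes "f \<in> Lsq M" "g \<in> Lsq M" shows "(\<lambda>x. f x + g x) \<in> Lsq M"
proof -
  note [measurable] = Lsq_measurable[OF assms(1)] Lsq_measurable[OF assms(2)]
  have "integrable M (\<lambda>x. 2 * (cmod (f x))\<^sup>2 + 2 * (cmod (g x))\<^sup>2)"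
    using Lsq_integrable[OF assms(1)] Lsq_integrable[OF assms(2)] by auto
  then have "integrable M (\<lambda>x. (cmod (f x + g x))\<^sup>2)"
    by (rule Bochner_Integration.integrable_bound) (auto intro!: cmod_add_sq_le)
  then show ?thesis by (simp add: Lsq_def)
qed

lemma Lsq_diff: "f \<in> Lsq M \<Longrightarrow> g \<in> Lsq M \<Longrightarrow> (\<lambda>x. f x - g x) \<in> Lsq M"
  using Lsq_add[OF _ Lsq_uminus, of f M g] by simp

lemma Lsq_mult_integrable:
  assumes "f \<in> Lsq M" "g \<in> Lsq M" shows "integrable M (\<lambda>x. f x * g x)"
proof -
  note [measurable] = Lsq_measurable[OF assms(1)] Lsq_measurable[OF assms(2)]
  have "integrable M (\<lambda>x. (cmod (f x))\<^sup>2 + (cmod (g x))\<^sup>2)"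
    using Lsq_integrable[OF assms(1)] Lsq_integrable[OF assms(2)] by auto
  then show ?thesis
  proof (rule Bochner_Integration.integrable_bound)
    have "cmod (f x * g x) \<le> (cmod (f x))\<^sup>2 + (cmod (g x))\<^sup>2" for x
    proof -
      have "2 * (cmod (f x) * cmod (g x)) \<le> (cmod (f x))\<^sup>2 + (cmod (g x))\<^sup>2"
        using sum_squares_bound[of "cmod (f x)" "cmod (g x)"] by (simp add: mult.assoc)
      moreover have "0 \<le> cmod (f x) * cmod (g x)" by simp
      ultimately show ?thesis unfolding norm_mult by linarith
    qed
    then show "AE x in M. norm (f x * g x) \<le> norm ((cmod (f x))\<^sup>2 + (cmod (g x))\<^sup>2)"
      by auto
  qed measurable
qed

lemma borel_measurable_cnj [measurable (raw)]:
  "f \<in> borel_measurable M \<Longrightarrow> (\<lambda>x. cnj (f x)) \<in> borel_measurable M"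
  by (rule borel_measurable_continuous_on[of cnj]) (intro continuous_intros)

lemma Lsq_cnj: "f \<in> Lsq M \<Longrightarrow> (\<lambda>x. cnj (f x)) \<in> Lsq M"
  by (simp add: Lsq_def borel_measurable_cnj)

lemma ip_integrable: "f \<in> Lsq M \<Longrightarrow> g \<in> Lsq M \<Longrightarrow> integrable M (\<lambda>x. f x * cnj (g x))"
  by (intro Lsq_mult_integrable Lsq_cnj)

text \<open>The moduli stay inside the integral, so that an integral of \<open>cmod\<close> can be
  bounded as well; the horizontal sides of Cauchy's rectangles need this.\<close>

lemma Cauchy_Schwarz_Lsq:
  assumes "f \<in> Lsq M" "g \<in> Lsq M"
  shows "(\<integral>x. cmod (f x) * cmod (g x) \<partial>M)\<^sup>2 \<le> sqnorm M f * sqnorm M g"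
proof -
  note [measurable] = Lsq_measurable[OF assms(1)] Lsq_measurable[OF assms(2)]
  have i: "integrable M (\<lambda>x. cmod (f x) * cmod (g x))"
    using integrable_norm[OF Lsq_mult_integrable[OF assms]] by (simp add: norm_mult)
  have "(\<integral>\<^sup>+x. ennreal (cmod (f x)) * ennreal (cmod (g x)) \<partial>M)\<^sup>2
      \<le> (\<integral>\<^sup>+x. ennreal (cmod (f x)) ^ 2 \<partial>M) * (\<integral>\<^sup>+x. ennreal (cmod (g x)) ^ 2 \<partial>M)"
    by (rule Cauchy_Schwarz_nn_integral) auto
  also have "(\<integral>\<^sup>+x. ennreal (cmod (f x)) * ennreal (cmod (g x)) \<partial>M)
      = ennreal (\<integral>x. cmod (f x) * cmod (g x) \<partial>M)"
    using i by (subst nn_integral_eq_integral[symmetric]) (auto simp: ennreal_mult')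
  also have "(\<integral>\<^sup>+x. ennreal (cmod (f x)) ^ 2 \<partial>M) = ennreal (sqnorm M f)"
    using sqnorm_eq_nn_integral[OF assms(1)] by (simp add: ennreal_power)
  also have "(\<integral>\<^sup>+x. ennreal (cmod (g x)) ^ 2 \<partial>M) = ennreal (sqnorm M g)"
    using sqnorm_eq_nn_integral[OF assms(2)] by (simp add: ennreal_power)
  finally show ?thesis
    by (simp add: ennreal_power flip: ennreal_mult)
qed

lemma ip_le:
  assumes "f \<in> Lsq M" "g \<in> Lsq M"
  shows "(cmod (ip M f g))\<^sup>2 \<le> sqnorm M f * sqnorm M g"
proof -
  have "cmod (ip M f g) \<le> (\<integral>x. cmod (f x * cnj (g x)) \<partial>M)"
    unfolding ip_def by (rule integral_norm_bound)
  also have "\<dots> = (\<integral>x. cmod (f x) * cmod (g x) \<partial>M)"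
    by (simp add: norm_mult)
  finally have "(cmod (ip M f g))\<^sup>2 \<le> (\<integral>x. cmod (f x) * cmod (g x) \<partial>M)\<^sup>2"
    by (intro power_mono) auto
  with Cauchy_Schwarz_Lsq[OF assms] show ?thesis by linarith
qed

lemma ip_le_sqrt:
  assumes "f \<in> Lsq M" "g \<in> Lsq M"
  shows "cmod (ip M f g) \<le> sqrt (sqnorm M f) * sqrt (sqnorm M g)"
  using real_sqrt_le_mono[OF ip_le[OF assms]] by (simp add: real_sqrt_mult)

lemma ip_self: "ip M f f = of_real (sqnorm M f)"
proof -
  have "ip M f f = (\<integral>x. complex_of_real ((cmod (f x))\<^sup>2) \<partial>M)"
    unfolding ip_def by (simp only: complex_norm_square)
  then show ?thesis
    unfolding sqnorm_def by (simp only: integral_complex_of_real)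
qed

lemma ip_add_left:
  assumes "f \<in> Lsq M" "g \<in> Lsq M" "k \<in> Lsq M"
  shows "ip M (\<lambda>x. f x + g x) k = ip M f k + ip M g k"
  unfolding ip_def using assms
  by (subst Bochner_Integration.integral_add[symmetric]) (auto intro!: ip_integrable simp: algebra_simps)

lemma ip_scale_left: "ip M (\<lambda>x. c * f x) k = c * ip M f k"
  unfolding ip_def by (simp add: mult.assoc)

lemma ip_commute: "ip M f g = cnj (ip M g f)"
proof -
  have "cnj (ip M g f) = (\<integral>x. cnj (g x * cnj (f x)) \<partial>M)"
    unfolding ip_def by (rule integral_bounded_linear'[OF bounded_linear_cnj bounded_linear_cnj, symmetric]) simp
  then show ?thesis by (simp add: ip_def mult.commute)
qed

lemma ip_diff_left:
  assumes "f \<in> Lsq M" "g \<in> Lsq M" "k \<in> Lsq M"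
  shows "ip M (\<lambda>x. f x - g x) k = ip M f k - ip M g k"
  using ip_add_left[OF assms(1) Lsq_scale[OF assms(2), of "-1"] assms(3)] ip_scale_left[of M "-1" g k]
  by simp

lemma ip_add_right:
  assumes "f \<in> Lsq M" "g \<in> Lsq M" "k \<in> Lsq M"
  shows "ip M k (\<lambda>x. f x + g x) = ip M k f + ip M k g"
  using ip_add_left[OF assms] by (simp add: ip_commute[of M k])

lemma ip_scale_right: "ip M k (\<lambda>x. c * f x) = cnj c * ip M k f"
  by (simp add: ip_commute[of M k] ip_scale_left)

lemma ip_cong_AE:
  assumes "f \<in> Lsq M" "f' \<in> Lsq M" "g \<in> Lsq M" "g' \<in> Lsq M"
    and "AE x in M. f x = f' x" "AE x in M. g x = g' x"
  shows "ip M f g = ip M f' g'"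
  unfolding ip_def
proof (rule integral_cong_AE)
  show "AE x in M. f x * cnj (g x) = f' x * cnj (g' x)"
    using assms(5,6) by eventually_elim simp
  note [measurable] = assms(1-4)[THEN Lsq_measurable]
  show "(\<lambda>x. f x * cnj (g x)) \<in> borel_measurable M" "(\<lambda>x. f' x * cnj (g' x)) \<in> borel_measurable M"
    by measurable
qed

lemma sqnorm_add:
  assumes "f \<in> Lsq M" "g \<in> Lsq M"
  shows "sqnorm M (\<lambda>x. f x + g x) = sqnorm M f + sqnorm M g + 2 * Re (ip M f g)"
proof -
  have "complex_of_real (sqnorm M (\<lambda>x. f x + g x)) = ip M (\<lambda>x. f x + g x) (\<lambda>x. f x + g x)"
    by (simp add: ip_self)
  also have "\<dots> = ip M f f + ip M g f + (ip M f g + ip M g g)"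
    using assms by (simp add: ip_add_left ip_add_right Lsq_add)
  also have "ip M g f = cnj (ip M f g)" by (rule ip_commute)
  finally have "Re (complex_of_real (sqnorm M (\<lambda>x. f x + g x)))
      = Re (ip M f f + cnj (ip M f g) + (ip M f g + ip M g g))" by simp
  then show ?thesis by (simp add: ip_self)
qed

lemma sqnorm_diff:
  assumes "f \<in> Lsq M" "g \<in> Lsq M"
  shows "sqnorm M (\<lambda>x. f x - g x) = sqnorm M f + sqnorm M g - 2 * Re (ip M f g)"
  using sqnorm_add[OF assms(1) Lsq_scale[OF assms(2), of "-1"]] sqnorm_scale[of M "-1" g] ip_scale_right[of M f "-1" g]
  by simp

lemma sqnorm_diff_commute: "sqnorm M (\<lambda>x. f x - g x) = sqnorm M (\<lambda>x. g x - f x)"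
  by (simp add: sqnorm_def norm_minus_commute)

lemma Minkowski_Lsq:
  assumes "f \<in> Lsq M" "g \<in> Lsq M"
  shows "sqrt (sqnorm M (\<lambda>x. f x + g x)) \<le> sqrt (sqnorm M f) + sqrt (sqnorm M g)"
proof (rule real_le_lsqrt)
  have "Re (ip M f g) \<le> sqrt (sqnorm M f) * sqrt (sqnorm M g)"
    using ip_le_sqrt[OF assms] complex_Re_le_cmod[of "ip M f g"] by linarith
  then show "sqnorm M (\<lambda>x. f x + g x) \<le> (sqrt (sqnorm M f) + sqrt (sqnorm M g))\<^sup>2"
    by (simp add: sqnorm_add[OF assms] power2_sum mult.assoc)
qed auto

text \<open>The parallelogram law with one square dropped; the factor 2 is the price of squared
  norms.\<close>

lemma sqnorm_add_le:
  assumes "f \<in> Lsq M" "g \<in> Lsq M"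
  shows "sqnorm M (\<lambda>x. f x + g x) \<le> 2 * sqnorm M f + 2 * sqnorm M g"
proof -
  have "sqnorm M (\<lambda>x. f x + g x) + sqnorm M (\<lambda>x. f x - g x) = 2 * sqnorm M f + 2 * sqnorm M g"
    by (simp add: sqnorm_add sqnorm_diff assms)
  then show ?thesis using sqnorm_nonneg[of M "\<lambda>x. f x - g x"] by linarith
qed

lemma sqnorm_diff_le:
  assumes "f \<in> Lsq M" "g \<in> Lsq M"
  shows "sqnorm M (\<lambda>x. f x - g x) \<le> 2 * sqnorm M f + 2 * sqnorm M g"
  using sqnorm_add_le[OF assms(1) Lsq_scale[OF assms(2), of "-1"]] sqnorm_scale[of M "-1" g]
  by simp

lemma sqnorm_triangle:
  assumes "f \<in> Lsq M" "g \<in> Lsq M" "k \<in> Lsq M"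
  shows "sqnorm M (\<lambda>x. f x - k x) \<le> 2 * sqnorm M (\<lambda>x. f x - g x) + 2 * sqnorm M (\<lambda>x. g x - k x)"
  using sqnorm_add_le[OF Lsq_diff[OF assms(1,2)] Lsq_diff[OF assms(2,3)]] by simp

section \<open>Mean-square convergence and completeness\<close>

lemma sqnorm_LIMSEQ_imp_AE_subseq:
  assumes "\<And>n. f n \<in> Lsq M" "g \<in> Lsq M" "(\<lambda>n. sqnorm M (\<lambda>x. f n x - g x)) \<longlonglongrightarrow> 0"
  shows "\<exists>r::nat\<Rightarrow>nat. strict_mono r \<and> (AE x in M. (\<lambda>n. f (r n) x) \<longlonglongrightarrow> g x)"
proof -
  have "\<exists>r::nat\<Rightarrow>nat. strict_mono r \<and> (AE x in M. (\<lambda>n. (cmod (f (r n) x - g x))\<^sup>2) \<longlonglongrightarrow> 0)"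
    using assms(3)
    by (intro tendsto_L1_AE_subseq Lsq_integrable Lsq_diff assms) (simp_all add: sqnorm_def)
  then obtain r :: "nat \<Rightarrow> nat" where r: "strict_mono r"
    and *: "AE x in M. (\<lambda>n. (cmod (f (r n) x - g x))\<^sup>2) \<longlonglongrightarrow> 0" by blast
  have "AE x in M. (\<lambda>n. f (r n) x) \<longlonglongrightarrow> g x"
    using *
  proof eventually_elim
    case (elim x)
    then have "(\<lambda>n. sqrt ((cmod (f (r n) x - g x))\<^sup>2)) \<longlonglongrightarrow> sqrt 0"
      by (rule tendsto_real_sqrt)
    then show ?case
      by (simp add: tendsto_norm_zero_iff LIM_zero_iff)
  qed
  with r show ?thesis by blast
qed

text \<open>A subsequence of a mean-square convergent sequence converges almost everywhere, so the
  two limits agree. Used to recognise a boundary function obtained by completeness as a concrete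
  one.\<close>

lemma sqnorm_LIMSEQ_unique_AE:
  assumes f: "\<And>n. f n \<in> Lsq M" "g \<in> Lsq M" "(\<lambda>n. sqnorm M (\<lambda>x. f n x - g x)) \<longlonglongrightarrow> 0"
    and k: "\<And>x. x \<in> space M \<Longrightarrow> (\<lambda>n. f n x) \<longlonglongrightarrow> k x"
  shows "AE x in M. g x = k x"
proof -
  obtain r :: "nat \<Rightarrow> nat" where r: "strict_mono r"
    and *: "AE x in M. (\<lambda>n. f (r n) x) \<longlonglongrightarrow> g x"
    using sqnorm_LIMSEQ_imp_AE_subseq[OF f] by blast
  show ?thesis
    using * AE_space
  proof eventually_elim
    case (elim x)
    show ?case
      using LIMSEQ_unique[OF elim(1)] LIMSEQ_subseq_LIMSEQ[OF k[OF elim(2)] r] by (simp add: o_def)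
  qed
qed

text \<open>Fatou's lemma, giving membership together with the bound, for limits that are known
  pointwise only.\<close>

lemma sqnorm_Fatou:
  assumes "\<And>n. f n \<in> Lsq M" "g \<in> borel_measurable M" "AE x in M. (\<lambda>n. f n x) \<longlonglongrightarrow> g x"
    and "eventually (\<lambda>n. sqnorm M (f n) \<le> K) sequentially" "0 \<le> K"
  shows "g \<in> Lsq M" "sqnorm M g \<le> K"
proof -
  note [measurable] = Lsq_measurable[OF assms(1)] assms(2)
  have "(\<integral>\<^sup>+x. ennreal ((cmod (g x))\<^sup>2) \<partial>M) = (\<integral>\<^sup>+x. liminf (\<lambda>n. ennreal ((cmod (f n x))\<^sup>2)) \<partial>M)"
  proof (rule nn_integral_cong_AE, use assms(3) in eventually_elim)
    case (elim x)
    then have "(\<lambda>n. ennreal ((cmod (f n x))\<^sup>2)) \<longlonglongrightarrow> ennreal ((cmod (g x))\<^sup>2)"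
      by (intro tendsto_intros)
    then show ?case using lim_imp_Liminf by force
  qed
  also have "\<dots> \<le> liminf (\<lambda>n. \<integral>\<^sup>+x. ennreal ((cmod (f n x))\<^sup>2) \<partial>M)"
    by (rule nn_integral_liminf) measurable
  also have "\<dots> = liminf (\<lambda>n. ennreal (sqnorm M (f n)))"
    using sqnorm_eq_nn_integral[OF assms(1)] by simp
  also have "\<dots> \<le> ennreal K"
  proof (rule order_trans[OF Liminf_le_Limsup Limsup_bounded])
    show "\<forall>\<^sub>F n in sequentially. ennreal (sqnorm M (f n)) \<le> ennreal K"
      using assms(4) by eventually_elim (rule ennreal_leI)
  qed auto
  finally have *: "(\<integral>\<^sup>+x. ennreal ((cmod (g x))\<^sup>2) \<partial>M) \<le> ennreal K" .
  show "g \<in> Lsq M" "sqnorm M g \<le> K"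
    using sqnorm_le_nn_integral[OF _ *] assms by auto
qed

text \<open>Riesz--Fischer on representatives: a fast subsequence converges almost everywhere, and
  Fatou's lemma turns the Cauchy condition into convergence to its limit.\<close>

lemma Lsq_complete:
  fixes f :: "nat \<Rightarrow> 'a \<Rightarrow> complex"
  assumes f: "\<And>n. f n \<in> Lsq M"
    and cauchy: "\<And>e. e > 0 \<Longrightarrow> \<exists>N. \<forall>m\<ge>N. \<forall>n\<ge>N. sqnorm M (\<lambda>x. f m x - f n x) < e"
  shows "\<exists>g\<in>Lsq M. (\<lambda>n. sqnorm M (\<lambda>x. f n x - g x)) \<longlonglongrightarrow> 0"
proof -
  note [measurable] = Lsq_measurable[OF f]
  \<comment> \<open>The rate 4^-k leaves room for the weights 2^k below: the weighted sum of squares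
    still has finite integral, and its finiteness at a point eventually forces the increments below
    2^(-k/2), which is summable.\<close>
  obtain N where N: "\<And>k m n. m \<ge> N k \<Longrightarrow> n \<ge> N k \<Longrightarrow> sqnorm M (\<lambda>x. f m x - f n x) < (1/4)^k"
    using cauchy[of "(1/4)^k" for k] by (metis zero_less_divide_1_iff zero_less_numeral zero_less_power)
  \<comment> \<open>The sum makes \<open>r\<close> dominate \<open>N\<close>, and the summand k
    makes it strictly increasing.\<close>
  define r where "r k = k + (\<Sum>j\<le>k. N j)" for k
  have r: "strict_mono r"
    by (rule strict_monoI_Suc) (simp add: r_def)
  have rN: "r k \<ge> N k" for k
  proof -
    have "N k \<le> (\<Sum>j\<le>k. N j)" by (rule member_le_sum) auto
    then show ?thesis by (simp add: r_def)
  qed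
  define d where "d k x = cmod (f (r (Suc k)) x - f (r k) x)" for k x
  have d_meas [measurable]: "d k \<in> borel_measurable M" for k
    unfolding d_def by measurable
  have d_int: "(\<integral>\<^sup>+x. ennreal (2^k * (d k x)\<^sup>2) \<partial>M) \<le> ennreal ((1/2)^k)" for k
  proof -
    have "(\<integral>\<^sup>+x. ennreal (2^k * (d k x)\<^sup>2) \<partial>M)
        = ennreal (2^k) * (\<integral>\<^sup>+x. ennreal ((cmod (f (r (Suc k)) x - f (r k) x))\<^sup>2) \<partial>M)"
      by (subst nn_integral_cmult[symmetric]) (auto simp: d_def ennreal_mult)
    also have "\<dots> = ennreal (2^k * sqnorm M (\<lambda>x. f (r (Suc k)) x - f (r k) x))"
      by (subst sqnorm_eq_nn_integral[OF Lsq_diff[OF f f]]) (simp add: ennreal_mult)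
    also have "\<dots> \<le> ennreal (2^k * (1/4)^k)"
      using N[of k "r (Suc k)" "r k"] rN[of k] strict_monoD[OF r, of k "Suc k"]
      by (intro ennreal_leI mult_left_mono) auto
    also have "(2^k * (1/4)^k :: real) = (1/2)^k"
      by (simp flip: power_mult_distrib)
    finally show ?thesis .
  qed
  have "(\<integral>\<^sup>+x. (\<Sum>k. ennreal (2^k * (d k x)\<^sup>2)) \<partial>M) = (\<Sum>k. \<integral>\<^sup>+x. ennreal (2^k * (d k x)\<^sup>2) \<partial>M)"
    by (rule nn_integral_suminf) measurable
  also have "\<dots> \<le> (\<Sum>k. ennreal ((1/2)^k))"
    by (intro suminf_le d_int) auto
  also have "\<dots> = ennreal (\<Sum>k. (1/2)^k)"
    by (rule suminf_ennreal2) auto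
  also have "\<dots> < \<infinity>" by simp
  finally have "AE x in M. (\<Sum>k. ennreal (2^k * (d k x)\<^sup>2)) \<noteq> \<infinity>"
    by (intro nn_integral_PInf_AE) (auto simp: less_top)
  then have conv: "AE x in M. convergent (\<lambda>k. f (r k) x)"
  proof eventually_elim
    case (elim x)
    then have "summable (\<lambda>k. 2^k * (d k x)\<^sup>2)"
      by (intro summable_suminf_not_top) auto
    then have "(\<lambda>k. 2^k * (d k x)\<^sup>2) \<longlonglongrightarrow> 0" by (rule summable_LIMSEQ_zero)
    then have "eventually (\<lambda>k. 2^k * (d k x)\<^sup>2 < 1) sequentially"
      by (rule order_tendstoD) simp
    then have ev: "eventually (\<lambda>k. norm (f (r (Suc k)) x - f (r k) x) \<le> (1 / sqrt 2)^k) sequentially"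
    proof eventually_elim
      case (elim k)
      have "d k x = sqrt ((d k x)\<^sup>2)" by (simp add: d_def)
      also have "\<dots> \<le> sqrt ((1/2)^k)"
        using elim by (intro real_sqrt_le_mono) (simp add: field_simps power_one_over)
      also have "\<dots> = (1 / sqrt 2)^k" by (simp add: real_sqrt_power real_sqrt_divide)
      finally show ?case by (simp add: d_def)
    qed
    have "summable (\<lambda>k. f (r (Suc k)) x - f (r k) x)"
      by (rule summable_comparison_test_ev[OF ev]) (simp add: summable_geometric)
    then have "convergent (\<lambda>n. (\<Sum>k<n. f (r (Suc k)) x - f (r k) x))"
      by (simp add: summable_iff_convergent)
    then have "convergent (\<lambda>n. f (r n) x - f (r 0) x)"
      using sum_lessThan_telescope[of "\<lambda>k. f (r k) x"] by simp
    then have "convergent (\<lambda>n. (f (r n) x - f (r 0) x) + f (r 0) x)"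
      by (rule convergent_add) (rule convergent_const)
    then show ?case by simp
  qed
  \<comment> \<open>At points of divergence the value of \<open>lim\<close> is arbitrary; these form
    a null set.\<close>
  define g where "g x = lim (\<lambda>k. f (r k) x)" for x
  have g [measurable]: "g \<in> borel_measurable M"
    unfolding g_def by measurable
  have lim: "AE x in M. (\<lambda>k. f (r k) x) \<longlonglongrightarrow> g x"
    using conv by eventually_elim (simp add: g_def convergent_LIMSEQ_iff)
  \<comment> \<open>Fatou's lemma in the second index, with m fixed.\<close>
  have key: "(\<lambda>x. f m x - g x) \<in> Lsq M \<and> sqnorm M (\<lambda>x. f m x - g x) \<le> e"
    if "\<And>n. n \<ge> n0 \<Longrightarrow> sqnorm M (\<lambda>x. f m x - f n x) \<le> e" "e > 0" for m n0 e
  proof -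
    have ev: "eventually (\<lambda>k. sqnorm M (\<lambda>x. f m x - f (r k) x) \<le> e) sequentially"
      using eventually_ge_at_top[of n0]
    proof eventually_elim
      case (elim k)
      then have "r k \<ge> n0" using seq_suble[OF r, of k] by linarith
      then show ?case using that by blast
    qed
    have lim': "AE x in M. (\<lambda>k. f m x - f (r k) x) \<longlonglongrightarrow> f m x - g x"
      using lim by eventually_elim (intro tendsto_intros)
    have "(\<lambda>x. f m x - g x) \<in> borel_measurable M" by measurable
    from sqnorm_Fatou[OF Lsq_diff[OF f f] this lim' ev] that(2) show ?thesis by simp
  qed
  obtain N1 where N1: "\<forall>m\<ge>N1. \<forall>n\<ge>N1. sqnorm M (\<lambda>x. f m x - f n x) < 1"
    using cauchy[of 1] by auto
  have "(\<lambda>x. f N1 x - g x) \<in> Lsq M"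
    using key[of N1 N1 1] N1 by (simp add: less_imp_le)
  from Lsq_diff[OF f[of N1] this] have gL: "g \<in> Lsq M" by simp
  moreover have "(\<lambda>n. sqnorm M (\<lambda>x. f n x - g x)) \<longlonglongrightarrow> 0"
  proof (rule LIMSEQ_I)
    fix e :: real assume "e > 0"
    then obtain N2 where N2: "\<forall>m\<ge>N2. \<forall>n\<ge>N2. sqnorm M (\<lambda>x. f m x - f n x) < e/2"
      using cauchy[of "e/2"] by auto
    have "norm (sqnorm M (\<lambda>x. f m x - g x) - 0) < e" if "m \<ge> N2" for m
      using key[of N2 m "e/2"] N2 that \<open>e > 0\<close> by (force simp: less_imp_le)
    then show "\<exists>no. \<forall>n\<ge>no. norm (sqnorm M (\<lambda>x. f n x - g x) - 0) < e" by blast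
  qed
  ultimately show ?thesis by blast
qed

lemma sqnorm_LIMSEQ_Cauchy:
  assumes f: "\<And>n. f n \<in> Lsq M" and g: "g \<in> Lsq M"
    and lim: "(\<lambda>n. sqnorm M (\<lambda>x. f n x - g x)) \<longlonglongrightarrow> 0" and "e > 0"
  shows "\<exists>N. \<forall>m\<ge>N. \<forall>n\<ge>N. sqnorm M (\<lambda>x. f m x - f n x) < e"
proof -
  have "eventually (\<lambda>n. sqnorm M (\<lambda>x. f n x - g x) < e / 4) sequentially"
    using lim \<open>e > 0\<close> by (intro order_tendstoD) auto
  then obtain N where N: "\<And>n. n \<ge> N \<Longrightarrow> sqnorm M (\<lambda>x. f n x - g x) < e / 4"
    by (auto simp: eventually_sequentially)
  have "sqnorm M (\<lambda>x. f m x - f n x) < e" if "m \<ge> N" "n \<ge> N" for m n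
  proof -
    have "sqnorm M (\<lambda>x. f m x - f n x)
        \<le> 2 * sqnorm M (\<lambda>x. f m x - g x) + 2 * sqnorm M (\<lambda>x. g x - f n x)"
      by (intro sqnorm_triangle f g)
    also have "\<dots> < e"
      using N[OF that(1)] N[OF that(2)] sqnorm_diff_commute[of M g "f n"] by simp
    finally show ?thesis .
  qed
  then show ?thesis by blast
qed

lemma sqrt_sqnorm_diff_le:
  assumes "f \<in> Lsq M" "g \<in> Lsq M"
  shows "\<bar>sqrt (sqnorm M f) - sqrt (sqnorm M g)\<bar> \<le> sqrt (sqnorm M (\<lambda>x. f x - g x))"
  using Minkowski_Lsq[OF assms(2) Lsq_diff[OF assms]]
    Minkowski_Lsq[OF assms(1) Lsq_diff[OF assms(2,1)]] sqnorm_diff_commute[of M f g]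
  by (auto simp: abs_le_iff)

lemma sqnorm_LIMSEQ:
  assumes f: "\<And>n. f n \<in> Lsq M" and g: "g \<in> Lsq M"
    and lim: "(\<lambda>n. sqnorm M (\<lambda>x. f n x - g x)) \<longlonglongrightarrow> 0"
  shows "(\<lambda>n. sqnorm M (f n)) \<longlonglongrightarrow> sqnorm M g"
proof -
  have "(\<lambda>n. sqrt (sqnorm M (f n)) - sqrt (sqnorm M g)) \<longlonglongrightarrow> 0"
  proof (rule tendsto_0_le[OF _ , of _ _ _ 1])
    show "(\<lambda>n. sqrt (sqnorm M (\<lambda>x. f n x - g x))) \<longlonglongrightarrow> 0"
      using tendsto_real_sqrt[OF lim] by simp
    show "\<forall>\<^sub>F n in sequentially. norm (sqrt (sqnorm M (f n)) - sqrt (sqnorm M g))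
        \<le> norm (sqrt (sqnorm M (\<lambda>x. f n x - g x))) * 1"
      using sqrt_sqnorm_diff_le[OF f g] by auto
  qed
  then have "(\<lambda>n. (sqrt (sqnorm M (f n)))\<^sup>2) \<longlonglongrightarrow> (sqrt (sqnorm M g))\<^sup>2"
    by (intro tendsto_power) (simp add: LIM_zero_iff)
  then show ?thesis by simp
qed

lemma ip_LIMSEQ:
  assumes f: "\<And>n. f n \<in> Lsq M" and g: "g \<in> Lsq M" and k: "k \<in> Lsq M"
    and lim: "(\<lambda>n. sqnorm M (\<lambda>x. f n x - g x)) \<longlonglongrightarrow> 0"
  shows "(\<lambda>n. ip M (f n) k) \<longlonglongrightarrow> ip M g k"
proof -
  have "(\<lambda>n. ip M (f n) k - ip M g k) \<longlonglongrightarrow> 0"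
  proof (rule tendsto_0_le[where K = "sqrt (sqnorm M k)"])
    show "(\<lambda>n. sqrt (sqnorm M (\<lambda>x. f n x - g x))) \<longlonglongrightarrow> 0"
      using tendsto_real_sqrt[OF lim] by simp
    show "\<forall>\<^sub>F n in sequentially. norm (ip M (f n) k - ip M g k)
        \<le> norm (sqrt (sqnorm M (\<lambda>x. f n x - g x))) * sqrt (sqnorm M k)"
      using ip_le_sqrt[OF Lsq_diff[OF f g] k] by (simp add: ip_diff_left f g k)
  qed
  then show ?thesis by (simp add: LIM_zero_iff)
qed

section \<open>Density of polynomials and the transform on the unit interval\<close>

lemma space_unit_interval [simp]: "space unit_interval = {0<..<1}"
  by (simp add: space_restrict_space)

lemma borel_measurable_unit_interval:
  "f \<in> borel_measurable borel \<Longrightarrow> f \<in> borel_measurable unit_interval"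
  by (rule measurable_restrict_space1) simp

lemma sqnorm_dominated:
  assumes "\<And>n. f n \<in> Lsq M" "g \<in> Lsq M" "integrable M w"
    and "\<And>x n. x \<in> space M \<Longrightarrow> (cmod (f n x - g x))\<^sup>2 \<le> w x"
    and "\<And>x. x \<in> space M \<Longrightarrow> (\<lambda>n. f n x) \<longlonglongrightarrow> g x"
  shows "(\<lambda>n. sqnorm M (\<lambda>x. f n x - g x)) \<longlonglongrightarrow> 0"
proof -
  note [measurable] = Lsq_measurable[OF assms(1)] Lsq_measurable[OF assms(2)]
  have "(\<lambda>n. \<integral>x. (cmod (f n x - g x))\<^sup>2 \<partial>M) \<longlonglongrightarrow> (\<integral>x. 0 \<partial>M)"
  proof (rule integral_dominated_convergence)
    show "AE x in M. (\<lambda>n. (cmod (f n x - g x))\<^sup>2) \<longlonglongrightarrow> 0"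
    proof (rule AE_I2)
      fix x assume "x \<in> space M"
      from tendsto_power[OF tendsto_norm[OF LIM_zero[OF assms(5)[OF this]]], of 2]
      show "(\<lambda>n. (cmod (f n x - g x))\<^sup>2) \<longlonglongrightarrow> 0" by simp
    qed
    show "AE x in M. norm ((cmod (f n x - g x))\<^sup>2) \<le> w x" for n
      using assms(4) by auto
  qed (use assms(3) in measurable)
  then show ?thesis by (simp add: sqnorm_def)
qed

lemma bounded_Lsq_unit_interval:
  assumes "f \<in> borel_measurable unit_interval" "\<And>u. 0 < u \<Longrightarrow> u < 1 \<Longrightarrow> cmod (f u) \<le> B" "0 \<le> B"
  shows "f \<in> Lsq unit_interval" "sqnorm unit_interval f \<le> B\<^sup>2"
proof -
  have "(\<integral>\<^sup>+u. ennreal ((cmod (f u))\<^sup>2) \<partial>unit_interval) \<le> (\<integral>\<^sup>+u. ennreal (B\<^sup>2) \<partial>unit_interval)"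
    by (intro nn_integral_mono ennreal_leI power_mono assms) auto
  also have "\<dots> = ennreal (B\<^sup>2)"
    by (simp add: emeasure_restrict_space)
  finally have *: "(\<integral>\<^sup>+u. ennreal ((cmod (f u))\<^sup>2) \<partial>unit_interval) \<le> ennreal (B\<^sup>2)" .
  show "f \<in> Lsq unit_interval" "sqnorm unit_interval f \<le> B\<^sup>2"
    using sqnorm_le_nn_integral[OF assms(1) *] by auto
qed

lemma integrable_const_unit_interval [simp]: "integrable unit_interval (\<lambda>u. c :: real)"
  by (simp add: integrable_iff_bounded emeasure_restrict_space ennreal_mult_less_top)

lemma continuous_Lsq_unit_interval:
  fixes f :: "real \<Rightarrow> complex"
  assumes "continuous_on UNIV f"
  shows "f \<in> Lsq unit_interval"
proof -
  have "compact (f ` {0..1})"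
    using assms by (intro compact_continuous_image) (auto intro: continuous_on_subset)
  then obtain B where "\<And>u. u \<in> {0..1} \<Longrightarrow> cmod (f u) \<le> B"
    using compact_imp_bounded bounded_iff by (metis (mono_tags) image_eqI)
  then have "\<And>u. 0 < u \<Longrightarrow> u < 1 \<Longrightarrow> cmod (f u) \<le> max B 0"
    by (fastforce simp: le_max_iff_disj)
  then show ?thesis
    using assms
    by (intro bounded_Lsq_unit_interval(1)[where B = "max B 0"] borel_measurable_unit_interval
        borel_measurable_continuous_onI) auto
qed

lemma poly_Lsq: "(\<lambda>u. poly q (complex_of_real u)) \<in> Lsq unit_interval"
  by (intro continuous_Lsq_unit_interval continuous_intros)

text \<open>The closure of the polynomials in L^2(0,1) as a predicate. Density becomes a matter of
  closure properties, climbing from half-lines through Borel sets and simple functions to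
  limits.\<close>

definition poly_approximable :: "(real \<Rightarrow> complex) \<Rightarrow> bool" where
  "poly_approximable f \<longleftrightarrow> f \<in> Lsq unit_interval \<and>
     (\<forall>e>0. \<exists>q. sqnorm unit_interval (\<lambda>u. f u - poly q (of_real u)) < e)"

lemma poly_approximable_add:
  assumes "poly_approximable f" "poly_approximable g"
  shows "poly_approximable (\<lambda>u. f u + g u)"
  unfolding poly_approximable_def
proof (intro conjI allI impI)
  have fg: "f \<in> Lsq unit_interval" "g \<in> Lsq unit_interval"
    using assms by (auto simp: poly_approximable_def)
  then show "(\<lambda>u. f u + g u) \<in> Lsq unit_interval" by (rule Lsq_add)
  fix e :: real assume "e > 0"
  then obtain p q where pq: "sqnorm unit_interval (\<lambda>u. f u - poly p (of_real u)) < e / 4"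
    "sqnorm unit_interval (\<lambda>u. g u - poly q (of_real u)) < e / 4"
    using assms unfolding poly_approximable_def by (meson divide_pos_pos zero_less_numeral)
  have "sqnorm unit_interval (\<lambda>u. (f u - poly p (of_real u)) + (g u - poly q (of_real u))) < e"
    using sqnorm_add_le[OF Lsq_diff[OF fg(1) poly_Lsq[of p]] Lsq_diff[OF fg(2) poly_Lsq[of q]]] pq by simp
  then show "\<exists>q. sqnorm unit_interval (\<lambda>u. f u + g u - poly q (of_real u)) < e"
    by (intro exI[of _ "p + q"]) (simp add: algebra_simps)
qed

lemma poly_approximable_scale:
  assumes "poly_approximable f"
  shows "poly_approximable (\<lambda>u. k * f u)"
  unfolding poly_approximable_def
proof (intro conjI allI impI)
  have f: "f \<in> Lsq unit_interval"
    using assms by (auto simp: poly_approximable_def)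
  then show "(\<lambda>u. k * f u) \<in> Lsq unit_interval" by (rule Lsq_scale)
  fix e :: real assume "e > 0"
  then have "e / ((cmod k)\<^sup>2 + 1) > 0"
    by (simp add: add_nonneg_pos)
  then obtain p where p: "sqnorm unit_interval (\<lambda>u. f u - poly p (of_real u)) < e / ((cmod k)\<^sup>2 + 1)"
    using assms unfolding poly_approximable_def by meson
  have "sqnorm unit_interval (\<lambda>u. k * (f u - poly p (of_real u)))
      \<le> ((cmod k)\<^sup>2 + 1) * sqnorm unit_interval (\<lambda>u. f u - poly p (of_real u))"
    unfolding sqnorm_scale by (intro mult_right_mono) auto
  also have "\<dots> < e"
    using p by (simp add: pos_less_divide_eq add_nonneg_pos mult.commute)
  finally show "\<exists>q. sqnorm unit_interval (\<lambda>u. k * f u - poly q (of_real u)) < e"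
    by (intro exI[of _ "smult k p"]) (simp add: algebra_simps)
qed

lemma poly_approximable_limit:
  assumes "f \<in> Lsq unit_interval"
    and "\<And>e. e > 0 \<Longrightarrow> \<exists>g. poly_approximable g \<and> sqnorm unit_interval (\<lambda>u. f u - g u) < e"
  shows "poly_approximable f"
  unfolding poly_approximable_def
proof (intro conjI allI impI)
  fix e :: real assume "e > 0"
  then obtain g where g: "poly_approximable g" "sqnorm unit_interval (\<lambda>u. f u - g u) < e / 4"
    using assms(2)[of "e/4"] by auto
  then obtain q where q: "sqnorm unit_interval (\<lambda>u. g u - poly q (of_real u)) < e / 4"
    using \<open>e > 0\<close> unfolding poly_approximable_def by (meson divide_pos_pos zero_less_numeral)
  have "g \<in> Lsq unit_interval" using g by (simp add: poly_approximable_def)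
  from sqnorm_triangle[OF assms(1) this poly_Lsq[of q]] g q
  show "\<exists>q. sqnorm unit_interval (\<lambda>u. f u - poly q (of_real u)) < e"
    by (intro exI[of _ q]) linarith
qed (fact assms(1))

lemma poly_approximable_LIMSEQ:
  assumes "f \<in> Lsq unit_interval" "\<And>n::nat. poly_approximable (g n)"
    and "(\<lambda>n. sqnorm unit_interval (\<lambda>u. g n u - f u)) \<longlonglongrightarrow> 0"
  shows "poly_approximable f"
proof (rule poly_approximable_limit[OF assms(1)])
  fix e :: real assume "e > 0"
  then have "eventually (\<lambda>n. sqnorm unit_interval (\<lambda>u. g n u - f u) < e) sequentially"
    using assms(3) by (intro order_tendstoD)
  then obtain n where "sqnorm unit_interval (\<lambda>u. g n u - f u) < e"
    by (auto simp: eventually_sequentially)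
  then have "sqnorm unit_interval (\<lambda>u. f u - g n u) < e"
    by (subst sqnorm_diff_commute)
  with assms(2) show "\<exists>g. poly_approximable g \<and> sqnorm unit_interval (\<lambda>u. f u - g u) < e"
    by blast
qed

lemma poly_approximable_poly: "poly_approximable (\<lambda>u. poly q (of_real u))"
  unfolding poly_approximable_def using poly_Lsq by (auto intro!: exI[of _ q])

lemma poly_approximable_continuous:
  fixes \<phi> :: "real \<Rightarrow> real"
  assumes "continuous_on UNIV \<phi>"
  shows "poly_approximable (\<lambda>u. of_real (\<phi> u))"
  unfolding poly_approximable_def
proof (intro conjI allI impI)
  show "(\<lambda>u. complex_of_real (\<phi> u)) \<in> Lsq unit_interval"
    by (intro continuous_Lsq_unit_interval continuous_intros assms)
  fix e :: real assume "e > 0"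
  have "continuous_on {0..1} \<phi>" using assms by (rule continuous_on_subset) auto
  then obtain g where "real_polynomial_function g"
    and ga: "\<And>u. u \<in> {0..1} \<Longrightarrow> \<bar>\<phi> u - g u\<bar> < sqrt (e / 2)"
    using \<open>e > 0\<close> by (auto intro: Stone_Weierstrass_real_polynomial_function[of "{0..1::real}" \<phi> "sqrt (e/2)"])
  then obtain a n where g: "g = (\<lambda>x. \<Sum>i\<le>n. a i * x^i)"
    by (auto simp: real_polynomial_function_iff_sum)
  define q where "q = (\<Sum>i\<le>n. monom (complex_of_real (a i)) i)"
  have q: "poly q (of_real u) = of_real (g u)" for u
    by (simp add: q_def g poly_sum poly_monom)
  have "sqnorm unit_interval (\<lambda>u. of_real (\<phi> u) - poly q (of_real u)) \<le> (sqrt (e/2))\<^sup>2"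
  proof (rule bounded_Lsq_unit_interval)
    show "(\<lambda>u. of_real (\<phi> u) - poly q (complex_of_real u)) \<in> borel_measurable unit_interval"
      using assms
      by (intro borel_measurable_unit_interval borel_measurable_continuous_onI continuous_intros)
    show "cmod (of_real (\<phi> u) - poly q (complex_of_real u)) \<le> sqrt (e/2)" if "0 < u" "u < 1" for u
      using ga[of u] that by (simp add: q flip: of_real_diff)
  qed (use \<open>e > 0\<close> in auto)
  also have "\<dots> < e" using \<open>e > 0\<close> by simp
  finally show "\<exists>q. sqnorm unit_interval (\<lambda>u. of_real (\<phi> u) - poly q (of_real u)) < e" by blast
qed

lemma indicator_Lsq_unit_interval:
  "A \<in> sets borel \<Longrightarrow> (\<lambda>u. indicator A u :: complex) \<in> Lsq unit_interval"
  by (rule bounded_Lsq_unit_interval[where B = 1])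
    (auto intro!: borel_measurable_unit_interval simp: indicator_def)

lemma poly_approximable_indicator_atMost: "poly_approximable (indicator {..a})"
proof (rule poly_approximable_LIMSEQ)
  \<comment> \<open>For n > 0 a ramp that equals 1 up to a and 0 from a + 1/n on.\<close>
  define g where "g n u = max 0 (min 1 (1 - real n * (u - a)))" for n u
  show "(indicator {..a} :: real \<Rightarrow> complex) \<in> Lsq unit_interval"
    by (rule indicator_Lsq_unit_interval) auto
  have g: "continuous_on UNIV (g n)" for n
    unfolding g_def by (intro continuous_intros)
  then show "poly_approximable (\<lambda>u. of_real (g n u))" for n
    by (rule poly_approximable_continuous)
  show "(\<lambda>n. sqnorm unit_interval (\<lambda>u. of_real (g n u) - indicator {..a} u)) \<longlonglongrightarrow> 0"
  proof (rule sqnorm_dominated[where w = "\<lambda>_. 1"])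
    show "(\<lambda>u. complex_of_real (g n u)) \<in> Lsq unit_interval" for n
      by (intro continuous_Lsq_unit_interval continuous_intros g)
    show "(indicator {..a} :: real \<Rightarrow> complex) \<in> Lsq unit_interval"
      by (rule indicator_Lsq_unit_interval) auto
    fix u :: real
    have "indicator {..a} u = complex_of_real (indicator {..a} u)"
      by (simp add: indicator_def)
    then have "cmod (of_real (g n u) - indicator {..a} u) = \<bar>g n u - indicator {..a} u\<bar>" for n
      by (metis norm_of_real of_real_diff)
    moreover have "\<bar>g n u - indicator {..a} u\<bar> \<le> 1" for n
      by (auto simp: g_def indicator_def)
    ultimately show "(cmod (of_real (g n u) - indicator {..a} u))\<^sup>2 \<le> 1" for n
      by (simp add: abs_square_le_1)
    show "(\<lambda>n. complex_of_real (g n u)) \<longlonglongrightarrow> indicator {..a} u"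
    proof (cases "u \<le> a")
      case True
      then have "g n u = 1" for n
        by (auto simp: g_def max_def min_def mult_nonneg_nonpos mult_le_0_iff)
      then show ?thesis using True by simp
    next
      case False
      then obtain N where N: "real N * (u - a) > 1"
        using ex_less_of_nat_mult[of "u - a" 1] by auto
      have "g n u = 0" if "n \<ge> N" for n
      proof -
        have "real N * (u - a) \<le> real n * (u - a)"
          using that False by (intro mult_right_mono) auto
        with N show ?thesis by (simp add: g_def)
      qed
      then have "eventually (\<lambda>n. complex_of_real (g n u) = 0) sequentially"
        by (auto simp: eventually_sequentially)
      then show ?thesis using False by (simp add: tendsto_eventually)
    qed
  qed simp
qed

text \<open>Half-lines are stable under intersection and generate the Borel sets, so Dynkin's
  theorem leaves complements and disjoint unions; the latter are dominated limits of finite sums of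
  indicators.\<close>

lemma poly_approximable_indicator:
  assumes "A \<in> sets borel"
  shows "poly_approximable (\<lambda>u. indicator A u)"
proof -
  have "Int_stable (range (\<lambda>a::real. {..a}))"
    by (auto simp: Int_stable_def)
  moreover have "range (\<lambda>a::real. {..a}) \<subseteq> Pow UNIV" by simp
  moreover have "A \<in> sigma_sets UNIV (range (\<lambda>a::real. {..a}))"
    using assms by (simp add: borel_eq_atMost)
  ultimately show ?thesis
  proof (induction rule: sigma_sets_induct_disjoint)
    case (basic A)
    then show ?case using poly_approximable_indicator_atMost by auto
  next
    case empty
    show ?case using poly_approximable_poly[of 0] by simp
  next
    case (compl A)
    have "poly_approximable (\<lambda>u. poly 1 (complex_of_real u) + (-1) * indicator A u)"
      by (intro poly_approximable_add poly_approximable_scale poly_approximable_poly compl)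
    moreover have "(\<lambda>u. poly 1 (complex_of_real u) + (-1) * indicator A u) = indicator (UNIV - A)"
      by (auto simp: indicator_def)
    ultimately show ?case by simp
  next
    case (union A)
    have Ab: "A i \<in> sets borel" for i
      using union(2) by (auto simp: borel_eq_atMost)
    have partial: "poly_approximable (\<lambda>u. \<Sum>i<n. indicator (A i) u)" for n
    proof (induction n)
      case 0
      show ?case using poly_approximable_poly[of 0] by simp
    next
      case (Suc n)
      then show ?case using poly_approximable_add[OF Suc union(3)[of n]] by simp
    qed
    have sum: "(\<Sum>i<n. indicator (A i) u) = (indicator (\<Union>i<n. A i) u :: complex)" for n u
      using union(1) by (subst indicator_UN_disjoint) (auto simp: disjoint_family_on_def)
    show ?case
    proof (rule poly_approximable_LIMSEQ)
      show "(\<lambda>u. indicator (\<Union>i. A i) u :: complex) \<in> Lsq unit_interval"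
        by (rule indicator_Lsq_unit_interval) (use Ab in auto)
      show "poly_approximable (\<lambda>u. indicator (\<Union>i<n. A i) u)" for n
        using partial[of n] by (simp add: sum)
      show "(\<lambda>n. sqnorm unit_interval (\<lambda>u. indicator (\<Union>i<n. A i) u - indicator (\<Union>i. A i) u)) \<longlonglongrightarrow> 0"
      proof (rule sqnorm_dominated[where w = "\<lambda>_. 1"])
        show "(\<lambda>u. indicator (\<Union>i<n. A i) u :: complex) \<in> Lsq unit_interval" for n
          by (rule indicator_Lsq_unit_interval) (use Ab in auto)
        show "(\<lambda>u. indicator (\<Union>i. A i) u :: complex) \<in> Lsq unit_interval"
          by (rule indicator_Lsq_unit_interval) (use Ab in auto)
        show "(\<lambda>n. indicator (\<Union>i<n. A i) u) \<longlonglongrightarrow> (indicator (\<Union>i. A i) u :: complex)" for u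
          by (rule LIMSEQ_indicator_UN)
      qed (auto simp: indicator_def)
    qed
  qed
qed

lemma poly_approximable_sum:
  "finite I \<Longrightarrow> (\<And>i. i \<in> I \<Longrightarrow> poly_approximable (f i)) \<Longrightarrow> poly_approximable (\<lambda>u. \<Sum>i\<in>I. f i u)"
proof (induction I rule: finite_induct)
  case empty
  show ?case using poly_approximable_poly[of 0] by simp
next
  case (insert i I)
  then show ?case by (simp add: poly_approximable_add)
qed

lemma sets_unit_interval_borel: "A \<in> sets unit_interval \<Longrightarrow> A \<in> sets borel"
  by (auto simp: sets_restrict_space)

lemma poly_approximable_cong:
  assumes "poly_approximable f" "\<And>u. 0 < u \<Longrightarrow> u < 1 \<Longrightarrow> f u = g u"
  shows "poly_approximable g"
proof -
  have "f \<in> borel_measurable unit_interval \<longleftrightarrow> g \<in> borel_measurable unit_interval"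
    using assms(2) by (intro measurable_cong) auto
  moreover have "integrable unit_interval (\<lambda>u. (cmod (f u))\<^sup>2) \<longleftrightarrow> integrable unit_interval (\<lambda>u. (cmod (g u))\<^sup>2)"
    using assms(2) by (intro Bochner_Integration.integrable_cong) auto
  ultimately have "f \<in> Lsq unit_interval \<longleftrightarrow> g \<in> Lsq unit_interval"
    by (simp add: Lsq_def)
  moreover have "sqnorm unit_interval (\<lambda>u. f u - poly q (of_real u)) = sqnorm unit_interval (\<lambda>u. g u - poly q (of_real u))" for q
    unfolding sqnorm_def by (intro Bochner_Integration.integral_cong) (auto simp: assms(2))
  ultimately show ?thesis using assms(1) by (simp add: poly_approximable_def)
qed

theorem poly_dense:
  assumes f: "f \<in> Lsq unit_interval"
  shows "poly_approximable f"
proof -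
  have "f \<in> borel_measurable unit_interval" using f by measurable
  from borel_measurable_implies_sequence_metric[OF this, of 0]
  obtain s where s: "\<And>i. simple_function unit_interval (s i)"
    "\<And>x. x \<in> space unit_interval \<Longrightarrow> (\<lambda>i. s i x) \<longlonglongrightarrow> f x"
    "\<And>i x. x \<in> space unit_interval \<Longrightarrow> dist (s i x) 0 \<le> 2 * dist (f x) 0"
    by blast
  have sp: "poly_approximable (s i)" for i
  proof (rule poly_approximable_cong)
    show "poly_approximable (\<lambda>u. \<Sum>y\<in>s i ` space unit_interval. y * indicator (s i -` {y} \<inter> space unit_interval) u)"
    proof (intro poly_approximable_sum poly_approximable_scale poly_approximable_indicator sets_unit_interval_borel)
      show "finite (s i ` space unit_interval)" using s(1)[of i] by (rule simple_functionD)
      show "s i -` {y} \<inter> space unit_interval \<in> sets unit_interval" for y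
        using s(1)[of i] by (rule simple_functionD)
    qed
    show "(\<Sum>y\<in>s i ` space unit_interval. y * indicator (s i -` {y} \<inter> space unit_interval) u) = s i u"
      if "0 < u" "u < 1" for u
    proof -
      have *: "y * indicator A u = indicator A u *\<^sub>R y" for y :: complex and A
        by (simp add: indicator_def)
      show ?thesis
        unfolding * by (rule simple_function_indicator_representation_banach[OF s(1), symmetric])
          (use that in simp)
    qed
  qed
  show ?thesis
  proof (rule poly_approximable_LIMSEQ[OF f sp])
    show "(\<lambda>n. sqnorm unit_interval (\<lambda>u. s n u - f u)) \<longlonglongrightarrow> 0"
    \<comment> \<open>9 = (2 + 1)^2, since the simple functions satisfy |s n| \<le> 2 |f|.\<close>
    proof (rule sqnorm_dominated[where w = "\<lambda>u. 9 * (cmod (f u))\<^sup>2"])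
      show "s n \<in> Lsq unit_interval" for n using sp by (simp add: poly_approximable_def)
      show "integrable unit_interval (\<lambda>u. 9 * (cmod (f u))\<^sup>2)"
        using Lsq_integrable[OF f] by simp
      fix u n assume u: "u \<in> space unit_interval"
      have "cmod (s n u - f u) \<le> 3 * cmod (f u)"
        using norm_triangle_ineq4[of "s n u" "f u"] s(3)[OF u, of n] by simp
      then have "(cmod (s n u - f u))\<^sup>2 \<le> (3 * cmod (f u))\<^sup>2"
        by (rule power_mono) simp
      then show "(cmod (s n u - f u))\<^sup>2 \<le> 9 * (cmod (f u))\<^sup>2"
        by (simp add: power_mult_distrib)
    qed (use f s(2) in auto)
  qed
qed

section \<open>Reproducing kernels and the transform of powers\<close>

definition kern :: "complex \<Rightarrow> real \<Rightarrow> complex" where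
  "kern s u = of_real u powr (cnj s - 1/2)"

lemma kern_measurable [measurable]: "kern s \<in> borel_measurable borel"
  unfolding kern_def powr_def by measurable

lemma cnj_kern: "0 < u \<Longrightarrow> cnj (kern s u) = of_real u powr (s - 1/2)"
  by (simp add: kern_def cnj_powr)

lemma norm_kern: "0 < u \<Longrightarrow> cmod (kern s u) = u powr (Re s - 1/2)"
  by (simp add: kern_def norm_powr_real_powr)

lemma powr_nn_integral_unit_interval:
  assumes "\<alpha> > -1"
  shows "(\<integral>\<^sup>+u. ennreal (u powr \<alpha>) \<partial>unit_interval) = ennreal (1 / (\<alpha> + 1))"
proof -
  have "((\<lambda>u. u powr \<alpha>) has_integral (1 powr (\<alpha>+1) / (\<alpha>+1))) {0..1::real}"
    using assms by (intro has_integral_powr_from_0) auto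
  then have "((\<lambda>u. u powr \<alpha>) has_integral (1 / (\<alpha>+1))) {0<..<1::real}"
    by (simp add: has_integral_Icc_iff_Ioo)
  then have "(\<integral>\<^sup>+u. ennreal (u powr \<alpha>) * indicator {0<..<1} u \<partial>lborel) = ennreal (1 / (\<alpha> + 1))"
    by (intro nn_integral_has_integral_lebesgue') auto
  then show ?thesis
    by (simp add: nn_integral_restrict_space)
qed

lemma kern_Lsq:
  assumes "Re s > 0"
  shows "kern s \<in> Lsq unit_interval" "sqnorm unit_interval (kern s) = 1 / (2 * Re s)"
proof -
  have "(\<integral>\<^sup>+u. ennreal ((cmod (kern s u))\<^sup>2) \<partial>unit_interval) = (\<integral>\<^sup>+u. ennreal (u powr (2 * Re s - 1)) \<partial>unit_interval)"
  proof (rule nn_integral_cong)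
    fix u assume "u \<in> space unit_interval"
    then have "(u powr (Re s - 1/2))\<^sup>2 = u powr (2 * Re s - 1)"
      by (subst powr_power) (auto simp: algebra_simps)
    then show "ennreal ((cmod (kern s u))\<^sup>2) = ennreal (u powr (2 * Re s - 1))"
      using \<open>u \<in> _\<close> by (simp add: norm_kern)
  qed
  also have "\<dots> = ennreal (1 / (2 * Re s))"
    using assms by (subst powr_nn_integral_unit_interval) auto
  finally have *: "(\<integral>\<^sup>+u. ennreal ((cmod (kern s u))\<^sup>2) \<partial>unit_interval) = ennreal (1 / (2 * Re s))" .
  then show k: "kern s \<in> Lsq unit_interval"
    by (auto simp: Lsq_iff_nn_integral intro!: borel_measurable_unit_interval)
  show "sqnorm unit_interval (kern s) = 1 / (2 * Re s)"
    using sqnorm_eq_nn_integral[OF k] * assms by simp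
qed

text \<open>Under u = exp(-t) the factor exp(-st) exp(-t/2) becomes u^(s + 1/2) and dt becomes du/u,
  which leaves the exponent s - 1/2 of the kernel. Evaluation at a point of the half-plane is
  thereby a bounded functional with an explicit representing vector.\<close>

lemma laplace_L2_eq_ip:
  assumes f: "f \<in> Lsq unit_interval" and s: "Re s > 0"
  shows "laplace_L2 f s = ip unit_interval f (kern s)"
proof -
  define F where "F u = f u * cnj (kern s u)" for u
  have [measurable]: "f \<in> borel_measurable unit_interval" using f by measurable
  have fi: "(\<lambda>u. indicator {0<..<1} u *\<^sub>R f u) \<in> borel_measurable borel"
    using borel_measurable_restrict_space_iff[of "{0<..<1}" lborel f] \<open>f \<in> borel_measurable unit_interval\<close>
    by simp
  have int: "integrable unit_interval F"
    unfolding F_def by (rule ip_integrable[OF f kern_Lsq(1)[OF s]])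
  then have setint: "set_integrable lborel {0<..<1} F"
    unfolding set_integrable_def by (subst integrable_restrict_space[symmetric]) auto
  have ip: "ip unit_interval f (kern s) = integral {0<..<1} F"
  proof -
    have "ip unit_interval f (kern s) = (LINT u:{0<..<1}|lborel. F u)"
      unfolding ip_def set_lebesgue_integral_def F_def by (subst integral_restrict_space) auto
    then show ?thesis using set_borel_integral_eq_integral(2)[OF setint] by simp
  qed
  have img: "(\<lambda>t::real. exp (- t)) ` {0<..} = {0<..<1}"
  proof safe
    fix u :: real assume "u \<in> {0<..<1}"
    then show "u \<in> (\<lambda>t. exp (- t)) ` {0<..}"
      by (intro image_eqI[of _ _ "- ln u"]) auto
  qed auto
  have "F absolutely_integrable_on {0<..<1}"
    using setint unfolding set_integrable_def by (intro integrable_completion[THEN iffD2]) auto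
  then have cov: "(\<lambda>t. \<bar>- exp (- t)\<bar> *\<^sub>R F (exp (- t))) absolutely_integrable_on {0<..} \<and>
      integral {0<..} (\<lambda>t. \<bar>- exp (- t)\<bar> *\<^sub>R F (exp (- t))) = integral {0<..<1} F"
    by (subst has_absolute_integral_change_of_variables_real)
      (auto simp: img intro!: derivative_eq_intros inj_onI)
  have eq: "\<bar>- exp (- t)\<bar> *\<^sub>R F (exp (- t)) = exp (- s * of_real t) * (of_real (exp (- t / 2)) * f (exp (- t)))"
    for t
  proof -
    have "complex_of_real (exp (-t)) powr (s - 1/2) = exp ((s - 1/2) * of_real (-t))"
      by (simp add: powr_def Ln_of_real)
    then have "\<bar>- exp (- t)\<bar> *\<^sub>R F (exp (- t)) = (exp (of_real (-t)) * exp ((s - 1/2) * of_real (-t))) * f (exp (-t))"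
      by (simp add: F_def cnj_kern scaleR_conv_of_real exp_of_real del: of_real_minus)
    also have "exp (of_real (-t)) * exp ((s - 1/2) * of_real (-t)) = exp (- s * of_real t) * exp (of_real (- t/2) :: complex)"
      unfolding exp_add[symmetric] by (intro arg_cong[where f = exp]) (simp add: algebra_simps)
    finally show ?thesis by (simp add: exp_of_real[symmetric] mult.assoc)
  qed
  \<comment> \<open>The change of variables yields integrability for the completed measure. Borel
    measurability, needed to return to \<open>lborel\<close>, comes from extending f by zero, as f
    is measurable on the open interval only.\<close>
  have meas: "(\<lambda>t. indicator {0<..} t *\<^sub>R (\<bar>- exp (- t)\<bar> *\<^sub>R F (exp (- t)))) \<in> borel_measurable borel"
  proof -
    have "(\<lambda>t. indicator {0<..} t *\<^sub>R (\<bar>- exp (- t)\<bar> *\<^sub>R F (exp (- t)))) =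
        (\<lambda>t. \<bar>- exp (- t)\<bar> *\<^sub>R ((\<lambda>u. indicator {0<..<1} u *\<^sub>R f u) (exp (-t)) * cnj (kern s (exp (- t)))))"
      by (auto simp: F_def indicator_def)
    also have "\<dots> \<in> borel_measurable borel"
      by (intro borel_measurable_scaleR borel_measurable_times measurable_compose[OF _ fi]) measurable
    finally show ?thesis .
  qed
  have "set_integrable lborel {0<..} (\<lambda>t. \<bar>- exp (- t)\<bar> *\<^sub>R F (exp (- t)))"
    using cov meas unfolding set_integrable_def by (subst integrable_completion[symmetric]) auto
  then have "(LBINT t:{0<..}. \<bar>- exp (- t)\<bar> *\<^sub>R F (exp (- t))) = integral {0<..<1} F"
    using cov set_borel_integral_eq_integral(2) by metis
  then show ?thesis
    unfolding laplace_L2_def ip eq by simp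
qed

lemma powr_le_one_if_nonneg: "0 < u \<Longrightarrow> u < 1 \<Longrightarrow> 0 \<le> x \<Longrightarrow> u powr x \<le> (1::real)"
  using powr_mono2[of x u 1] by simp

text \<open>Generalised polynomials, encoded as lists of pairs of a coefficient and an exponent. Complex
  exponents are allowed so that the reproducing kernels belong to the class.\<close>

definition powsum :: "(complex \<times> complex) list \<Rightarrow> real \<Rightarrow> complex" where
  "powsum xs u = (\<Sum>(k, z)\<leftarrow>xs. k * of_real u powr z)"

definition powsum_tr :: "(complex \<times> complex) list \<Rightarrow> complex \<Rightarrow> complex" where
  "powsum_tr xs s = (\<Sum>(k, z)\<leftarrow>xs. k / (s + z + 1/2))"

text \<open>Square integrability of u^z at 0; equivalently, the poles of the transform lie strictly
  to the left of the imaginary axis.\<close>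

definition powsum_ok :: "(complex \<times> complex) list \<Rightarrow> bool" where
  "powsum_ok xs \<longleftrightarrow> (\<forall>(k, z)\<in>set xs. Re z > -1/2)"

definition powsum_scale :: "complex \<Rightarrow> (complex \<times> complex) list \<Rightarrow> (complex \<times> complex) list" where
  "powsum_scale c xs = map (\<lambda>(k, z). (c * k, z)) xs"

lemma powsum_simps [simp]:
  "powsum [] u = 0" "powsum ((k, z) # xs) u = k * of_real u powr z + powsum xs u"
  "powsum (xs @ ys) u = powsum xs u + powsum ys u" "powsum (powsum_scale c xs) u = c * powsum xs u"
  by (simp_all add: powsum_def powsum_scale_def sum_list_const_mult[symmetric] o_def case_prod_unfold mult.assoc)

lemma powsum_tr_simps [simp]:
  "powsum_tr [] s = 0" "powsum_tr ((k, z) # xs) s = k / (s + z + 1/2) + powsum_tr xs s"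
  "powsum_tr (xs @ ys) s = powsum_tr xs s + powsum_tr ys s" "powsum_tr (powsum_scale c xs) s = c * powsum_tr xs s"
  by (simp_all add: powsum_tr_def powsum_scale_def sum_list_const_mult[symmetric] o_def case_prod_unfold)

lemma powsum_ok_simps [simp]:
  "powsum_ok []" "powsum_ok ((k, z) # xs) \<longleftrightarrow> Re z > -1/2 \<and> powsum_ok xs" "powsum_ok (xs @ ys) \<longleftrightarrow> powsum_ok xs \<and> powsum_ok ys"
  "powsum_ok (powsum_scale c xs) \<longleftrightarrow> powsum_ok xs"
  by (auto simp: powsum_ok_def powsum_scale_def)

lemma powr_Lsq:
  assumes "Re z > -1/2"
  shows "(\<lambda>u. complex_of_real u powr z) \<in> Lsq unit_interval"
proof -
  have "kern (cnj (z + 1/2)) \<in> Lsq unit_interval"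
    using assms by (intro kern_Lsq) auto
  also have "kern (cnj (z + 1/2)) = (\<lambda>u. of_real u powr z)"
    by (auto simp: kern_def)
  finally show ?thesis .
qed

lemma powsum_Lsq:
  assumes "powsum_ok xs" shows "powsum xs \<in> Lsq unit_interval"
  using assms
proof (induction xs)
  case Nil
  have "powsum [] = (\<lambda>u. 0)" by auto
  then show ?case by simp
next
  case (Cons a xs)
  obtain k z where a: "a = (k, z)" by force
  have "(\<lambda>u. k * of_real u powr z + powsum xs u) \<in> Lsq unit_interval"
    using Cons by (intro Lsq_add Lsq_scale powr_Lsq) (auto simp: a)
  then show ?case
    by (simp add: a powsum_def)
qed

lemma powsum_dense:
  assumes f: "f \<in> Lsq unit_interval" and "e > 0"
  shows "\<exists>xs. powsum_ok xs \<and> sqnorm unit_interval (\<lambda>u. f u - powsum xs u) < e"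
proof -
  obtain q where q: "sqnorm unit_interval (\<lambda>u. f u - poly q (of_real u)) < e"
    using poly_dense[OF f] \<open>e > 0\<close> by (auto simp: poly_approximable_def)
  define xs where "xs = map (\<lambda>i. (coeff q i, of_nat i :: complex)) [0..<Suc (degree q)]"
  have "powsum xs u = poly q (of_real u)" if "0 < u" for u
  proof -
    have "powsum xs u = (\<Sum>i\<leftarrow>[0..<Suc (degree q)]. coeff q i * of_real u ^ i)"
      using that by (simp add: powsum_def xs_def o_def powr_nat')
    also have "\<dots> = (\<Sum>i\<le>degree q. coeff q i * of_real u ^ i)"
      by (simp only: interv_sum_list_conv_sum_set_nat set_upt atLeast0LessThan lessThan_Suc_atMost)
    finally show ?thesis by (simp add: poly_altdef)
  qed
  then have "sqnorm unit_interval (\<lambda>u. f u - powsum xs u) = sqnorm unit_interval (\<lambda>u. f u - poly q (of_real u))"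
    unfolding sqnorm_def by (intro Bochner_Integration.integral_cong) auto
  moreover have "powsum_ok xs" by (auto simp: powsum_ok_def xs_def intro: less_le_trans[of _ 0])
  ultimately show ?thesis using q by auto
qed

lemma powsum_dense_seq:
  assumes f: "f \<in> Lsq unit_interval"
  obtains xs :: "nat \<Rightarrow> (complex \<times> complex) list"
  where "\<And>n. powsum_ok (xs n)" "(\<lambda>n. sqnorm unit_interval (\<lambda>u. powsum (xs n) u - f u)) \<longlonglongrightarrow> 0"
proof -
  have "\<exists>xs. powsum_ok xs \<and> sqnorm unit_interval (\<lambda>u. f u - powsum xs u) < inverse (real (Suc n))" for n
    using powsum_dense[OF f] by simp
  then obtain xs where xs: "\<And>n. powsum_ok (xs n)"
    "\<And>n. sqnorm unit_interval (\<lambda>u. f u - powsum (xs n) u) < inverse (real (Suc n))" by metis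
  have "(\<lambda>n. sqnorm unit_interval (\<lambda>u. powsum (xs n) u - f u)) \<longlonglongrightarrow> 0"
  proof (rule tendsto_sandwich[OF _ _ tendsto_const LIMSEQ_inverse_real_of_nat])
    show "\<forall>\<^sub>F n in sequentially. sqnorm unit_interval (\<lambda>u. powsum (xs n) u - f u) \<le> inverse (real (Suc n))"
      using xs(2) sqnorm_diff_commute[of unit_interval f] by (simp add: less_imp_le)
  qed auto
  then show thesis using that xs(1) by blast
qed

text \<open>The integrand is u^\<zeta> with Re \<zeta> > -1. Its integrability follows from that of
  the two square integrable factors, and its primitive u^(\<zeta> + 1)/(\<zeta> + 1) tends to 0 at
  0.\<close>

lemma ip_powr_kern:
  assumes "Re w > 0" "Re z > -1/2"
  shows "ip unit_interval (\<lambda>u. of_real u powr z) (kern w) = 1 / (w + z + 1/2)"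
proof -
  define \<zeta> where "\<zeta> = w + z - 1/2"
  have \<zeta>: "Re \<zeta> > -1" using assms by (simp add: \<zeta>_def)
  then have nz: "\<zeta> + 1 \<noteq> 0" by (auto simp: complex_eq_iff)
  have eq: "of_real u powr z * cnj (kern w u) = of_real u powr \<zeta>" if "u \<in> {0<..<1}" for u
  proof -
    have "z + (w - 1/2) = \<zeta>" by (simp add: \<zeta>_def)
    then show ?thesis using that by (simp add: cnj_kern flip: powr_add)
  qed
  have "integrable unit_interval (\<lambda>u. of_real u powr z * cnj (kern w u))"
    by (intro ip_integrable powr_Lsq kern_Lsq assms)
  then have "integrable unit_interval (\<lambda>u. complex_of_real u powr \<zeta>)"
    by (subst Bochner_Integration.integrable_cong[OF refl, of _ _ "\<lambda>u. of_real u powr z * cnj (kern w u)"])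
      (auto simp: eq)
  then have "set_integrable lborel {0<..<1} (\<lambda>u. complex_of_real u powr \<zeta>)"
    unfolding set_integrable_def by (subst integrable_restrict_space[symmetric]) auto
  moreover have "einterval 0 1 = {0<..<1}"
    by (auto simp: einterval_def zero_ereal_def one_ereal_def)
  ultimately have int: "set_integrable lborel (einterval 0 1) (\<lambda>u. complex_of_real u powr \<zeta>)"
    by simp
  have "(LBINT u=0..1. complex_of_real u powr \<zeta>) = 1 / (\<zeta> + 1) - 0"
  proof (rule interval_integral_FTC_integrable[where F = "\<lambda>u. of_real u powr (\<zeta> + 1) / (\<zeta> + 1)"])
    fix u :: real assume u: "0 < ereal u" "ereal u < 1"
    then have u0: "complex_of_real u \<notin> \<real>\<^sub>\<le>\<^sub>0" by (simp add: zero_ereal_def complex_nonpos_Reals_iff)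
    then have "((\<lambda>s. s powr (\<zeta> + 1) / (\<zeta> + 1)) has_field_derivative of_real u powr \<zeta>) (at (of_real u))"
      using nz by (auto intro!: derivative_eq_intros has_field_derivative_powr)
    then show "((\<lambda>u. of_real u powr (\<zeta> + 1) / (\<zeta> + 1)) has_vector_derivative of_real u powr \<zeta>) (at u)"
      by (rule has_vector_derivative_real_field)
    show "isCont (\<lambda>u. complex_of_real u powr \<zeta>) u"
      using u0 by (intro continuous_intros) auto
  next
    have "((\<lambda>u. complex_of_real u powr (\<zeta> + 1)) \<longlongrightarrow> 0) (at_right 0)"
    proof (rule tendsto_norm_zero_cancel, rule Lim_transform_eventually)
      show "((\<lambda>u::real. u powr (Re \<zeta> + 1)) \<longlongrightarrow> 0) (at_right 0)"
      proof -
        have "\<forall>\<^sub>F u in at_right (0::real). 0 \<le> u"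
          by (rule eventually_mono[OF eventually_at_right_less]) simp
        then show ?thesis
          using \<zeta> tendsto_powr'[of "\<lambda>u::real. u" 0 "at_right 0" "\<lambda>_. Re \<zeta> + 1" "Re \<zeta> + 1"]
          by (auto intro: tendsto_ident_at)
      qed
      show "\<forall>\<^sub>F u in at_right (0::real). u powr (Re \<zeta> + 1) = cmod (of_real u powr (\<zeta> + 1))"
        using eventually_at_right_less[of 0] by eventually_elim (simp add: norm_powr_real_powr)
    qed
    then have "((\<lambda>u. complex_of_real u powr (\<zeta> + 1) / (\<zeta> + 1)) \<longlongrightarrow> 0 / (\<zeta> + 1)) (at_right 0)"
      by (intro tendsto_divide tendsto_const nz)
    then show "(((\<lambda>u. complex_of_real u powr (\<zeta> + 1) / (\<zeta> + 1)) \<circ> real_of_ereal) \<longlongrightarrow> 0) (at_right 0)"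
      by (simp add: zero_ereal_def ereal_tendsto_simps)
    have "isCont (\<lambda>u. complex_of_real u powr (\<zeta> + 1) / (\<zeta> + 1)) 1"
      using nz by (intro continuous_intros) auto
    then have "((\<lambda>u. complex_of_real u powr (\<zeta> + 1) / (\<zeta> + 1)) \<longlongrightarrow> 1 / (\<zeta> + 1)) (at_left 1)"
      by (auto simp: isCont_def intro: tendsto_within_subset)
    then show "(((\<lambda>u. complex_of_real u powr (\<zeta> + 1) / (\<zeta> + 1)) \<circ> real_of_ereal) \<longlongrightarrow> 1 / (\<zeta> + 1)) (at_left 1)"
      by (simp add: one_ereal_def ereal_tendsto_simps)
  qed (use int in auto)
  moreover have "ip unit_interval (\<lambda>u. of_real u powr z) (kern w) = (LBINT u=0..1. complex_of_real u powr \<zeta>)"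
  proof -
    have "ip unit_interval (\<lambda>u. of_real u powr z) (kern w) = (\<integral>u. of_real u powr \<zeta> \<partial>unit_interval)"
      unfolding ip_def by (intro Bochner_Integration.integral_cong) (auto simp: eq)
    also have "\<dots> = (LBINT u:{0<..<1}. of_real u powr \<zeta>)"
      unfolding set_lebesgue_integral_def by (subst integral_restrict_space) auto
    finally show ?thesis
      by (simp add: interval_lebesgue_integral_def zero_ereal_def one_ereal_def)
  qed
  ultimately show ?thesis by (simp add: \<zeta>_def)
qed

lemma ip_powsum_kern:
  assumes "Re w > 0" "powsum_ok xs"
  shows "ip unit_interval (powsum xs) (kern w) = powsum_tr xs w"
  using assms(2)
proof (induction xs)
  case Nil
  then show ?case by (simp add: ip_def)
next
  case (Cons a xs)
  obtain k z where a: "a = (k, z)" by force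
  have z: "Re z > -1/2" "powsum_ok xs" using Cons.prems by (auto simp: a)
  then have "(\<lambda>u. complex_of_real u powr z) \<in> Lsq unit_interval"
    by (intro powr_Lsq)
  then have "ip unit_interval (\<lambda>u. k * of_real u powr z + powsum xs u) (kern w) = k / (w + z + 1/2) + powsum_tr xs w"
    using Cons.IH z assms(1)
    by (subst ip_add_left) (auto intro!: Lsq_scale powsum_Lsq kern_Lsq simp: ip_scale_left ip_powr_kern)
  moreover have "powsum (a # xs) = (\<lambda>u. k * of_real u powr z + powsum xs u)"
    by (auto simp: a)
  ultimately show ?case by (simp add: a)
qed

section \<open>Cauchy's formula in the Hardy space\<close>

lemma nn_integral_inverse_quadratic:
  assumes "p > 0"
  shows "(\<integral>\<^sup>+y. ennreal (1 / (p\<^sup>2 + (y - v)\<^sup>2)) \<partial>lborel) = ennreal (pi / p)"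
proof -
  define F where "F y = arctan ((y - v) / p) / p" for y
  have den: "p\<^sup>2 + (y - v)\<^sup>2 > 0" for y using assms by (simp add: add_pos_nonneg)
  have der: "DERIV F y :> 1 / (p\<^sup>2 + (y - v)\<^sup>2)" for y
  proof -
    have "1 + ((y - v) / p)\<^sup>2 = (p\<^sup>2 + (y - v)\<^sup>2) / p\<^sup>2"
      using assms by (simp add: field_simps power_divide)
    then show ?thesis
      unfolding F_def using assms den[of y]
      by (auto intro!: derivative_eq_intros simp: divide_simps power2_eq_square)
  qed
  have lim: "(F \<longlongrightarrow> (pi / 2) / p) at_top" "(F \<longlongrightarrow> (- (pi / 2)) / p) at_bot"
  proof -
    have "filterlim (\<lambda>y. (y - v) / p) at_top at_top"
      unfolding filterlim_at_top
    proof
      fix Z show "\<forall>\<^sub>F y in at_top. Z \<le> (y - v) / p"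
        using eventually_ge_at_top[of "Z * p + v"]
        by eventually_elim (use assms in \<open>simp add: pos_le_divide_eq\<close>)
    qed
    moreover have "filterlim (\<lambda>y. (y - v) / p) at_bot at_bot"
      unfolding filterlim_at_bot
    proof
      fix Z show "\<forall>\<^sub>F y in at_bot. (y - v) / p \<le> Z"
        using eventually_le_at_bot[of "Z * p + v"]
        by eventually_elim (use assms in \<open>simp add: pos_divide_le_eq\<close>)
    qed
    ultimately have "((\<lambda>y. arctan ((y - v) / p)) \<longlongrightarrow> pi / 2) at_top" "((\<lambda>y. arctan ((y - v) / p)) \<longlongrightarrow> - (pi / 2)) at_bot"
      by (auto intro!: filterlim_compose[OF tendsto_arctan_at_top] filterlim_compose[OF tendsto_arctan_at_bot])
    note l = this
    show "(F \<longlongrightarrow> (pi / 2) / p) at_top" "(F \<longlongrightarrow> (- (pi / 2)) / p) at_bot"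
      unfolding F_def
      using tendsto_divide[OF l(1) tendsto_const[of p]] tendsto_divide[OF l(2) tendsto_const[of p]] assms
      by simp_all
  qed
  have nonneg: "AE y in lborel. -\<infinity> < ereal y \<longrightarrow> ereal y < \<infinity> \<longrightarrow> 0 \<le> 1 / (p\<^sup>2 + (y - v)\<^sup>2)"
    by auto
  have cont: "isCont (\<lambda>y. 1 / (p\<^sup>2 + (y - v)\<^sup>2)) y" for y
    using den[of y] by (intro continuous_intros) auto
  have "set_integrable lborel (einterval (-\<infinity>) \<infinity>) (\<lambda>y. 1 / (p\<^sup>2 + (y - v)\<^sup>2))"
       "(LBINT y=-\<infinity>..\<infinity>. 1 / (p\<^sup>2 + (y - v)\<^sup>2)) = (pi / 2) / p - (- (pi / 2)) / p"
    by ((rule interval_integral_FTC_nonneg[where F = F and A = "- (pi / 2) / p" and B = "pi / 2 / p"];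
         use der cont nonneg lim in \<open>simp add: ereal_tendsto_simps\<close>),
       (rule interval_integral_FTC_nonneg[where F = F and A = "- (pi / 2) / p" and B = "pi / 2 / p"];
         use der cont nonneg lim in \<open>simp add: ereal_tendsto_simps\<close>))
  then have "integrable lborel (\<lambda>y. 1 / (p\<^sup>2 + (y - v)\<^sup>2))" "(\<integral>y. 1 / (p\<^sup>2 + (y - v)\<^sup>2) \<partial>lborel) = pi / p"
    using assms by (auto simp: set_integrable_def interval_lebesgue_integral_def set_lebesgue_integral_def)
  then show ?thesis
    by (subst nn_integral_eq_integral) (auto simp: less_imp_le[OF den])
qed

lemma cmod_Complex_diff_sq: "(cmod (Complex x y - w))\<^sup>2 = (x - Re w)\<^sup>2 + (y - Im w)\<^sup>2"
  by (simp add: cmod_power2)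

lemma continuous_on_Complex [continuous_intros]:
  "continuous_on A f \<Longrightarrow> continuous_on A g \<Longrightarrow> continuous_on A (\<lambda>x. Complex (f x) (g x))"
  unfolding Complex_eq by (intro continuous_intros)

lemma line_kernel:
  assumes "x \<noteq> Re w"
  shows "(\<lambda>y. 1 / (Complex x y - w)) \<in> Lsq lborel"
    and "sqnorm lborel (\<lambda>y. 1 / (Complex x y - w)) = pi / \<bar>x - Re w\<bar>"
proof -
  have nz: "Complex x y - w \<noteq> 0" for y using assms by (auto simp: complex_eq_iff)
  have "continuous_on UNIV (\<lambda>y. 1 / (Complex x y - w))"
    using nz by (intro continuous_intros) auto
  then have meas: "(\<lambda>y. 1 / (Complex x y - w)) \<in> borel_measurable borel"
    by (rule borel_measurable_continuous_onI)
  have "(\<integral>\<^sup>+y. ennreal ((cmod (1 / (Complex x y - w)))\<^sup>2) \<partial>lborel)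
      = (\<integral>\<^sup>+y. ennreal (1 / (\<bar>x - Re w\<bar>\<^sup>2 + (y - Im w)\<^sup>2)) \<partial>lborel)"
    by (intro nn_integral_cong) (simp add: norm_divide power_divide cmod_Complex_diff_sq)
  also have "\<dots> = ennreal (pi / \<bar>x - Re w\<bar>)"
    by (rule nn_integral_inverse_quadratic) (use assms in auto)
  finally have *: "(\<integral>\<^sup>+y. ennreal ((cmod (1 / (Complex x y - w)))\<^sup>2) \<partial>lborel) = ennreal (pi / \<bar>x - Re w\<bar>)" .
  then show L: "(\<lambda>y. 1 / (Complex x y - w)) \<in> Lsq lborel"
    using meas by (auto simp: Lsq_iff_nn_integral)
  show "sqnorm lborel (\<lambda>y. 1 / (Complex x y - w)) = pi / \<bar>x - Re w\<bar>"
    using sqnorm_eq_nn_integral[OF L] * by simp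
qed

text \<open>Membership in \<open>H2\<close> with a named real bound. The constant has to be tracked
  because the Paley--Wiener argument needs an estimate that is uniform over all vertical
  lines.\<close>

definition H2_bound :: "(complex \<Rightarrow> complex) \<Rightarrow> real \<Rightarrow> bool" where
  "H2_bound F K \<longleftrightarrow> F holomorphic_on RHP \<and> 0 \<le> K \<and>
     (\<forall>x>0. (\<integral>\<^sup>+y. ennreal ((cmod (F (Complex x y)))\<^sup>2) \<partial>lborel) \<le> ennreal K)"

lemma H2_iff_bound: "F \<in> H2 \<longleftrightarrow> (\<exists>K. H2_bound F K)"
proof
  assume F: "F \<in> H2"
  define S where "S = (SUP x\<in>{0<..}. \<integral>\<^sup>+y. ennreal ((cmod (F (Complex x y)))\<^sup>2) \<partial>lborel)"
  have "S < \<infinity>" using F by (simp add: H2_def S_def)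
  then have "S = ennreal (enn2real S)" by simp
  moreover have "(\<integral>\<^sup>+y. ennreal ((cmod (F (Complex x y)))\<^sup>2) \<partial>lborel) \<le> S" if "x > 0" for x
    unfolding S_def by (rule SUP_upper) (use that in simp)
  ultimately show "\<exists>K. H2_bound F K"
    using F by (intro exI[of _ "enn2real S"]) (simp add: H2_bound_def H2_def)
next
  assume "\<exists>K. H2_bound F K"
  then obtain K where K: "H2_bound F K" by blast
  have "(SUP x\<in>{0<..}. \<integral>\<^sup>+y. ennreal ((cmod (F (Complex x y)))\<^sup>2) \<partial>lborel) \<le> ennreal K"
    by (rule SUP_least) (use K in \<open>auto simp: H2_bound_def\<close>)
  also have "\<dots> < \<infinity>" by simp
  finally show "F \<in> H2" using K by (simp add: H2_def H2_bound_def)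
qed

lemma continuous_on_line:
  assumes "F holomorphic_on RHP" "x > 0"
  shows "continuous_on UNIV (\<lambda>y. F (Complex x y))"
  by (rule continuous_on_compose2[OF holomorphic_on_imp_continuous_on[OF assms(1)]])
    (use assms(2) in \<open>auto intro!: continuous_intros\<close>)

lemma H2_bound_line:
  assumes "H2_bound F K" "x > 0"
  shows "(\<lambda>y. F (Complex x y)) \<in> Lsq lborel" "sqnorm lborel (\<lambda>y. F (Complex x y)) \<le> K"
proof -
  have "(\<lambda>y. F (Complex x y)) \<in> borel_measurable lborel"
    using assms continuous_on_line by (auto simp: H2_bound_def intro!: borel_measurable_continuous_onI)
  then show "(\<lambda>y. F (Complex x y)) \<in> Lsq lborel" "sqnorm lborel (\<lambda>y. F (Complex x y)) \<le> K"
    using assms by (auto simp: H2_bound_def intro!: sqnorm_le_nn_integral)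
qed

lemma unit_interval_sigma_finite: "sigma_finite_measure unit_interval"
  by (intro sigma_finite_measure_restrict_space lborel.sigma_finite_measure_axioms) auto

text \<open>The horizontal sides of the rectangles are controlled in mean only, so their heights have to
  be chosen along a sequence.\<close>

lemma H2_bound_horizontal:
  assumes F: "H2_bound F K" and x: "0 < x" "x < X" and n: "n > (0::nat)"
  shows "\<exists>S\<ge>real n. sqnorm unit_interval (\<lambda>t. F (Complex (x + t * (X - x)) S)) < 1 / n \<and>
     sqnorm unit_interval (\<lambda>t. F (Complex (x + t * (X - x)) (- S))) < 1 / n"
proof (rule ccontr)
  define \<phi> where "\<phi> S = (\<integral>\<^sup>+t. ennreal ((cmod (F (Complex (x + t * (X - x)) S)))\<^sup>2) \<partial>unit_interval)" for S
  have pos: "x + t * (X - x) > 0" if "0 < t" for t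
    using x that by (simp add: add_pos_pos)
  have hol: "F holomorphic_on RHP" using F by (simp add: H2_bound_def)
  have L: "(\<lambda>t. F (Complex (x + t * (X - x)) S)) \<in> Lsq unit_interval" for S
  proof -
    have pos': "0 < x + t * (X - x)" if "t \<in> {0..1}" for t
      using x that by (simp add: add_pos_nonneg)
    have cont: "continuous_on {0..1} (\<lambda>t. F (Complex (x + t * (X - x)) S))"
      by (rule continuous_on_compose2[OF holomorphic_on_imp_continuous_on[OF hol]])
        (use pos' in \<open>auto intro!: continuous_intros\<close>)
    then have "compact ((\<lambda>t. F (Complex (x + t * (X - x)) S)) ` {0..1})"
      by (intro compact_continuous_image) auto
    then have "bounded ((\<lambda>t. F (Complex (x + t * (X - x)) S)) ` {0..1})"
      by (rule compact_imp_bounded)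
    then obtain B where B: "B > 0" "\<And>t. t \<in> {0..1} \<Longrightarrow> cmod (F (Complex (x + t * (X - x)) S)) \<le> B"
      unfolding bounded_pos by auto
    have "continuous_on {0<..<1} (\<lambda>t. F (Complex (x + t * (X - x)) S))"
      by (rule continuous_on_subset[OF cont]) auto
    then have "(\<lambda>t. F (Complex (x + t * (X - x)) S)) \<in> borel_measurable (restrict_space borel {0<..<1})"
      by (rule borel_measurable_continuous_on_restrict)
    then have "(\<lambda>t. F (Complex (x + t * (X - x)) S)) \<in> borel_measurable unit_interval"
      by (subst measurable_cong_sets[OF _ refl, of _ "restrict_space borel {0<..<1}"])
        (auto simp: sets_restrict_space)
    then show ?thesis
      by (rule bounded_Lsq_unit_interval[where B = B]) (use B in auto)
  qed
  assume "\<not> ?thesis"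
  then have ge: "1 / n \<le> sqnorm unit_interval (\<lambda>t. F (Complex (x + t * (X - x)) S)) \<or>
      1 / n \<le> sqnorm unit_interval (\<lambda>t. F (Complex (x + t * (X - x)) (- S)))" if "S \<ge> real n" for S
    using that by (auto simp: not_less)
  have phi: "\<phi> S = ennreal (sqnorm unit_interval (\<lambda>t. F (Complex (x + t * (X - x)) S)))" for S
    unfolding \<phi>_def by (rule sqnorm_eq_nn_integral[OF L])
  have ge': "ennreal (1 / n) \<le> \<phi> S + \<phi> (- S)" if "S \<ge> real n" for S
    unfolding phi using ge[OF that] by (auto simp flip: ennreal_plus intro!: ennreal_leI intro: add_increasing add_increasing2)
  \<comment> \<open>F is arbitrary off the half-plane; extension by zero makes the integrand jointly
    measurable for Fubini.\<close>
  define F0 where "F0 s = indicator RHP s *\<^sub>R F s" for s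
  have F0 [measurable]: "F0 \<in> borel_measurable borel"
    unfolding F0_def
    by (rule borel_measurable_continuous_on_indicator)
      (use hol in \<open>auto intro!: holomorphic_on_imp_continuous_on borel_open open_halfspace_Re_gt\<close>)
  define f where "f S t = (cmod (F0 (of_real (x + t * (X - x)) + \<i> * of_real S)))\<^sup>2" for S t
  have f_eq: "f S t = (cmod (F (Complex (x + t * (X - x)) S)))\<^sup>2" if "0 < t" for S t
    using pos[OF that] unfolding f_def Complex_eq[symmetric] F0_def by simp
  have f_meas: "(\<lambda>(S, t). ennreal (f S t)) \<in> borel_measurable (lborel \<Otimes>\<^sub>M lborel)"
    unfolding f_def case_prod_beta by measurable
  have f_meas': "(\<lambda>(S, t). ennreal (f S t)) \<in> borel_measurable (lborel \<Otimes>\<^sub>M unit_interval)"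
  proof -
    have "(\<lambda>p. (fst p, snd p)) \<in> lborel \<Otimes>\<^sub>M unit_interval \<rightarrow>\<^sub>M lborel \<Otimes>\<^sub>M lborel"
      by (intro measurable_Pair measurable_fst measurable_compose[OF measurable_snd] measurable_restrict_space1) auto
    from measurable_compose[OF this f_meas] show ?thesis by simp
  qed
  have feq: "\<phi> S = (\<integral>\<^sup>+t. ennreal (f S t) \<partial>unit_interval)" for S
    unfolding \<phi>_def by (intro nn_integral_cong) (simp add: f_eq)
  interpret UI: sigma_finite_measure unit_interval by (rule unit_interval_sigma_finite)
  interpret P: pair_sigma_finite lborel unit_interval ..
  have \<phi>_meas [measurable]: "\<phi> \<in> borel_measurable lborel"
    unfolding feq by (rule UI.borel_measurable_nn_integral[OF f_meas'])
  have "(\<integral>\<^sup>+S. \<phi> S \<partial>lborel) = (\<integral>\<^sup>+t. \<integral>\<^sup>+S. ennreal (f S t) \<partial>lborel \<partial>unit_interval)"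
    unfolding feq by (rule P.Fubini'[symmetric]) (rule f_meas')
  also have "\<dots> \<le> (\<integral>\<^sup>+t. ennreal K \<partial>unit_interval)"
  proof (rule nn_integral_mono)
    fix t assume t: "t \<in> space unit_interval"
    have "(\<integral>\<^sup>+S. ennreal (f S t) \<partial>lborel) = (\<integral>\<^sup>+S. ennreal ((cmod (F (Complex (x + t * (X - x)) S)))\<^sup>2) \<partial>lborel)"
      using t by (intro nn_integral_cong) (simp add: f_eq)
    also have "\<dots> \<le> ennreal K"
      using F pos[of t] t by (simp add: H2_bound_def)
    finally show "(\<integral>\<^sup>+S. ennreal (f S t) \<partial>lborel) \<le> ennreal K" .
  qed
  also have "\<dots> = ennreal K" by (simp add: emeasure_restrict_space)
  finally have int: "(\<integral>\<^sup>+S. \<phi> S \<partial>lborel) \<le> ennreal K" .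
  have "(\<integral>\<^sup>+S. \<phi> (- S) \<partial>lborel) = (\<integral>\<^sup>+S. \<phi> S \<partial>lborel)"
    using nn_integral_real_affine[of \<phi> "-1" 0] by simp
  then have "(\<integral>\<^sup>+S. \<phi> S + \<phi> (- S) \<partial>lborel) \<le> ennreal K + ennreal K"
    using int by (subst nn_integral_add) (auto intro!: add_mono)
  \<comment> \<open>If every height from n on were bad, the integral over an interval of length n
    (2K + 1) would be at least 2K + 1, which exceeds the total 2K just obtained.\<close>
  moreover have "(\<integral>\<^sup>+S. ennreal (1 / n) * indicator {real n..real n + n * (2 * K + 1)} S \<partial>lborel)
      \<le> (\<integral>\<^sup>+S. \<phi> S + \<phi> (- S) \<partial>lborel)"
    by (intro nn_integral_mono) (auto simp: indicator_def ge')
  moreover have "(\<integral>\<^sup>+S. ennreal (1 / n) * indicator {real n..real n + n * (2 * K + 1)} S \<partial>lborel) = ennreal (2 * K + 1)"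
    using n F by (subst nn_integral_cmult) (auto simp: H2_bound_def simp flip: ennreal_mult)
  moreover have "K \<ge> 0" using F by (simp add: H2_bound_def)
  ultimately have "ennreal (2 * K + 1) \<le> ennreal K + ennreal K" by (metis order_trans)
  with \<open>K \<ge> 0\<close> show False by (simp flip: ennreal_plus)
qed

text \<open>A bounded mean square of F on the side is enough: the decay in S comes from the
  denominator alone.\<close>

lemma H2_bound_horizontal_integral:
  assumes F: "H2_bound F K" and x: "0 < x" "x < X" and S: "\<bar>S\<bar> > \<bar>Im w\<bar>"
    and small: "sqnorm unit_interval (\<lambda>t. F (Complex (x + t * (X - x)) S)) \<le> e" "e \<le> 1"
  shows "cmod (contour_integral (linepath (Complex x S) (Complex X S)) (\<lambda>\<zeta>. F \<zeta> / (\<zeta> - w)))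
     \<le> (X - x) / (\<bar>S\<bar> - \<bar>Im w\<bar>)"
proof -
  define G where "G t = F (Complex (x + t * (X - x)) S)" for t
  have hol: "F holomorphic_on RHP" using F by (simp add: H2_bound_def)
  have nz: "cmod (Complex r S - w) \<ge> \<bar>S\<bar> - \<bar>Im w\<bar>" for r
    using abs_Im_le_cmod[of "Complex r S - w"] by simp
  have pos: "0 < x + t * (X - x)" if "t \<in> {0..1}" for t
    using x that by (simp add: add_pos_nonneg)
  have cont: "continuous_on {0..1} G"
    unfolding G_def
    by (rule continuous_on_compose2[OF holomorphic_on_imp_continuous_on[OF hol]])
      (use pos in \<open>auto intro!: continuous_intros\<close>)
  have lp: "linepath (Complex x S) (Complex X S) t = Complex (x + t * (X - x)) S" for t
    by (simp add: linepath_def complex_eq_iff algebra_simps)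
  have "contour_integral (linepath (Complex x S) (Complex X S)) (\<lambda>\<zeta>. F \<zeta> / (\<zeta> - w))
      = integral {0..1} (\<lambda>t. G t / (Complex (x + t * (X - x)) S - w) * of_real (X - x))"
    unfolding contour_integral_integral vector_derivative_linepath_at
    by (simp add: lp G_def complex_of_real_def complex_diff)
  also have "cmod \<dots> \<le> integral {0..1} (\<lambda>t. (X - x) / (\<bar>S\<bar> - \<bar>Im w\<bar>) * cmod (G t))"
  proof (rule integral_norm_bound_integral)
    have ne: "Complex r S - w \<noteq> 0" for r using nz[of r] S by auto
    show "(\<lambda>t. G t / (Complex (x + t * (X - x)) S - w) * of_real (X - x)) integrable_on {0..1}"
      using ne by (intro integrable_continuous_real continuous_intros cont) auto
    show "(\<lambda>t. (X - x) / (\<bar>S\<bar> - \<bar>Im w\<bar>) * cmod (G t)) integrable_on {0..1}"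
      by (intro integrable_continuous_real continuous_intros cont)
    fix t :: real
    have "cmod (G t) * (X - x) / cmod (Complex (x + t * (X - x)) S - w) \<le> cmod (G t) * (X - x) / (\<bar>S\<bar> - \<bar>Im w\<bar>)"
      using nz[of "x + t * (X - x)"] S x by (intro divide_left_mono mult_nonneg_nonneg mult_pos_pos) auto
    then show "cmod (G t / (Complex (x + t * (X - x)) S - w) * of_real (X - x))
       \<le> (X - x) / (\<bar>S\<bar> - \<bar>Im w\<bar>) * cmod (G t)"
      using x by (simp add: norm_mult norm_divide mult.commute del: of_real_diff)
  qed
  also have "\<dots> = (X - x) / (\<bar>S\<bar> - \<bar>Im w\<bar>) * integral {0..1} (\<lambda>t. cmod (G t))"
    by (rule integral_mult_right)
  also have "\<dots> \<le> (X - x) / (\<bar>S\<bar> - \<bar>Im w\<bar>) * 1"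
  proof (intro mult_left_mono)
    have icont: "set_integrable lborel {0<..<1} (\<lambda>t. cmod (G t))"
      by (rule set_integrable_subset[OF borel_integrable_atLeastAtMost'[of 0 1]])
        (auto intro!: continuous_intros cont)
    have "integral {0..1} (\<lambda>t. cmod (G t)) = integral {0<..<1} (\<lambda>t. cmod (G t))"
      by (rule integral_open_interval_real)
    also have "\<dots> = (\<integral>t. cmod (G t) * cmod 1 \<partial>unit_interval)"
      using set_borel_integral_eq_integral(2)[OF icont]
      by (simp add: integral_restrict_space set_lebesgue_integral_def)
    also have "\<dots> \<le> 1"
    proof -
      have one: "(\<lambda>t. 1) \<in> Lsq unit_interval" "sqnorm unit_interval (\<lambda>t. 1) \<le> 1\<^sup>2"
        using bounded_Lsq_unit_interval[of "\<lambda>t. 1" 1] by simp_all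
      have GL: "G \<in> Lsq unit_interval"
      proof -
        have "bounded (G ` {0..1})"
          by (intro compact_imp_bounded compact_continuous_image cont) auto
        then obtain B where B: "B > 0" "\<And>t. t \<in> {0..1} \<Longrightarrow> cmod (G t) \<le> B"
          unfolding bounded_pos by auto
        have "continuous_on {0<..<1} G"
          by (rule continuous_on_subset[OF cont]) auto
        then have "G \<in> borel_measurable (restrict_space borel {0<..<1})"
          by (rule borel_measurable_continuous_on_restrict)
        then have "G \<in> borel_measurable unit_interval"
          by (subst measurable_cong_sets[OF _ refl, of _ "restrict_space borel {0<..<1}"])
            (auto simp: sets_restrict_space)
        then show ?thesis
          by (rule bounded_Lsq_unit_interval[where B = B]) (use B in auto)
      qed
      have "(\<integral>t. cmod (G t) * cmod 1 \<partial>unit_interval)\<^sup>2 \<le> sqnorm unit_interval G * sqnorm unit_interval (\<lambda>t. 1)"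
        by (rule Cauchy_Schwarz_Lsq[OF GL one(1)])
      also have "\<dots> \<le> 1 * 1"
        using small one(2) by (intro mult_mono) (auto simp: G_def[abs_def])
      finally show ?thesis
        using power2_le_imp_le[of "\<integral>t. cmod (G t) * cmod 1 \<partial>unit_interval" 1] by simp
    qed
    finally show "integral {0..1} (\<lambda>t. cmod (G t)) \<le> 1" .
  qed (use x S in auto)
  finally show ?thesis by simp
qed

text \<open>A point w to the left of the rectangle may lie outside the half-plane; the quotient is
  then holomorphic on the convex set of points to the right of both w and the imaginary axis, and
  Cauchy's theorem gives 0.\<close>

lemma holomorphic_rectangle:
  fixes F :: "complex \<Rightarrow> complex"
  assumes hol: "F holomorphic_on RHP" and x: "0 < x" "x < X" and w: "Re w \<noteq> x" "Re w < X"
    and S: "S > \<bar>Im w\<bar>"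
  shows "((\<lambda>\<zeta>. F \<zeta> / (\<zeta> - w)) has_contour_integral (2 * pi * \<i> * (if Re w > x then F w else 0)))
     (rectpath (Complex x (- S)) (Complex X S))"
proof (cases "Re w > x")
  case True
  have "((\<lambda>\<zeta>. F \<zeta> / (\<zeta> - w)) has_contour_integral
      (2 * pi * \<i> * winding_number (rectpath (Complex x (- S)) (Complex X S)) w * F w))
     (rectpath (Complex x (- S)) (Complex X S))"
  proof (rule Cauchy_integral_formula_convex_simple[where S = RHP])
    show "w \<in> interior RHP"
      using True x by (subst interior_open) (auto simp: open_halfspace_Re_gt)
    show "path_image (rectpath (Complex x (- S)) (Complex X S)) \<subseteq> RHP - {w}"
      using True x w S by (subst path_image_rectpath) auto
  qed (use hol in \<open>auto simp: convex_halfspace_Re_gt\<close>)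
  moreover have "winding_number (rectpath (Complex x (- S)) (Complex X S)) w = 1"
    using True w S by (intro winding_number_rectpath) (auto simp: in_box_complex_iff)
  ultimately show ?thesis using True by simp
next
  case False
  have "((\<lambda>\<zeta>. F \<zeta> / (\<zeta> - w)) has_contour_integral 0) (rectpath (Complex x (- S)) (Complex X S))"
  proof (rule Cauchy_theorem_convex_simple[where S = "{s. Re s > max 0 (Re w)}"])
    show "(\<lambda>\<zeta>. F \<zeta> / (\<zeta> - w)) holomorphic_on {s. Re s > max 0 (Re w)}"
      by (intro holomorphic_intros holomorphic_on_subset[OF hol]) auto
    show "convex {s. Re s > max 0 (Re w)}"
      by (rule convex_halfspace_Re_gt)
    show "path_image (rectpath (Complex x (- S)) (Complex X S)) \<subseteq> {s. Re s > max 0 (Re w)}"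
      using False x w S by (subst path_image_rectpath) auto
  qed auto
  then show ?thesis using False by simp
qed

lemma contour_integral_rectpath_split:
  assumes cont: "continuous_on (path_image (rectpath (Complex x (- S)) (Complex X S))) g"
    and x: "x < X" and S: "S > 0"
  shows "contour_integral (rectpath (Complex x (- S)) (Complex X S)) g =
     \<i> * integral {-S..S} (\<lambda>y. g (Complex X y)) - \<i> * integral {-S..S} (\<lambda>y. g (Complex x y)) +
     contour_integral (linepath (Complex x (- S)) (Complex X (- S))) g -
     contour_integral (linepath (Complex x S) (Complex X S)) g"
proof -
  have img: "path_image (rectpath (Complex x (- S)) (Complex X S)) =
      closed_segment (Complex x (- S)) (Complex X (- S)) \<union> (closed_segment (Complex X (- S)) (Complex X S)
      \<union> (closed_segment (Complex X S) (Complex x S) \<union> closed_segment (Complex x S) (Complex x (- S))))"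
    by (simp add: rectpath_def Let_def path_image_join Un_assoc)
  have ci: "g contour_integrable_on linepath (Complex x (- S)) (Complex X (- S))"
      "g contour_integrable_on linepath (Complex X (- S)) (Complex X S)"
      "g contour_integrable_on linepath (Complex X S) (Complex x S)"
      "g contour_integrable_on linepath (Complex x S) (Complex x (- S))"
    using cont unfolding img
    by (auto intro!: contour_integrable_continuous_linepath elim: continuous_on_subset)
  have "contour_integral (rectpath (Complex x (- S)) (Complex X S)) g =
      contour_integral (linepath (Complex x (- S)) (Complex X (- S))) g +
      (contour_integral (linepath (Complex X (- S)) (Complex X S)) g +
      (contour_integral (linepath (Complex X S) (Complex x S)) g +
       contour_integral (linepath (Complex x S) (Complex x (- S))) g))"
    using ci by (simp add: rectpath_def Let_def contour_integrable_joinI)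
  also have "contour_integral (linepath (Complex X (- S)) (Complex X S)) g = \<i> * integral {-S..S} (\<lambda>y. g (Complex X y))"
    using S by (intro contour_integral_linepath_same_Re) auto
  also have "contour_integral (linepath (Complex x S) (Complex x (- S))) g
      = - contour_integral (linepath (Complex x (- S)) (Complex x S)) g"
    using contour_integral_reversepath[of "linepath (Complex x (- S)) (Complex x S)" g] by simp
  also have "contour_integral (linepath (Complex x (- S)) (Complex x S)) g = \<i> * integral {-S..S} (\<lambda>y. g (Complex x y))"
    using S by (intro contour_integral_linepath_same_Re) auto
  also have "contour_integral (linepath (Complex X S) (Complex x S)) g
      = - contour_integral (linepath (Complex x S) (Complex X S)) g"
    using contour_integral_reversepath[of "linepath (Complex x S) (Complex X S)" g] by simp
  finally show ?thesis by simp
qed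

lemma integral_symmetric_LIMSEQ:
  fixes g :: "real \<Rightarrow> complex"
  assumes g: "integrable lborel g" and S: "filterlim S at_top sequentially"
  shows "(\<lambda>n. integral {-S n..S n} g) \<longlonglongrightarrow> (\<integral>y. g y \<partial>lborel)"
proof -
  have [measurable]: "g \<in> borel_measurable lborel" using g by auto
  have "set_integrable lborel {-S n..S n} g" for n
    unfolding set_integrable_def by (rule integrable_mult_indicator[OF _ g]) auto
  then have eq: "integral {-S n..S n} g = (\<integral>y. indicator {-S n..S n} y *\<^sub>R g y \<partial>lborel)" for n
    using set_borel_integral_eq_integral(2) unfolding set_lebesgue_integral_def by metis
  show ?thesis
    unfolding eq
  proof (rule integral_dominated_convergence[where w = "\<lambda>y. norm (g y)"])
    show "AE y in lborel. (\<lambda>n. indicator {-S n..S n} y *\<^sub>R g y) \<longlonglongrightarrow> g y"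
    proof (rule AE_I2)
      fix y :: real
      have "eventually (\<lambda>n. S n \<ge> \<bar>y\<bar>) sequentially"
        using S by (simp add: filterlim_at_top)
      then have "eventually (\<lambda>n. indicator {-S n..S n} y *\<^sub>R g y = g y) sequentially"
        by eventually_elim (auto simp: indicator_def)
      then show "(\<lambda>n. indicator {-S n..S n} y *\<^sub>R g y) \<longlonglongrightarrow> g y"
        by (rule tendsto_eventually)
    qed
  qed (use g in \<open>auto simp: indicator_def\<close>)
qed

lemma H2_bound_line_integrable:
  assumes "H2_bound F K" "x > 0" "x \<noteq> Re w"
  shows "integrable lborel (\<lambda>y. F (Complex x y) / (Complex x y - w))"
  using Lsq_mult_integrable[OF H2_bound_line(1)[OF assms(1,2)] line_kernel(1)[OF assms(3)]]
  by (simp add: divide_inverse)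

text \<open>The two vertical integrals converge absolutely, so only their difference survives when
  the rectangles grow along heights at which the horizontal sides are under control.\<close>

lemma H2_bound_line_difference:
  fixes F :: "complex \<Rightarrow> complex"
  assumes F: "H2_bound F K" and x: "0 < x" "x < X" and w: "Re w \<noteq> x" "Re w < X"
  shows "(\<integral>y. F (Complex X y) / (Complex X y - w) \<partial>lborel) - (\<integral>y. F (Complex x y) / (Complex x y - w) \<partial>lborel)
     = 2 * pi * (if Re w > x then F w else 0)"
proof -
  define g where "g \<zeta> = F \<zeta> / (\<zeta> - w)" for \<zeta>
  have hol: "F holomorphic_on RHP" using F by (simp add: H2_bound_def)
  obtain S where S: "\<And>n::nat. S n \<ge> real (Suc n)"
    "\<And>n. sqnorm unit_interval (\<lambda>t. F (Complex (x + t * (X - x)) (S n))) < 1 / real (Suc n)"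
    "\<And>n. sqnorm unit_interval (\<lambda>t. F (Complex (x + t * (X - x)) (- S n))) < 1 / real (Suc n)"
    using H2_bound_horizontal[OF F x, of "Suc n" for n] by (metis zero_less_Suc)
  have Slim: "filterlim S at_top sequentially"
    by (rule filterlim_at_top_mono[OF filterlim_real_sequentially])
      (use S(1) in \<open>auto intro!: always_eventually order_trans[OF _ S(1)]\<close>)
  have ev: "eventually (\<lambda>n. S n > \<bar>Im w\<bar>) sequentially"
    using Slim by (simp add: filterlim_at_top_dense)
  define h where "h n = contour_integral (linepath (Complex x (- S n)) (Complex X (- S n))) g
      - contour_integral (linepath (Complex x (S n)) (Complex X (S n))) g" for n
  have h0: "h \<longlonglongrightarrow> 0"
  proof (rule Lim_null_comparison)
    show "eventually (\<lambda>n. norm (h n) \<le> 2 * ((X - x) / (S n - \<bar>Im w\<bar>))) sequentially"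
      using ev
    proof eventually_elim
      case (elim n)
      have "sqnorm unit_interval (\<lambda>t. F (Complex (x + t * (X - x)) (S n))) \<le> 1"
        "sqnorm unit_interval (\<lambda>t. F (Complex (x + t * (X - x)) (- S n))) \<le> 1"
        using S(2,3)[of n] by (auto intro: order_trans[OF less_imp_le])
      then have "cmod (contour_integral (linepath (Complex x (S n)) (Complex X (S n))) g) \<le> (X - x) / (S n - \<bar>Im w\<bar>)"
        "cmod (contour_integral (linepath (Complex x (- S n)) (Complex X (- S n))) g) \<le> (X - x) / (S n - \<bar>Im w\<bar>)"
        using H2_bound_horizontal_integral[OF F x, of w "S n" 1]
          H2_bound_horizontal_integral[OF F x, of w "- S n" 1] elim
        unfolding g_def by simp_all
      then show ?case
        unfolding h_def by (intro order_trans[OF norm_triangle_ineq4]) linarith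
    qed
    have "filterlim (\<lambda>n. S n - \<bar>Im w\<bar>) at_infinity sequentially"
      using filterlim_tendsto_add_at_top[OF tendsto_const[of "- \<bar>Im w\<bar>"] Slim]
      by (intro filterlim_at_top_imp_at_infinity) simp
    then have "(\<lambda>n. (X - x) / (S n - \<bar>Im w\<bar>)) \<longlonglongrightarrow> 0"
      by (rule tendsto_divide_0[OF tendsto_const])
    then show "(\<lambda>n. 2 * ((X - x) / (S n - \<bar>Im w\<bar>))) \<longlonglongrightarrow> 0"
      by (intro tendsto_mult_right_zero)
  qed
  have "eventually (\<lambda>n. \<i> * integral {-S n..S n} (\<lambda>y. g (Complex X y)) - \<i> * integral {-S n..S n} (\<lambda>y. g (Complex x y)) + h n
      = 2 * pi * \<i> * (if Re w > x then F w else 0)) sequentially"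
    using ev
  proof eventually_elim
    case (elim n)
    have "continuous_on (path_image (rectpath (Complex x (- S n)) (Complex X (S n)))) g"
    proof -
      have "path_image (rectpath (Complex x (- S n)) (Complex X (S n))) \<subseteq> RHP - {w}"
        using x w elim by (subst path_image_rectpath) auto
      moreover have "g holomorphic_on RHP - {w}"
        unfolding g_def by (intro holomorphic_intros holomorphic_on_subset[OF hol]) auto
      ultimately show ?thesis
        by (meson continuous_on_subset holomorphic_on_imp_continuous_on)
    qed
    moreover have "0 < S n" using elim by simp
    moreover have "contour_integral (rectpath (Complex x (- S n)) (Complex X (S n))) g
        = 2 * pi * \<i> * (if Re w > x then F w else 0)"
      unfolding g_def by (rule contour_integral_unique[OF holomorphic_rectangle[OF hol x w elim]])
    ultimately show ?case
      using contour_integral_rectpath_split[OF _ x(2), of "S n" g] by (simp add: h_def add_diff_eq split del: if_split)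
  qed
  then have l1: "(\<lambda>n. \<i> * integral {-S n..S n} (\<lambda>y. g (Complex X y)) - \<i> * integral {-S n..S n} (\<lambda>y. g (Complex x y)) + h n)
      \<longlonglongrightarrow> 2 * pi * \<i> * (if Re w > x then F w else 0)"
    by (rule tendsto_eventually)
  have l2: "(\<lambda>n. \<i> * integral {-S n..S n} (\<lambda>y. g (Complex X y)) - \<i> * integral {-S n..S n} (\<lambda>y. g (Complex x y)) + h n)
      \<longlonglongrightarrow> \<i> * (\<integral>y. g (Complex X y) \<partial>lborel) - \<i> * (\<integral>y. g (Complex x y) \<partial>lborel) + 0"
    using x w unfolding g_def
    by (intro tendsto_intros h0 integral_symmetric_LIMSEQ[OF H2_bound_line_integrable[OF F] Slim]) auto
  from LIMSEQ_unique[OF l1 l2]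
  have "\<i> * ((\<integral>y. g (Complex X y) \<partial>lborel) - (\<integral>y. g (Complex x y) \<partial>lborel))
      = \<i> * (2 * pi * (if Re w > x then F w else 0))"
    by (simp add: algebra_simps)
  then show ?thesis by (simp add: g_def)
qed

text \<open>The right-hand line is moved to infinity: at real part X, Cauchy--Schwarz against a
  kernel of squared norm pi/(X - Re w) makes its integral vanish. The value 0 for w to the left of
  the line is as important as the formula itself, since it is what converts Cauchy kernels into
  Poisson kernels.\<close>

theorem H2_Cauchy:
  fixes F :: "complex \<Rightarrow> complex"
  assumes F: "H2_bound F K" and x: "0 < x" and w: "Re w \<noteq> x"
  shows "(\<integral>y. F (Complex x y) / (w - Complex x y) \<partial>lborel) = 2 * pi * (if Re w > x then F w else 0)"
proof -
  define J where "J X = (\<integral>y. F (Complex X y) / (Complex X y - w) \<partial>lborel)" for X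
  have "(\<lambda>n. J (max x (Re w) + real (Suc n))) \<longlonglongrightarrow> 0"
  proof (rule Lim_null_comparison)
    show "(\<lambda>n. sqrt (K * (pi / real (Suc n)))) \<longlonglongrightarrow> 0"
    proof -
      have "(\<lambda>n. K * (pi * inverse (real (Suc n)))) \<longlonglongrightarrow> K * (pi * 0)"
        by (intro tendsto_intros LIMSEQ_inverse_real_of_nat)
      then show ?thesis
        using tendsto_real_sqrt by (fastforce simp: divide_inverse)
    qed
    have "norm (J (max x (Re w) + real (Suc n))) \<le> sqrt (K * (pi / real (Suc n)))" for n
    proof -
      define X where "X = max x (Re w) + real (Suc n)"
      have X: "X > 0" "X \<noteq> Re w" "X - Re w \<ge> real (Suc n)" using x by (auto simp: X_def)
      have "J X = ip lborel (\<lambda>y. F (Complex X y)) (\<lambda>y. cnj (1 / (Complex X y - w)))"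
        by (simp add: J_def ip_def)
      then have "(cmod (J X))\<^sup>2 \<le> sqnorm lborel (\<lambda>y. F (Complex X y)) * sqnorm lborel (\<lambda>y. cnj (1 / (Complex X y - w)))"
        using ip_le[OF H2_bound_line(1)[OF F X(1)] Lsq_cnj[OF line_kernel(1)[OF X(2)]]] by simp
      also have "sqnorm lborel (\<lambda>y. cnj (1 / (Complex X y - w))) = pi / \<bar>X - Re w\<bar>"
        using line_kernel(2)[OF X(2)] unfolding sqnorm_def by (simp only: complex_mod_cnj)
      also have "sqnorm lborel (\<lambda>y. F (Complex X y)) * (pi / \<bar>X - Re w\<bar>) \<le> K * (pi / real (Suc n))"
        using H2_bound_line(2)[OF F X(1)] X F
        by (intro mult_mono divide_left_mono) (auto simp: H2_bound_def)
      finally show ?thesis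
        unfolding X_def by (rule real_le_rsqrt)
    qed
    then show "eventually (\<lambda>n. norm (J (max x (Re w) + real (Suc n))) \<le> sqrt (K * (pi / real (Suc n)))) sequentially"
      by simp
  qed
  then have "(\<lambda>n. J (max x (Re w) + real (Suc n)) - J x) \<longlonglongrightarrow> 0 - J x"
    by (intro tendsto_intros)
  moreover have "J (max x (Re w) + real (Suc n)) - J x = 2 * pi * (if Re w > x then F w else 0)" for n
    unfolding J_def using x w by (intro H2_bound_line_difference[OF F]) auto
  ultimately have "2 * pi * (if Re w > x then F w else 0) = 0 - J x"
    using LIMSEQ_unique[OF tendsto_const] by fastforce
  moreover have "(\<integral>y. F (Complex x y) / (w - Complex x y) \<partial>lborel) = - J x"
  proof -
    have "F (Complex x y) / (w - Complex x y) = - (F (Complex x y) / (Complex x y - w))" for y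
      by (metis minus_diff_eq minus_divide_right)
    then show ?thesis unfolding J_def by simp
  qed
  ultimately show ?thesis by simp
qed

section \<open>Isometry, boundary functions and the Poisson integral\<close>

text \<open>Agrees with \<open>laplace_L2\<close> for square integrable f on the half-plane; as an
  inner product it is visibly linear and continuous in f.\<close>

definition lap :: "(real \<Rightarrow> complex) \<Rightarrow> complex \<Rightarrow> complex" where
  "lap f s = ip unit_interval f (kern s)"

lemma laplace_L2_eq_lap: "f \<in> Lsq unit_interval \<Longrightarrow> Re s > 0 \<Longrightarrow> laplace_L2 f s = lap f s"
  by (simp add: lap_def laplace_L2_eq_ip)

lemma lap_powsum: "powsum_ok xs \<Longrightarrow> Re s > 0 \<Longrightarrow> lap (powsum xs) s = powsum_tr xs s"
  by (simp add: lap_def ip_powsum_kern)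

lemma lap_diff:
  "f \<in> Lsq unit_interval \<Longrightarrow> g \<in> Lsq unit_interval \<Longrightarrow> Re s > 0 \<Longrightarrow> lap (\<lambda>u. f u - g u) s = lap f s - lap g s"
  by (simp add: lap_def ip_diff_left kern_Lsq)

lemma lap_add:
  "f \<in> Lsq unit_interval \<Longrightarrow> g \<in> Lsq unit_interval \<Longrightarrow> Re s > 0 \<Longrightarrow> lap (\<lambda>u. f u + g u) s = lap f s + lap g s"
  by (simp add: lap_def ip_add_left kern_Lsq)

lemma lap_scale: "lap (\<lambda>u. c * f u) s = c * lap f s"
  by (simp add: lap_def ip_scale_left)

lemma lap_le:
  assumes "f \<in> Lsq unit_interval" "Re s > 0"
  shows "(cmod (lap f s))\<^sup>2 \<le> sqnorm unit_interval f / (2 * Re s)"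
  using ip_le[OF assms(1) kern_Lsq(1)[OF assms(2)]] kern_Lsq(2)[OF assms(2)] by (simp add: lap_def)

lemma lap_LIMSEQ:
  assumes "\<And>n. f n \<in> Lsq unit_interval" "g \<in> Lsq unit_interval" "Re s > 0"
    "(\<lambda>n. sqnorm unit_interval (\<lambda>u. f n u - g u)) \<longlonglongrightarrow> 0"
  shows "(\<lambda>n. lap (f n) s) \<longlonglongrightarrow> lap g s"
  unfolding lap_def by (intro ip_LIMSEQ assms kern_Lsq)

section \<open>Isometry on generalised polynomials\<close>

definition powsum_shift :: "complex \<Rightarrow> (complex \<times> complex) list \<Rightarrow> (complex \<times> complex) list" where
  "powsum_shift c xs = map (\<lambda>(k, z). (k, z + c)) xs"

lemma powsum_tr_powsum_shift: "powsum_tr (powsum_shift c xs) s = powsum_tr xs (s + c)"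
  by (simp add: powsum_tr_def powsum_shift_def o_def case_prod_unfold algebra_simps)

lemma powsum_powsum_shift: "u > 0 \<Longrightarrow> powsum (powsum_shift c xs) u = of_real u powr c * powsum xs u"
  by (induction xs) (auto simp: powsum_shift_def powr_add algebra_simps)

lemma powsum_ok_powsum_shift_pos: "powsum_ok xs \<Longrightarrow> Re c \<ge> 0 \<Longrightarrow> powsum_ok (powsum_shift c xs)"
  by (fastforce simp: powsum_ok_def powsum_shift_def)

text \<open>Finitely many poles strictly left of the axis leave a gap. Shifting by part of it turns
  the imaginary axis into a line inside the half-plane, where the Hardy space results apply.\<close>

lemma powsum_ok_powsum_shift_neg: "powsum_ok xs \<Longrightarrow> \<exists>d>0. powsum_ok (powsum_shift (- of_real d) xs)"
proof (induction xs)
  case Nil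
  show ?case by (auto simp: powsum_shift_def intro: exI[of _ 1])
next
  case (Cons a xs)
  obtain k z where a: "a = (k, z)" by force
  obtain d where d: "d > 0" "powsum_ok (powsum_shift (- of_real d) xs)" using Cons by (auto simp: a)
  \<comment> \<open>Half of the gap between the new exponent and -1/2, so that the inequality stays
    strict.\<close>
  define d' where "d' = min d ((Re z + 1/2) / 2)"
  have z: "Re z > -1/2" using Cons.prems by (simp add: a)
  have "d' \<le> (Re z + 1/2) / 2" unfolding d'_def by (rule min.cobounded2)
  then have d': "d' > 0" "Re z - d' > -1/2" using d z by (auto simp: d'_def)
  have "powsum_shift (- of_real d') xs = powsum_shift (of_real (d - d')) (powsum_shift (- of_real d) xs)"
    by (simp add: powsum_shift_def o_def case_prod_unfold)
  moreover have "powsum_ok (powsum_shift (of_real (d - d')) (powsum_shift (- of_real d) xs))"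
    by (rule powsum_ok_powsum_shift_pos[OF d(2)]) (simp add: d'_def)
  ultimately have "powsum_ok (powsum_shift (- of_real d') xs)" by (simp only:)
  then have "powsum_ok (powsum_shift (- of_real d') (a # xs))"
    using d' by (simp add: a powsum_shift_def)
  then show ?case using d' by blast
qed

lemma powsum_tr_line_Lsq:
  assumes "powsum_ok xs" "x \<ge> 0"
  shows "(\<lambda>y. powsum_tr xs (Complex x y)) \<in> Lsq lborel"
  using assms(1)
proof (induction xs)
  case Nil
  then show ?case by simp
next
  case (Cons a xs)
  obtain k z where a: "a = (k, z)" by force
  have "x \<noteq> Re (- z - 1/2)" using Cons.prems assms by (simp add: a)
  from line_kernel(1)[OF this]
  have "(\<lambda>y. 1 / (Complex x y + z + 1/2)) \<in> Lsq lborel" by (simp add: algebra_simps)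
  then have "(\<lambda>y. k * (1 / (Complex x y + z + 1/2)) + powsum_tr xs (Complex x y)) \<in> Lsq lborel"
    using Cons by (intro Lsq_add Lsq_scale) (auto simp: a)
  then show ?case by (simp add: a)
qed

lemma powsum_tr_holomorphic: "powsum_ok xs \<Longrightarrow> powsum_tr xs holomorphic_on {s. Re s \<ge> 0}"
proof (induction xs)
  case Nil
  have "powsum_tr [] = (\<lambda>s. 0)" by auto
  then show ?case by simp
next
  case (Cons a xs)
  obtain k z where a: "a = (k, z)" by force
  have "s + z + 1/2 \<noteq> 0" if "Re s \<ge> 0" for s
    using that Cons.prems by (auto simp: a complex_eq_iff)
  then have "(\<lambda>s. k / (s + z + 1/2) + powsum_tr xs s) holomorphic_on {s. Re s \<ge> 0}"
    using Cons by (intro holomorphic_intros) (auto simp: a)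
  then show ?case by (simp add: a powsum_tr_def)
qed

lemma powsum_tr_H2_bound: "powsum_ok xs \<Longrightarrow> \<exists>K. H2_bound (powsum_tr xs) K"
proof -
  assume ok: "powsum_ok xs"
  have "\<exists>K\<ge>0. \<forall>x>0. sqnorm lborel (\<lambda>y. powsum_tr xs (Complex x y)) \<le> K"
    using ok
  proof (induction xs)
    case Nil
    then show ?case by auto
  next
    case (Cons a xs)
    obtain k z where a: "a = (k, z)" by force
    obtain K where K: "K \<ge> 0" "\<And>x. x > 0 \<Longrightarrow> sqnorm lborel (\<lambda>y. powsum_tr xs (Complex x y)) \<le> K"
      using Cons by (auto simp: a)
    have "sqnorm lborel (\<lambda>y. powsum_tr (a # xs) (Complex x y)) \<le> 2 * ((cmod k)\<^sup>2 * (pi / (Re z + 1/2))) + 2 * K" if x: "x > 0" for x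
    proof -
      have ne: "x \<noteq> Re (- z - 1/2)" using Cons.prems x by (simp add: a)
      have L: "(\<lambda>y. 1 / (Complex x y + z + 1/2)) \<in> Lsq lborel"
        "sqnorm lborel (\<lambda>y. 1 / (Complex x y + z + 1/2)) = pi / \<bar>x + Re z + 1/2\<bar>"
        using line_kernel[OF ne] by (simp_all add: algebra_simps)
      have "sqnorm lborel (\<lambda>y. k * (1 / (Complex x y + z + 1/2)) + powsum_tr xs (Complex x y))
          \<le> 2 * sqnorm lborel (\<lambda>y. k * (1 / (Complex x y + z + 1/2))) + 2 * sqnorm lborel (\<lambda>y. powsum_tr xs (Complex x y))"
        using Cons.prems x by (intro sqnorm_add_le Lsq_scale L powsum_tr_line_Lsq) (auto simp: a)
      also have "\<dots> \<le> 2 * ((cmod k)\<^sup>2 * (pi / (Re z + 1/2))) + 2 * K"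
        unfolding sqnorm_scale L(2) using Cons.prems x
        by (intro add_mono mult_left_mono K divide_left_mono) (auto simp: a)
      finally show ?thesis by (simp add: a)
    qed
    moreover have "0 \<le> 2 * ((cmod k)\<^sup>2 * (pi / (Re z + 1/2))) + 2 * K"
      using K Cons.prems by (auto simp: a intro!: add_nonneg_nonneg mult_nonneg_nonneg divide_nonneg_nonneg)
    ultimately show ?case by blast
  qed
  then obtain K where K: "K \<ge> 0" "\<And>x. x > 0 \<Longrightarrow> sqnorm lborel (\<lambda>y. powsum_tr xs (Complex x y)) \<le> K" by blast
  have "H2_bound (powsum_tr xs) K"
    unfolding H2_bound_def
    using K ok by (auto simp: sqnorm_eq_nn_integral powsum_tr_line_Lsq intro!: ennreal_leI
        holomorphic_on_subset[OF powsum_tr_holomorphic])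
  then show ?thesis by blast
qed

text \<open>The axis is the boundary of the domain of \<open>H2_Cauchy\<close>. A rational transform
  extends beyond it, so the formula is applied on the line of real part d to the function translated
  by d.\<close>

lemma powsum_tr_Cauchy:
  assumes ok: "powsum_ok xs" and w: "Re w \<noteq> 0"
  shows "(\<integral>y. powsum_tr xs (Complex 0 y) / (w - Complex 0 y) \<partial>lborel) = 2 * pi * (if Re w > 0 then powsum_tr xs w else 0)"
proof -
  obtain d where d: "d > 0" "powsum_ok (powsum_shift (- of_real d) xs)"
    using powsum_ok_powsum_shift_neg[OF ok] by blast
  obtain K where K: "H2_bound (powsum_tr (powsum_shift (- of_real d) xs)) K"
    using powsum_tr_H2_bound[OF d(2)] by blast
  have e: "Complex d y + - of_real d = Complex 0 y" "w + of_real d - Complex d y = w - Complex 0 y"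
    "w + of_real d + - of_real d = w" for y
    by (auto simp: complex_eq_iff)
  have "Re (w + of_real d) \<noteq> d" using w by simp
  from H2_Cauchy[OF K d(1) this] show ?thesis
    unfolding powsum_tr_powsum_shift e by simp
qed

text \<open>By linearity the second argument may be a power u^z, which is the kernel at w =
  \<open>cnj z + 1/2\<close>. On the axis the conjugate of its transform is the Cauchy kernel 1/(w -
  iy), so both sides evaluate the transform of \<open>xs\<close> at w.\<close>

lemma powsum_tr_isometry_ip:
  assumes "powsum_ok xs" "powsum_ok ys"
  shows "ip lborel (\<lambda>y. powsum_tr xs (Complex 0 y)) (\<lambda>y. powsum_tr ys (Complex 0 y)) = 2 * pi * ip unit_interval (powsum xs) (powsum ys)"
  using assms(2)
proof (induction ys)
  case Nil
  then show ?case by (simp add: ip_def)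
next
  case (Cons a ys)
  obtain k z where a: "a = (k, z)" by force
  define w where "w = cnj z + 1/2"
  have z: "Re z > -1/2" "powsum_ok ys" "Re w > 0" using Cons.prems by (auto simp: a w_def)
  have "0 \<noteq> Re (- z - 1/2)" using z by simp
  from line_kernel(1)[OF this]
  have L: "(\<lambda>y. 1 / (Complex 0 y + z + 1/2)) \<in> Lsq lborel" by (simp add: algebra_simps)
  have kw: "kern w = (\<lambda>u. of_real u powr z)"
    by (auto simp: kern_def w_def)
  have cw: "cnj (1 / (Complex 0 y + z + 1/2)) = 1 / (w - Complex 0 y)" for y
  proof -
    have "cnj (Complex 0 y + z + 1/2) = w - Complex 0 y" by (simp add: complex_eq_iff w_def)
    then show ?thesis by simp
  qed
  have "ip lborel (\<lambda>y. powsum_tr xs (Complex 0 y)) (\<lambda>y. k * (1 / (Complex 0 y + z + 1/2)) + powsum_tr ys (Complex 0 y))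
      = cnj k * ip lborel (\<lambda>y. powsum_tr xs (Complex 0 y)) (\<lambda>y. 1 / (Complex 0 y + z + 1/2))
        + ip lborel (\<lambda>y. powsum_tr xs (Complex 0 y)) (\<lambda>y. powsum_tr ys (Complex 0 y))"
    using assms z by (simp add: ip_add_right Lsq_scale[OF L] powsum_tr_line_Lsq ip_scale_right del: times_divide_eq_right)
  also have "ip lborel (\<lambda>y. powsum_tr xs (Complex 0 y)) (\<lambda>y. 1 / (Complex 0 y + z + 1/2)) = 2 * pi * powsum_tr xs w"
    using powsum_tr_Cauchy[OF assms(1), of w] z(3) by (simp only: ip_def cw) simp
  also have "powsum_tr xs w = ip unit_interval (powsum xs) (\<lambda>u. of_real u powr z)"
    using ip_powsum_kern[OF z(3) assms(1)] by (simp add: kw)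
  finally have 1: "ip lborel (\<lambda>y. powsum_tr xs (Complex 0 y)) (\<lambda>y. k * (1 / (Complex 0 y + z + 1/2)) + powsum_tr ys (Complex 0 y))
      = 2 * pi * (cnj k * ip unit_interval (powsum xs) (\<lambda>u. of_real u powr z) + ip unit_interval (powsum xs) (powsum ys))"
    using Cons.IH z by (simp add: algebra_simps)
  have "cnj k * ip unit_interval (powsum xs) (\<lambda>u. of_real u powr z) + ip unit_interval (powsum xs) (powsum ys)
      = ip unit_interval (powsum xs) (\<lambda>u. k * of_real u powr z + powsum ys u)"
    using assms z powr_Lsq[OF z(1)] by (simp add: ip_add_right Lsq_scale powsum_Lsq ip_scale_right)
  moreover have "powsum (a # ys) = (\<lambda>u. k * of_real u powr z + powsum ys u)" by (auto simp: a)
  ultimately show ?case using 1 by (simp add: a)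
qed

lemma powsum_tr_isometry:
  assumes "powsum_ok xs"
  shows "sqnorm lborel (\<lambda>y. powsum_tr xs (Complex 0 y)) = 2 * pi * sqnorm unit_interval (powsum xs)"
proof -
  have "complex_of_real (sqnorm lborel (\<lambda>y. powsum_tr xs (Complex 0 y))) = of_real (2 * pi * sqnorm unit_interval (powsum xs))"
    using powsum_tr_isometry_ip[OF assms assms] by (simp add: ip_self)
  then show ?thesis by (simp only: of_real_eq_iff)
qed

lemma powsum_tr_isometry_diff:
  assumes "powsum_ok xs" "powsum_ok ys"
  shows "sqnorm lborel (\<lambda>y. powsum_tr xs (Complex 0 y) - powsum_tr ys (Complex 0 y))
    = 2 * pi * sqnorm unit_interval (\<lambda>u. powsum xs u - powsum ys u)"
proof -
  have "powsum_ok (xs @ powsum_scale (-1) ys)" using assms by simp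
  from powsum_tr_isometry[OF this] show ?thesis
    by (simp add: sqnorm_def)
qed

text \<open>A relation and not a function, since the boundary function is only determined almost
  everywhere.\<close>

definition boundary_trace :: "(real \<Rightarrow> complex) \<Rightarrow> (real \<Rightarrow> complex) \<Rightarrow> bool" where
  "boundary_trace f \<Phi> \<longleftrightarrow> f \<in> Lsq unit_interval \<and> \<Phi> \<in> Lsq lborel \<and>
     (\<exists>xs. (\<forall>n. powsum_ok (xs n)) \<and> (\<lambda>n. sqnorm unit_interval (\<lambda>u. powsum (xs n) u - f u)) \<longlonglongrightarrow> 0 \<and>
        (\<lambda>n. sqnorm lborel (\<lambda>y. powsum_tr (xs n) (Complex 0 y) - \<Phi> y)) \<longlonglongrightarrow> 0)"

text \<open>The isometry carries the Cauchy property from the interval to the axis. The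
  approximating sequence is prescribed because the limit is later identified along that very
  sequence.\<close>

lemma boundary_trace_exists_seq:
  assumes f: "f \<in> Lsq unit_interval" and ok: "\<And>n. powsum_ok (xs n)"
    and lim: "(\<lambda>n. sqnorm unit_interval (\<lambda>u. powsum (xs n) u - f u)) \<longlonglongrightarrow> 0"
  obtains \<Phi> where "boundary_trace f \<Phi>" "(\<lambda>n. sqnorm lborel (\<lambda>y. powsum_tr (xs n) (Complex 0 y) - \<Phi> y)) \<longlonglongrightarrow> 0"
proof -
  have "\<exists>\<Phi>\<in>Lsq lborel. (\<lambda>n. sqnorm lborel (\<lambda>y. powsum_tr (xs n) (Complex 0 y) - \<Phi> y)) \<longlonglongrightarrow> 0"
  proof (rule Lsq_complete)
    show "(\<lambda>y. powsum_tr (xs n) (Complex 0 y)) \<in> Lsq lborel" for n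
      using ok by (intro powsum_tr_line_Lsq) auto
    fix e :: real assume "e > 0"
    then have "e / (2 * pi) > 0" by simp
    from sqnorm_LIMSEQ_Cauchy[OF powsum_Lsq[OF ok] f lim this] obtain N where
      "\<And>m n. m \<ge> N \<Longrightarrow> n \<ge> N \<Longrightarrow> sqnorm unit_interval (\<lambda>u. powsum (xs m) u - powsum (xs n) u) < e / (2 * pi)"
      by blast
    then show "\<exists>N. \<forall>m\<ge>N. \<forall>n\<ge>N. sqnorm lborel (\<lambda>y. powsum_tr (xs m) (Complex 0 y) - powsum_tr (xs n) (Complex 0 y)) < e"
      unfolding powsum_tr_isometry_diff[OF ok ok] by (intro exI[of _ N]) (simp add: field_simps)
  qed
  with that f ok lim show thesis unfolding boundary_trace_def by blast
qed

lemma boundary_trace_exists: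
  assumes "f \<in> Lsq unit_interval"
  obtains \<Phi> where "boundary_trace f \<Phi>"
  using powsum_dense_seq[OF assms] boundary_trace_exists_seq[OF assms] by metis

lemma boundary_trace_Lsq: "boundary_trace f \<Phi> \<Longrightarrow> f \<in> Lsq unit_interval" "boundary_trace f \<Phi> \<Longrightarrow> \<Phi> \<in> Lsq lborel"
  by (auto simp: boundary_trace_def)

lemma boundary_trace_sqnorm:
  assumes "boundary_trace f \<Phi>" shows "sqnorm lborel \<Phi> = 2 * pi * sqnorm unit_interval f"
proof -
  obtain xs where xs: "\<And>n. powsum_ok (xs n)" "(\<lambda>n. sqnorm unit_interval (\<lambda>u. powsum (xs n) u - f u)) \<longlonglongrightarrow> 0"
    "(\<lambda>n. sqnorm lborel (\<lambda>y. powsum_tr (xs n) (Complex 0 y) - \<Phi> y)) \<longlonglongrightarrow> 0"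
    using assms by (auto simp: boundary_trace_def)
  have "(\<lambda>n. sqnorm lborel (\<lambda>y. powsum_tr (xs n) (Complex 0 y))) \<longlonglongrightarrow> sqnorm lborel \<Phi>"
    using xs by (intro sqnorm_LIMSEQ powsum_tr_line_Lsq boundary_trace_Lsq[OF assms]) auto
  moreover have "(\<lambda>n. 2 * pi * sqnorm unit_interval (powsum (xs n))) \<longlonglongrightarrow> 2 * pi * sqnorm unit_interval f"
    using xs by (intro tendsto_intros sqnorm_LIMSEQ powsum_Lsq boundary_trace_Lsq[OF assms]) auto
  ultimately show ?thesis
    using xs(1) by (simp add: powsum_tr_isometry LIMSEQ_unique)
qed

lemma boundary_trace_diff:
  assumes "boundary_trace f \<Phi>" "powsum_ok ys"
  shows "boundary_trace (\<lambda>u. f u - powsum ys u) (\<lambda>y. \<Phi> y - powsum_tr ys (Complex 0 y))"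
proof -
  obtain xs where xs: "\<And>n. powsum_ok (xs n)" "(\<lambda>n. sqnorm unit_interval (\<lambda>u. powsum (xs n) u - f u)) \<longlonglongrightarrow> 0"
    "(\<lambda>n. sqnorm lborel (\<lambda>y. powsum_tr (xs n) (Complex 0 y) - \<Phi> y)) \<longlonglongrightarrow> 0"
    using assms by (auto simp: boundary_trace_def)
  show ?thesis
    unfolding boundary_trace_def
    using xs assms(2) boundary_trace_Lsq[OF assms(1)]
    by (intro conjI exI[of _ "\<lambda>n. xs n @ powsum_scale (-1) ys"]) (auto intro!: Lsq_diff powsum_Lsq powsum_tr_line_Lsq)
qed

lemma axis_kernel:
  assumes "Re w \<noteq> 0"
  shows "(\<lambda>y. 1 / (w - Complex 0 y)) \<in> Lsq lborel"
proof -
  have "(\<lambda>y. (-1) * (1 / (Complex 0 y - w))) \<in> Lsq lborel"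
    using assms by (intro Lsq_scale line_kernel) auto
  moreover have "(-1) * (1 / (Complex 0 y - w)) = 1 / (w - Complex 0 y)" for y
    by (metis minus_diff_eq minus_divide_right mult_minus1)
  ultimately show ?thesis by simp
qed

lemma boundary_trace_Cauchy:
  assumes "boundary_trace f \<Phi>" and w: "Re w \<noteq> 0"
  shows "(\<integral>y. \<Phi> y / (w - Complex 0 y) \<partial>lborel) = 2 * pi * (if Re w > 0 then lap f w else 0)"
proof -
  obtain xs where xs: "\<And>n. powsum_ok (xs n)" "(\<lambda>n. sqnorm unit_interval (\<lambda>u. powsum (xs n) u - f u)) \<longlonglongrightarrow> 0"
    "(\<lambda>n. sqnorm lborel (\<lambda>y. powsum_tr (xs n) (Complex 0 y) - \<Phi> y)) \<longlonglongrightarrow> 0"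
    using assms by (auto simp: boundary_trace_def)
  define k where "k y = cnj (1 / (w - Complex 0 y))" for y
  have k: "k \<in> Lsq lborel" unfolding k_def[abs_def] by (intro Lsq_cnj axis_kernel w)
  have eq: "ip lborel \<Psi> k = (\<integral>y. \<Psi> y / (w - Complex 0 y) \<partial>lborel)" for \<Psi>
    by (simp add: ip_def k_def)
  have "(\<lambda>n. ip lborel (\<lambda>y. powsum_tr (xs n) (Complex 0 y)) k) \<longlonglongrightarrow> ip lborel \<Phi> k"
    using xs by (intro ip_LIMSEQ powsum_tr_line_Lsq boundary_trace_Lsq[OF assms(1)] k) auto
  then have 1: "(\<lambda>n. 2 * pi * (if Re w > 0 then powsum_tr (xs n) w else 0)) \<longlonglongrightarrow> ip lborel \<Phi> k"
    unfolding eq powsum_tr_Cauchy[OF xs(1) w] .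
  have "(\<lambda>n. 2 * pi * (if Re w > 0 then powsum_tr (xs n) w else 0)) \<longlonglongrightarrow> 2 * pi * (if Re w > 0 then lap f w else 0)"
  proof (cases "Re w > 0")
    case True
    have "(\<lambda>n. lap (powsum (xs n)) w) \<longlonglongrightarrow> lap f w"
      using xs True by (intro lap_LIMSEQ powsum_Lsq boundary_trace_Lsq[OF assms(1)]) auto
    then show ?thesis using True xs by (auto simp: lap_powsum intro!: tendsto_intros)
  qed auto
  from LIMSEQ_unique[OF 1 this] show ?thesis by (simp add: eq)
qed

section \<open>The Poisson integral\<close>

definition poisson :: "real \<Rightarrow> real \<Rightarrow> real" where
  "poisson x t = x / (pi * (x\<^sup>2 + t\<^sup>2))"

lemma poisson_nonneg: "x > 0 \<Longrightarrow> poisson x t \<ge> 0"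
  by (simp add: poisson_def)

lemma poisson_measurable [measurable]: "poisson x \<in> borel_measurable borel"
  unfolding poisson_def by measurable

lemma poisson_nn_integral:
  assumes "x > 0" shows "(\<integral>\<^sup>+y. ennreal (poisson x (y - v)) \<partial>lborel) = 1"
proof -
  have "(\<integral>\<^sup>+y. ennreal (poisson x (y - v)) \<partial>lborel) = (\<integral>\<^sup>+y. ennreal (x / pi) * ennreal (1 / (x\<^sup>2 + (y - v)\<^sup>2)) \<partial>lborel)"
    using assms by (intro nn_integral_cong) (simp add: poisson_def flip: ennreal_mult)
  also have "\<dots> = ennreal (x / pi) * ennreal (pi / x)"
    by (subst nn_integral_cmult) (auto simp: nn_integral_inverse_quadratic assms)
  also have "\<dots> = 1" using assms by (simp flip: ennreal_mult)
  finally show ?thesis .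
qed

text \<open>Up to the factor 1/(2 pi), the Poisson kernel is the difference of the Cauchy kernels at
  w and at its mirror image w' in the axis. The first reproduces the transform at w, the second
  integrates to 0.\<close>

lemma boundary_trace_poisson:
  assumes "boundary_trace f \<Phi>" and x: "x > 0"
  shows "integrable lborel (\<lambda>y. of_real (poisson x (y - v)) * \<Phi> y)"
    and "lap f (Complex x v) = (\<integral>y. of_real (poisson x (y - v)) * \<Phi> y \<partial>lborel)"
proof -
  define w where "w = Complex x v"
  define w' where "w' = Complex (- x) v"
  have w: "Re w > 0" "Re w \<noteq> 0" "Re w' < 0" "Re w' \<noteq> 0" using x by (auto simp: w_def w'_def)
  have nz: "w - Complex 0 y \<noteq> 0" "w' - Complex 0 y \<noteq> 0" for y
    using w by (auto simp: complex_eq_iff)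
  have i1: "integrable lborel (\<lambda>y. \<Phi> y / (w - Complex 0 y))" "integrable lborel (\<lambda>y. \<Phi> y / (w' - Complex 0 y))"
    using Lsq_mult_integrable[OF boundary_trace_Lsq(2)[OF assms(1)] axis_kernel[OF w(2)]]
      Lsq_mult_integrable[OF boundary_trace_Lsq(2)[OF assms(1)] axis_kernel[OF w(4)]] by simp_all
  have key: "of_real (poisson x (y - v)) * \<Phi> y = of_real (1 / (2 * pi)) * (\<Phi> y / (w - Complex 0 y) - \<Phi> y / (w' - Complex 0 y))" for y
  proof -
    have "(w - Complex 0 y) * (w' - Complex 0 y) = - of_real (x\<^sup>2 + (y - v)\<^sup>2)"
      by (simp add: w_def w'_def complex_eq_iff power2_eq_square algebra_simps)
    moreover have "(w' - Complex 0 y) - (w - Complex 0 y) = - of_real (2 * x)"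
      by (simp add: w_def w'_def complex_eq_iff)
    moreover have "1 / (w - Complex 0 y) - 1 / (w' - Complex 0 y)
        = ((w' - Complex 0 y) - (w - Complex 0 y)) / ((w - Complex 0 y) * (w' - Complex 0 y))"
      using nz[of y] by (simp add: divide_simps)
    ultimately have "1 / (w - Complex 0 y) - 1 / (w' - Complex 0 y) = - of_real (2 * x) / - of_real (x\<^sup>2 + (y - v)\<^sup>2)"
      by (simp only:)
    also have "\<dots> = of_real (2 * x / (x\<^sup>2 + (y - v)\<^sup>2))"
      by (simp only: minus_divide_divide of_real_divide)
    finally have "of_real (1 / (2 * pi)) * (\<Phi> y * (1 / (w - Complex 0 y) - 1 / (w' - Complex 0 y)))
       = of_real (1 / (2 * pi) * (2 * x / (x\<^sup>2 + (y - v)\<^sup>2))) * \<Phi> y" by simp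
    also have "1 / (2 * pi) * (2 * x / (x\<^sup>2 + (y - v)\<^sup>2)) = poisson x (y - v)"
      by (simp add: poisson_def)
    finally show ?thesis by (simp add: right_diff_distrib)
  qed
  show "integrable lborel (\<lambda>y. of_real (poisson x (y - v)) * \<Phi> y)"
    unfolding key using i1 by (intro integrable_mult_right Bochner_Integration.integrable_diff)
  have "(\<integral>y. of_real (poisson x (y - v)) * \<Phi> y \<partial>lborel)
      = of_real (1 / (2 * pi)) * ((\<integral>y. \<Phi> y / (w - Complex 0 y) \<partial>lborel) - (\<integral>y. \<Phi> y / (w' - Complex 0 y) \<partial>lborel))"
    unfolding key using i1 by (subst Bochner_Integration.integral_diff[symmetric]) auto
  also have "\<dots> = lap f w"
    using w boundary_trace_Cauchy[OF assms(1) w(2)] boundary_trace_Cauchy[OF assms(1) w(4)] by simp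
  finally show "lap f (Complex x v) = (\<integral>y. of_real (poisson x (y - v)) * \<Phi> y \<partial>lborel)"
    by (simp add: w_def)
qed

text \<open>Jensen's inequality for a kernel of mass 1, by Cauchy--Schwarz after splitting the
  kernel into two square roots.\<close>

lemma boundary_trace_poisson_sq:
  assumes "boundary_trace f \<Phi>" and x: "x > 0"
  shows "ennreal ((cmod (lap f (Complex x v)))\<^sup>2) \<le> (\<integral>\<^sup>+y. ennreal (poisson x (y - v)) * ennreal ((cmod (\<Phi> y))\<^sup>2) \<partial>lborel)"
proof -
  have [measurable]: "\<Phi> \<in> borel_measurable borel" using boundary_trace_Lsq(2)[OF assms(1)] by (auto simp: Lsq_def)
  have "ennreal (cmod (lap f (Complex x v))) \<le> (\<integral>\<^sup>+y. ennreal (cmod (of_real (poisson x (y - v)) * \<Phi> y)) \<partial>lborel)"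
    unfolding boundary_trace_poisson(2)[OF assms] by (rule integral_norm_bound_ennreal[OF boundary_trace_poisson(1)[OF assms]])
  also have "\<dots> = (\<integral>\<^sup>+y. ennreal (sqrt (poisson x (y - v))) * ennreal (sqrt (poisson x (y - v)) * cmod (\<Phi> y)) \<partial>lborel)"
    using poisson_nonneg[OF x] by (intro nn_integral_cong) (simp add: norm_mult flip: ennreal_mult mult.assoc)
  finally have "(ennreal (cmod (lap f (Complex x v))))\<^sup>2
      \<le> (\<integral>\<^sup>+y. ennreal (sqrt (poisson x (y - v))) * ennreal (sqrt (poisson x (y - v)) * cmod (\<Phi> y)) \<partial>lborel)\<^sup>2"
    by (intro power_mono) auto
  also have "\<dots> \<le> (\<integral>\<^sup>+y. (ennreal (sqrt (poisson x (y - v))))\<^sup>2 \<partial>lborel) *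
      (\<integral>\<^sup>+y. (ennreal (sqrt (poisson x (y - v)) * cmod (\<Phi> y)))\<^sup>2 \<partial>lborel)"
    by (rule Cauchy_Schwarz_nn_integral) measurable
  also have "(\<integral>\<^sup>+y. (ennreal (sqrt (poisson x (y - v))))\<^sup>2 \<partial>lborel) = 1"
    using poisson_nn_integral[OF x, of v] poisson_nonneg[OF x] by (simp add: ennreal_power)
  also have "(\<integral>\<^sup>+y. (ennreal (sqrt (poisson x (y - v)) * cmod (\<Phi> y)))\<^sup>2 \<partial>lborel)
     = (\<integral>\<^sup>+y. ennreal (poisson x (y - v)) * ennreal ((cmod (\<Phi> y))\<^sup>2) \<partial>lborel)"
    using poisson_nonneg[OF x] by (simp add: ennreal_power power_mult_distrib ennreal_mult)
  finally show ?thesis by (simp add: ennreal_power)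
qed

section \<open>The transform on vertical lines\<close>

lemma upowr_Lsq:
  assumes f: "f \<in> Lsq unit_interval" and x: "x \<ge> 0"
  shows "(\<lambda>u. of_real (u powr x) * f u) \<in> Lsq unit_interval"
    and "sqnorm unit_interval (\<lambda>u. of_real (u powr x) * f u) \<le> sqnorm unit_interval f"
proof -
  have [measurable]: "f \<in> borel_measurable unit_interval" using f by measurable
  have "(\<lambda>u. complex_of_real (u powr x)) \<in> borel_measurable unit_interval"
    by (intro borel_measurable_unit_interval) measurable
  then have m: "(\<lambda>u. of_real (u powr x) * f u) \<in> borel_measurable unit_interval" by measurable
  have "cmod (of_real (u powr x) * f u) \<le> cmod (f u)" if "u \<in> space unit_interval" for u
    using powr_le_one_if_nonneg[of u x] x that by (simp add: norm_mult mult_left_le_one_le)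
  from Lsq_mono[OF f m this]
  show "(\<lambda>u. of_real (u powr x) * f u) \<in> Lsq unit_interval"
    "sqnorm unit_interval (\<lambda>u. of_real (u powr x) * f u) \<le> sqnorm unit_interval f" by auto
qed

text \<open>Multiplication by u^x translates the transform by x, so the line of real part x carries
  the boundary function of u^x f. Point evaluations converge along the approximants, which
  identifies that boundary function.\<close>

lemma lap_line:
  assumes f: "f \<in> Lsq unit_interval" and x: "x > 0"
  shows "(\<lambda>y. lap f (Complex x y)) \<in> Lsq lborel"
    and "sqnorm lborel (\<lambda>y. lap f (Complex x y)) = 2 * pi * sqnorm unit_interval (\<lambda>u. of_real (u powr x) * f u)"
proof -
  obtain xs where xs: "\<And>n. powsum_ok (xs n)" "(\<lambda>n. sqnorm unit_interval (\<lambda>u. powsum (xs n) u - f u)) \<longlonglongrightarrow> 0"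
    using powsum_dense_seq[OF f] by blast
  define ys where "ys n = powsum_shift (of_real x) (xs n)" for n
  have ys: "powsum_ok (ys n)" for n unfolding ys_def using xs x by (intro powsum_ok_powsum_shift_pos) auto
  have yseq: "powsum (ys n) u = of_real (u powr x) * powsum (xs n) u" if "u > 0" for n u
    using that by (simp add: ys_def powsum_powsum_shift powr_of_real)
  have fx: "(\<lambda>u. of_real (u powr x) * f u) \<in> Lsq unit_interval" using f x by (intro upowr_Lsq) auto
  have "(\<lambda>n. sqnorm unit_interval (\<lambda>u. powsum (ys n) u - of_real (u powr x) * f u)) \<longlonglongrightarrow> 0"
  proof (rule tendsto_sandwich[OF _ _ tendsto_const xs(2)])
    have "sqnorm unit_interval (\<lambda>u. powsum (ys n) u - of_real (u powr x) * f u)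
        = sqnorm unit_interval (\<lambda>u. of_real (u powr x) * (powsum (xs n) u - f u))" for n
      unfolding sqnorm_def by (intro Bochner_Integration.integral_cong) (auto simp: yseq algebra_simps)
    also have "\<dots> n \<le> sqnorm unit_interval (\<lambda>u. powsum (xs n) u - f u)" for n
      using x by (intro upowr_Lsq Lsq_diff powsum_Lsq xs f) auto
    finally show "\<forall>\<^sub>F n in sequentially. sqnorm unit_interval (\<lambda>u. powsum (ys n) u - of_real (u powr x) * f u)
        \<le> sqnorm unit_interval (\<lambda>u. powsum (xs n) u - f u)" by simp
  qed auto
  from boundary_trace_exists_seq[OF fx ys this] obtain \<Phi> where \<Phi>: "boundary_trace (\<lambda>u. of_real (u powr x) * f u) \<Phi>"
    and lim: "(\<lambda>n. sqnorm lborel (\<lambda>y. powsum_tr (ys n) (Complex 0 y) - \<Phi> y)) \<longlonglongrightarrow> 0" by blast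
  have "AE y in lborel. \<Phi> y = lap f (Complex x y)"
  proof (rule sqnorm_LIMSEQ_unique_AE[OF _ boundary_trace_Lsq(2)[OF \<Phi>] lim])
    show "(\<lambda>y. powsum_tr (ys n) (Complex 0 y)) \<in> Lsq lborel" for n
      by (intro powsum_tr_line_Lsq ys) auto
    fix y :: real
    have "(\<lambda>n. lap (powsum (xs n)) (Complex x y)) \<longlonglongrightarrow> lap f (Complex x y)"
      using xs x f by (intro lap_LIMSEQ powsum_Lsq) auto
    moreover have "Complex 0 y + of_real x = Complex x y" by (simp add: complex_eq_iff)
    ultimately show "(\<lambda>n. powsum_tr (ys n) (Complex 0 y)) \<longlonglongrightarrow> lap f (Complex x y)"
      using xs x by (simp add: lap_powsum ys_def powsum_tr_powsum_shift)
  qed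
  moreover have meas: "(\<lambda>y. lap f (Complex x y)) \<in> borel_measurable lborel"
  proof (rule borel_measurable_LIMSEQ_metric)
    show "(\<lambda>y. lap (powsum (xs n)) (Complex x y)) \<in> borel_measurable lborel" for n
      using Lsq_measurable[OF powsum_tr_line_Lsq[OF xs(1), of x n]] x xs by (simp add: lap_powsum)
    show "(\<lambda>n. lap (powsum (xs n)) (Complex x y)) \<longlonglongrightarrow> lap f (Complex x y)" for y
      using xs x f by (intro lap_LIMSEQ powsum_Lsq) auto
  qed
  ultimately show "(\<lambda>y. lap f (Complex x y)) \<in> Lsq lborel"
    and "sqnorm lborel (\<lambda>y. lap f (Complex x y)) = 2 * pi * sqnorm unit_interval (\<lambda>u. of_real (u powr x) * f u)"
    using Lsq_cong_AE[OF boundary_trace_Lsq(2)[OF \<Phi>]] sqnorm_cong_AE[OF Lsq_measurable[OF boundary_trace_Lsq(2)[OF \<Phi>]] meas] boundary_trace_sqnorm[OF \<Phi>]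
    by auto
qed

text \<open>The evaluation bound \<open>lap_le\<close> is uniform on sets bounded away from the
  axis, so rational transforms converge locally uniformly.\<close>

lemma lap_holomorphic:
  assumes f: "f \<in> Lsq unit_interval"
  shows "lap f holomorphic_on RHP"
proof -
  obtain xs where xs: "\<And>n. powsum_ok (xs n)" "(\<lambda>n. sqnorm unit_interval (\<lambda>u. powsum (xs n) u - f u)) \<longlonglongrightarrow> 0"
    using powsum_dense_seq[OF f] by blast
  show ?thesis
  proof (rule holomorphic_uniform_sequence[OF open_halfspace_Re_gt])
    show "powsum_tr (xs n) holomorphic_on RHP" for n
      by (rule holomorphic_on_subset[OF powsum_tr_holomorphic[OF xs(1)]]) auto
    fix s assume s: "s \<in> RHP"
    define d where "d = Re s / 2"
    have d: "d > 0" using s by (simp add: d_def)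
    have Re: "Re z \<ge> d" if "z \<in> cball s d" for z
      using that complex_Re_le_cmod[of "s - z"] by (simp add: d_def dist_norm)
    have "uniform_limit (cball s d) (\<lambda>n. powsum_tr (xs n)) (lap f) sequentially"
    proof (rule uniform_limitI)
      fix e :: real assume e: "e > 0"
      have "eventually (\<lambda>n. sqnorm unit_interval (\<lambda>u. powsum (xs n) u - f u) < e\<^sup>2 * (2 * d)) sequentially"
        using xs(2) e d by (intro order_tendstoD) auto
      then show "\<forall>\<^sub>F n in sequentially. \<forall>z\<in>cball s d. dist (powsum_tr (xs n) z) (lap f z) < e"
      proof (eventually_elim, intro ballI)
        fix n z assume n: "sqnorm unit_interval (\<lambda>u. powsum (xs n) u - f u) < e\<^sup>2 * (2 * d)" and z: "z \<in> cball s d"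
        have Rez: "Re z > 0" "Re z \<ge> d" using Re[OF z] d by auto
        have "(cmod (powsum_tr (xs n) z - lap f z))\<^sup>2 = (cmod (lap (\<lambda>u. powsum (xs n) u - f u) z))\<^sup>2"
          using Rez f xs by (simp add: lap_diff powsum_Lsq lap_powsum)
        also have "\<dots> \<le> sqnorm unit_interval (\<lambda>u. powsum (xs n) u - f u) / (2 * Re z)"
          using Rez f xs by (intro lap_le Lsq_diff powsum_Lsq)
        also have "\<dots> \<le> sqnorm unit_interval (\<lambda>u. powsum (xs n) u - f u) / (2 * d)"
          using Rez d by (intro divide_left_mono) auto
        also have "\<dots> < e\<^sup>2" using n d by (simp add: divide_simps)
        finally show "dist (powsum_tr (xs n) z) (lap f z) < e"
          using e by (simp add: dist_norm power2_less_imp_less)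
      qed
    qed
    moreover have "cball s d \<subseteq> RHP" using Re d by force
    ultimately show "\<exists>d>0. cball s d \<subseteq> RHP \<and> uniform_limit (cball s d) (\<lambda>n. powsum_tr (xs n)) (lap f) sequentially"
      using d by blast
  qed
qed

lemma lap_H2_bound:
  assumes f: "f \<in> Lsq unit_interval"
  shows "H2_bound (lap f) (2 * pi * sqnorm unit_interval f)"
  unfolding H2_bound_def
  using lap_holomorphic[OF f] upowr_Lsq(2)[OF f]
  by (auto simp: sqnorm_eq_nn_integral lap_line[OF f] intro!: ennreal_leI)

section \<open>Horizontal boundary limits\<close>

text \<open>The Hardy--Littlewood weak type inequality. A measurable superset \<open>U\<close> takes
  the place of the exceptional set, whose own measurability is thus no issue.\<close>

lemma maximal_weak_type:
  fixes \<psi> :: "real \<Rightarrow> ennreal"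
  assumes [measurable]: "\<psi> \<in> borel_measurable borel" and A: "(\<integral>\<^sup>+y. \<psi> y \<partial>lborel) \<le> ennreal A" "A \<ge> 0"
    and c: "c > 0"
  shows "\<exists>U\<in>sets lborel. {v. \<exists>r>0. ennreal (2 * r * c) \<le> (\<integral>\<^sup>+y. \<psi> y * indicator (cball v r) y \<partial>lborel)} \<subseteq> U
     \<and> emeasure lborel U \<le> ennreal (5 / c * A)"
proof -
  define S where "S = {v. \<exists>r>0. ennreal (2 * r * c) \<le> (\<integral>\<^sup>+y. \<psi> y * indicator (cball v r) y \<partial>lborel)}"
  obtain r where r: "\<And>v. v \<in> S \<Longrightarrow> r v > 0"
    "\<And>v. v \<in> S \<Longrightarrow> ennreal (2 * r v * c) \<le> (\<integral>\<^sup>+y. \<psi> y * indicator (cball v (r v)) y \<partial>lborel)"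
  proof -
    have "\<forall>v\<in>S. \<exists>r. r > 0 \<and> ennreal (2 * r * c) \<le> (\<integral>\<^sup>+y. \<psi> y * indicator (cball v r) y \<partial>lborel)"
      by (simp add: S_def)
    from bchoice[OF this] show thesis using that by blast
  qed
  \<comment> \<open>Vitali's lemma requires bounded radii; here the total mass A bounds
    them.\<close>
  have rB: "0 < r v \<and> r v \<le> A / (2 * c)" if "v \<in> S" for v
  proof -
    have "ennreal (2 * r v * c) \<le> (\<integral>\<^sup>+y. \<psi> y * indicator (cball v (r v)) y \<partial>lborel)" using r that by blast
    also have "\<dots> \<le> (\<integral>\<^sup>+y. \<psi> y \<partial>lborel)" by (intro nn_integral_mono) (auto simp: indicator_def)
    also have "\<dots> \<le> ennreal A" by (rule A)
    finally have "2 * r v * c \<le> A" using A by simp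
    then show ?thesis using r(1)[OF that] c by (simp add: field_simps)
  qed
  have "S \<subseteq> (\<Union>v\<in>S. cball v (r v))"
  proof
    fix v assume "v \<in> S"
    then show "v \<in> (\<Union>v\<in>S. cball v (r v))"
      using r(1)[of v] by (intro UN_I[of v]) auto
  qed
  from Vitali_covering_lemma_cballs[OF this rB]
  obtain C where C: "countable C" "C \<subseteq> S"
     "pairwise (\<lambda>i j. disjnt (cball i (r i)) (cball j (r j))) C"
     "S \<subseteq> (\<Union>i\<in>C. cball i (5 * r i))" by blast
  define U where "U = (\<Union>i\<in>C. cball i (5 * r i))"
  have U: "U \<in> sets lborel" unfolding U_def using C(1) by (intro sets.countable_UN') auto
  have "emeasure lborel U = (\<integral>\<^sup>+y. indicator U y \<partial>lborel)" using U by simp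
  \<comment> \<open>The sum over the countable family C is written as an integral over counting
    measure, so that it can be exchanged with the integral in y.\<close>
  also have "\<dots> \<le> (\<integral>\<^sup>+y. \<integral>\<^sup>+i. indicator (cball i (5 * r i)) y \<partial>count_space C \<partial>lborel)"
  proof (rule nn_integral_mono)
    fix y :: real
    show "indicator U y \<le> (\<integral>\<^sup>+i. indicator (cball i (5 * r i)) y \<partial>count_space C)"
    proof (cases "y \<in> U")
      case True
      then obtain i where i: "i \<in> C" "y \<in> cball i (5 * r i)" unfolding U_def by blast
      then show ?thesis
        using nn_integral_ge_point[OF i(1), of "\<lambda>i. indicator (cball i (5 * r i)) y"] by (simp add: indicator_def)
    qed simp
  qed
  also have "\<dots> = (\<integral>\<^sup>+i. \<integral>\<^sup>+y. indicator (cball i (5 * r i)) y \<partial>lborel \<partial>count_space C)"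
    by (rule nn_integral_count_space_nn_integral[OF C(1)]) (auto intro!: borel_measurable_indicator)
  also have "\<dots> \<le> (\<integral>\<^sup>+i. ennreal (5 / c) * (\<integral>\<^sup>+y. \<psi> y * indicator (cball i (r i)) y \<partial>lborel) \<partial>count_space C)"
  proof (rule nn_integral_mono)
    fix i assume "i \<in> space (count_space C)"
    then have i: "i \<in> S" using C by auto
    have "(\<integral>\<^sup>+y. indicator (cball i (5 * r i)) y \<partial>lborel) = ennreal (10 * r i)"
      using r(1)[OF i] by (simp add: cball_eq_atLeastAtMost)
    also have "\<dots> = ennreal (5 / c) * ennreal (2 * r i * c)"
      using c r(1)[OF i] by (simp flip: ennreal_mult)
    also have "\<dots> \<le> ennreal (5 / c) * (\<integral>\<^sup>+y. \<psi> y * indicator (cball i (r i)) y \<partial>lborel)"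
      by (intro mult_left_mono r i) auto
    finally show "(\<integral>\<^sup>+y. indicator (cball i (5 * r i)) y \<partial>lborel)
      \<le> ennreal (5 / c) * (\<integral>\<^sup>+y. \<psi> y * indicator (cball i (r i)) y \<partial>lborel)" .
  qed
  also have "\<dots> = ennreal (5 / c) * (\<integral>\<^sup>+i. \<integral>\<^sup>+y. \<psi> y * indicator (cball i (r i)) y \<partial>lborel \<partial>count_space C)"
    by (rule nn_integral_cmult) auto
  also have "(\<integral>\<^sup>+i. \<integral>\<^sup>+y. \<psi> y * indicator (cball i (r i)) y \<partial>lborel \<partial>count_space C)
      = (\<integral>\<^sup>+y. \<integral>\<^sup>+i. \<psi> y * indicator (cball i (r i)) y \<partial>count_space C \<partial>lborel)"
    by (rule nn_integral_count_space_nn_integral[OF C(1), symmetric])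
      (auto intro!: borel_measurable_indicator borel_measurable_times_ennreal assms(1))
  \<comment> \<open>The selected balls are disjoint, so each y is counted at most once.\<close>
  also have "\<dots> \<le> (\<integral>\<^sup>+y. \<psi> y \<partial>lborel)"
  proof (rule nn_integral_mono)
    fix y :: real
    show "(\<integral>\<^sup>+i. \<psi> y * indicator (cball i (r i)) y \<partial>count_space C) \<le> \<psi> y"
    proof (cases "\<exists>i\<in>C. y \<in> cball i (r i)")
      case True
      then obtain i where i: "i \<in> C" "y \<in> cball i (r i)" by blast
      have uniq: "j = i" if "j \<in> C" "y \<in> cball j (r j)" for j
        using C(3) i that by (auto simp: pairwise_def disjnt_iff)
      have "(\<integral>\<^sup>+i. \<psi> y * indicator (cball i (r i)) y \<partial>count_space C) = (\<integral>\<^sup>+j. \<psi> y * indicator {i} j \<partial>count_space C)"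
      proof (rule nn_integral_cong)
        fix j assume "j \<in> space (count_space C)"
        then have "j \<in> C" by simp
        then have "y \<in> cball j (r j) \<longleftrightarrow> j \<in> {i}" using i(2) uniq by blast
        then show "\<psi> y * indicator (cball j (r j)) y = \<psi> y * indicator {i} j"
          by (simp only: indicator_def)
      qed
      also have "\<dots> = \<psi> y" using i by (subst nn_integral_cmult_indicator) auto
      finally show ?thesis by simp
    next
      case False
      then have "(\<integral>\<^sup>+i. \<psi> y * indicator (cball i (r i)) y \<partial>count_space C) = (\<integral>\<^sup>+i. 0 \<partial>count_space C)"
        by (intro nn_integral_cong) (auto simp: indicator_def)
      then show ?thesis by simp
    qed
  qed
  also have "\<dots> \<le> ennreal A" by (rule A)
  finally have "emeasure lborel U \<le> ennreal (5 / c) * ennreal A" by (simp add: mult_left_mono)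
  moreover have "ennreal (5 / c * A) = ennreal (5 / c) * ennreal A" using c A by (intro ennreal_mult) auto
  ultimately have "emeasure lborel U \<le> ennreal (5 / c * A)" by (simp only:)
  with U C(4) show ?thesis unfolding S_def U_def by blast
qed

text \<open>Take the least j with |t| \<le> 2^j x. If j > 0, then |t| > 2^(j-1) x, and therefore 4^j
  x^2 \<le> 4 (x^2 + t^2) in every case; this is the origin of the numerator 4.\<close>

lemma poisson_le_dyadic:
  assumes x: "x > 0"
  shows "ennreal (poisson x t) \<le> (\<Sum>j. ennreal (4 / (pi * x * 4 ^ j)) * indicator {t. \<bar>t\<bar> \<le> 2 ^ j * x} t)"
proof -
  define j where "j = (LEAST j. \<bar>t\<bar> \<le> 2 ^ j * x)"
  have ex: "\<exists>j. \<bar>t\<bar> \<le> 2 ^ j * x"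
  proof -
    obtain n where "\<bar>t\<bar> / x < 2 ^ n" using real_arch_pow[of 2 "\<bar>t\<bar> / x"] by auto
    then show ?thesis using x by (intro exI[of _ n]) (simp add: field_simps)
  qed
  then have j: "\<bar>t\<bar> \<le> 2 ^ j * x" unfolding j_def by (rule LeastI_ex)
  have "4 ^ j * x\<^sup>2 \<le> 4 * (x\<^sup>2 + t\<^sup>2)"
  proof (cases j)
    case 0
    then show ?thesis by simp
  next
    case (Suc i)
    then have "\<not> \<bar>t\<bar> \<le> 2 ^ i * x" using not_less_Least[of i "\<lambda>j. \<bar>t\<bar> \<le> 2 ^ j * x"] by (simp add: j_def)
    then have *: "(2 ^ i * x)\<^sup>2 \<le> \<bar>t\<bar>\<^sup>2" using x by (intro power_mono) auto
    have "((2::real) ^ i)\<^sup>2 = (2\<^sup>2) ^ i"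
      by (simp only: power_mult[symmetric] mult.commute)
    then have "(2 ^ i * x)\<^sup>2 = 4 ^ i * x\<^sup>2"
      by (simp add: power_mult_distrib)
    moreover have "4 ^ j * x\<^sup>2 = 4 * (4 ^ i * x\<^sup>2)" using Suc by simp
    moreover have "\<bar>t\<bar>\<^sup>2 = t\<^sup>2" by simp
    moreover have "4 * t\<^sup>2 \<le> 4 * (x\<^sup>2 + t\<^sup>2)" by simp
    ultimately show ?thesis
      using mult_left_mono[OF *, of 4] by (simp only:) (meson order_trans zero_le_numeral)
  qed
  then have "x * (pi * x * 4 ^ j) \<le> 4 * (pi * (x\<^sup>2 + t\<^sup>2))"
    by (simp add: power2_eq_square mult.commute mult.left_commute)
  then have "poisson x t \<le> 4 / (pi * x * 4 ^ j)"
  proof -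
    have A: "pi * (x\<^sup>2 + t\<^sup>2) > 0" and B: "pi * x * 4 ^ j > 0"
      using x by (auto intro!: mult_pos_pos add_pos_nonneg)
    show ?thesis
      using \<open>x * (pi * x * 4 ^ j) \<le> 4 * (pi * (x\<^sup>2 + t\<^sup>2))\<close> unfolding poisson_def
      by (simp only: pos_divide_le_eq[OF A] times_divide_eq_left pos_le_divide_eq[OF B])
  qed
  then have "ennreal (poisson x t) \<le> ennreal (4 / (pi * x * 4 ^ j)) * indicator {t. \<bar>t\<bar> \<le> 2 ^ j * x} t"
    using j by (simp add: ennreal_leI)
  also have "\<dots> = (\<Sum>j\<in>{j}. ennreal (4 / (pi * x * 4 ^ j)) * indicator {t. \<bar>t\<bar> \<le> 2 ^ j * x} t)"
    by (simp only: sum.insert finite.emptyI empty_iff sum.empty add_0_right not_False_eq_True)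
  also have "\<dots> \<le> (\<Sum>j. ennreal (4 / (pi * x * 4 ^ j)) * indicator {t. \<bar>t\<bar> \<le> 2 ^ j * x} t)"
    by (rule sum_le_suminf) auto
  finally show ?thesis .
qed

text \<open>The dyadic term of index j contributes at most 4/(pi x 4^j) * 2 (2^j x) c = (8/pi) c /
  2^j. Since 8/pi < 3, the sum is at most 6c, whatever x.\<close>

lemma poisson_le_maximal:
  fixes \<psi> :: "real \<Rightarrow> ennreal"
  assumes [measurable]: "\<psi> \<in> borel_measurable borel" and x: "x > 0" and c: "c \<ge> 0"
    and le: "\<And>r. r > 0 \<Longrightarrow> (\<integral>\<^sup>+y. \<psi> y * indicator (cball v r) y \<partial>lborel) \<le> ennreal (2 * r * c)"
  shows "(\<integral>\<^sup>+y. ennreal (poisson x (y - v)) * \<psi> y \<partial>lborel) \<le> ennreal (6 * c)"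
proof -
  have [measurable]: "(\<lambda>y. \<psi> y * indicator (cball v r) y) \<in> borel_measurable borel" for r
    by (intro borel_measurable_times_ennreal assms borel_measurable_indicator) auto
  have "(\<integral>\<^sup>+y. ennreal (poisson x (y - v)) * \<psi> y \<partial>lborel)
      \<le> (\<integral>\<^sup>+y. (\<Sum>j. ennreal (4 / (pi * x * 4 ^ j)) * (\<psi> y * indicator (cball v (2 ^ j * x)) y)) \<partial>lborel)"
  proof (rule nn_integral_mono)
    fix y :: real
    have "ennreal (poisson x (y - v)) * \<psi> y
      \<le> (\<Sum>j. ennreal (4 / (pi * x * 4 ^ j)) * indicator {t. \<bar>t\<bar> \<le> 2 ^ j * x} (y - v)) * \<psi> y"
      by (intro mult_right_mono poisson_le_dyadic x) auto
    also have "\<dots> = (\<Sum>j. ennreal (4 / (pi * x * 4 ^ j)) * indicator {t. \<bar>t\<bar> \<le> 2 ^ j * x} (y - v) * \<psi> y)"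
      by (rule ennreal_suminf_multc[symmetric])
    also have "\<dots> = (\<Sum>j. ennreal (4 / (pi * x * 4 ^ j)) * (\<psi> y * indicator (cball v (2 ^ j * x)) y))"
      by (intro suminf_cong) (auto simp: indicator_def dist_real_def)
    finally show "ennreal (poisson x (y - v)) * \<psi> y
      \<le> (\<Sum>j. ennreal (4 / (pi * x * 4 ^ j)) * (\<psi> y * indicator (cball v (2 ^ j * x)) y))" .
  qed
  also have "\<dots> = (\<Sum>j. \<integral>\<^sup>+y. ennreal (4 / (pi * x * 4 ^ j)) * (\<psi> y * indicator (cball v (2 ^ j * x)) y) \<partial>lborel)"
    by (rule nn_integral_suminf) measurable
  also have "\<dots> = (\<Sum>j. ennreal (4 / (pi * x * 4 ^ j)) * (\<integral>\<^sup>+y. \<psi> y * indicator (cball v (2 ^ j * x)) y \<partial>lborel))"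
    by (intro suminf_cong nn_integral_cmult) measurable
  also have "\<dots> \<le> (\<Sum>j. ennreal (3 * c * (1 / 2) ^ j))"
  proof (intro suminf_le)
    fix j :: nat
    have "ennreal (4 / (pi * x * 4 ^ j)) * (\<integral>\<^sup>+y. \<psi> y * indicator (cball v (2 ^ j * x)) y \<partial>lborel)
       \<le> ennreal (4 / (pi * x * 4 ^ j)) * ennreal (2 * (2 ^ j * x) * c)"
      using x by (intro mult_left_mono le) auto
    also have "\<dots> = ennreal (8 / pi * (2 ^ j / 4 ^ j) * c)"
      using x c by (simp flip: ennreal_mult)
    also have "(2 ^ j / 4 ^ j :: real) = (1 / 2) ^ j" by (simp flip: power_divide)
    also have "ennreal (8 / pi * (1 / 2) ^ j * c) \<le> ennreal (3 * (1 / 2) ^ j * c)"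
      using c pi_gt3 by (intro ennreal_leI mult_right_mono) (auto simp: divide_le_eq)
    also have "3 * (1 / 2) ^ j * c = 3 * c * (1 / 2) ^ j" by simp
    finally show "ennreal (4 / (pi * x * 4 ^ j)) * (\<integral>\<^sup>+y. \<psi> y * indicator (cball v (2 ^ j * x)) y \<partial>lborel)
       \<le> ennreal (3 * c * (1 / 2) ^ j)" .
  qed auto
  also have "\<dots> = ennreal (\<Sum>j. 3 * c * (1 / 2) ^ j)"
    using c by (intro suminf_ennreal2 summable_mult) auto
  also have "(\<Sum>j. 3 * c * (1 / 2) ^ j) = 6 * c"
    by (subst suminf_mult) (auto simp: suminf_geometric)
  finally show ?thesis .
qed

lemma AE_not_small_sets:
  assumes V: "\<And>k::nat. V k \<in> sets M" "\<And>k. emeasure M (V k) \<le> ennreal (e k)" "e \<longlonglongrightarrow> 0"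
  shows "AE x in M. \<exists>k. x \<notin> V k"
proof (rule AE_I)
  show "{x \<in> space M. \<not> (\<exists>k. x \<notin> V k)} \<subseteq> (\<Inter>k. V k)" by auto
  show meas: "(\<Inter>k. V k) \<in> sets M" using V by auto
  have le: "emeasure M (\<Inter>k. V k) \<le> ennreal (e k)" for k
  proof -
    have "emeasure M (\<Inter>k. V k) \<le> emeasure M (V k)" by (intro emeasure_mono V) auto
    also have "\<dots> \<le> ennreal (e k)" by (rule V)
    finally show ?thesis .
  qed
  have "(\<lambda>k. ennreal (e k)) \<longlonglongrightarrow> ennreal 0" using V(3) by (intro tendsto_intros)
  then have "emeasure M (\<Inter>k. V k) \<le> ennreal 0"
    by (rule LIMSEQ_le_const) (use le in auto)
  then show "emeasure M (\<Inter>k. V k) = 0" by simp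
qed

text \<open>f is split into a generalised polynomial, whose transform is continuous up to the axis,
  and a remainder of small norm. Off a set of small measure the maximal inequality bounds the
  remainder at all heights simultaneously.\<close>

theorem lap_boundary_limit:
  assumes tr: "boundary_trace f \<Phi>"
  shows "AE v in lborel. ((\<lambda>x. lap f (Complex x v)) \<longlongrightarrow> \<Phi> v) (at_right 0)"
proof -
  obtain xs where xs: "\<And>n. powsum_ok (xs n)"
    "(\<lambda>n. sqnorm lborel (\<lambda>y. powsum_tr (xs n) (Complex 0 y) - \<Phi> y)) \<longlonglongrightarrow> 0"
    using tr by (auto simp: boundary_trace_def)
  define f' where "f' k u = f u - powsum (xs k) u" for k u
  define \<Phi>' where "\<Phi>' k y = \<Phi> y - powsum_tr (xs k) (Complex 0 y)" for k y
  have tr': "boundary_trace (f' k) (\<Phi>' k)" for k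
    unfolding f'_def[abs_def] \<Phi>'_def[abs_def] by (rule boundary_trace_diff[OF tr xs(1)])
  have L: "\<Phi>' k \<in> Lsq lborel" for k by (rule boundary_trace_Lsq[OF tr'])
  have \<Phi>'_meas [measurable]: "\<Phi>' k \<in> borel_measurable borel" for k using L[of k] by (auto simp: Lsq_def)
  define e where "e k = sqnorm lborel (\<Phi>' k)" for k
  have e0: "e \<longlonglongrightarrow> 0"
    using xs(2) by (simp add: e_def[abs_def] \<Phi>'_def[abs_def] sqnorm_diff_commute[of lborel \<Phi>])
  have e_nn: "(\<integral>\<^sup>+y. ennreal ((cmod (\<Phi>' k y))\<^sup>2) \<partial>lborel) = ennreal (e k)" for k
    unfolding e_def by (rule sqnorm_eq_nn_integral[OF L])
  have key: "AE v in lborel. eventually (\<lambda>x. cmod (lap f (Complex x v) - \<Phi> v) \<le> 3 * d) (at_right 0)"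
    if d: "d > 0" for d :: real
  proof -
    \<comment> \<open>Matches the factor 6 of \<open>poisson_le_maximal\<close>, so that the
      transform of the remainder is at most d in modulus. The final 3d collects this error, the
      error of the polynomial part and the boundary value of the remainder.\<close>
    define c where "c = d\<^sup>2 / 6"
    have c: "c > 0" using d by (simp add: c_def)
    have "\<exists>U\<in>sets lborel. {v. \<exists>r>0. ennreal (2 * r * c) \<le> (\<integral>\<^sup>+y. ennreal ((cmod (\<Phi>' k y))\<^sup>2) * indicator (cball v r) y \<partial>lborel)} \<subseteq> U
       \<and> emeasure lborel U \<le> ennreal (5 / c * e k)" for k
      by (rule maximal_weak_type) (use e_nn c in \<open>auto simp: e_def\<close>)
    then have "\<forall>k. \<exists>U. U \<in> sets lborel \<and>
        {v. \<exists>r>0. ennreal (2 * r * c) \<le> (\<integral>\<^sup>+y. ennreal ((cmod (\<Phi>' k y))\<^sup>2) * indicator (cball v r) y \<partial>lborel)} \<subseteq> U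
       \<and> emeasure lborel U \<le> ennreal (5 / c * e k)"
      by blast
    from choice[OF this] obtain U where U0: "\<And>k. U k \<in> sets lborel \<and>
        {v. \<exists>r>0. ennreal (2 * r * c) \<le> (\<integral>\<^sup>+y. ennreal ((cmod (\<Phi>' k y))\<^sup>2) * indicator (cball v r) y \<partial>lborel)} \<subseteq> U k
       \<and> emeasure lborel (U k) \<le> ennreal (5 / c * e k)"
      by blast
    have U: "\<And>k. U k \<in> sets lborel"
      "\<And>k v r. r > 0 \<Longrightarrow> v \<notin> U k \<Longrightarrow> (\<integral>\<^sup>+y. ennreal ((cmod (\<Phi>' k y))\<^sup>2) * indicator (cball v r) y \<partial>lborel) \<le> ennreal (2 * r * c)"
      "\<And>k. emeasure lborel (U k) \<le> ennreal (5 / c * e k)"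
    proof -
      show "U k \<in> sets lborel" "emeasure lborel (U k) \<le> ennreal (5 / c * e k)" for k using U0 by auto
      fix k v and r :: real assume "r > 0" "v \<notin> U k"
      then have "\<not> ennreal (2 * r * c) \<le> (\<integral>\<^sup>+y. ennreal ((cmod (\<Phi>' k y))\<^sup>2) * indicator (cball v r) y \<partial>lborel)"
        using U0[of k] by blast
      then show "(\<integral>\<^sup>+y. ennreal ((cmod (\<Phi>' k y))\<^sup>2) * indicator (cball v r) y \<partial>lborel) \<le> ennreal (2 * r * c)"
        by simp
    qed
    \<comment> \<open>The second exceptional set, by Chebyshev's inequality: points at which the
      boundary value of the remainder is itself large.\<close>
    define W where "W k = {y \<in> space lborel. ennreal (d\<^sup>2) \<le> ennreal ((cmod (\<Phi>' k y))\<^sup>2)}" for k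
    have W: "W k \<in> sets lborel" for k unfolding W_def by measurable
    have We: "emeasure lborel (W k) \<le> ennreal (1 / d\<^sup>2 * e k)" for k
    proof -
      have "W k = {y \<in> space lborel. 1 \<le> ennreal (1 / d\<^sup>2) * ennreal ((cmod (\<Phi>' k y))\<^sup>2)}"
        unfolding W_def using d
        by (intro Collect_cong conj_cong refl)
          (simp add: divide_simps flip: ennreal_mult ennreal_1 del: ennreal_1)
      also have "emeasure lborel ({y \<in> space lborel. 1 \<le> ennreal (1 / d\<^sup>2) * ennreal ((cmod (\<Phi>' k y))\<^sup>2)})
          \<le> ennreal (1 / d\<^sup>2) * (\<integral>\<^sup>+y. ennreal ((cmod (\<Phi>' k y))\<^sup>2) * indicator UNIV y \<partial>lborel)"
        using nn_integral_Markov_inequality[of "\<lambda>y. ennreal ((cmod (\<Phi>' k y))\<^sup>2)" UNIV lborel "ennreal (1 / d\<^sup>2)"] by simp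
      also have "\<dots> = ennreal (1 / d\<^sup>2 * e k)"
        using e_nn[of k] by (simp add: e_def flip: ennreal_mult)
      finally show ?thesis .
    qed
    \<comment> \<open>One good index k, depending on v, is enough for the fixed tolerance d.\<close>
    have "AE v in lborel. \<exists>k. v \<notin> U k \<union> W k"
    proof (rule AE_not_small_sets)
      show "U k \<union> W k \<in> sets lborel" for k using U W by auto
      show "emeasure lborel (U k \<union> W k) \<le> ennreal ((5 / c + 1 / d\<^sup>2) * e k)" for k
      proof -
        have "emeasure lborel (U k \<union> W k) \<le> emeasure lborel (U k) + emeasure lborel (W k)"
          by (rule emeasure_subadditive[OF U(1) W])
        also have "\<dots> \<le> ennreal (5 / c * e k) + ennreal (1 / d\<^sup>2 * e k)"
          by (intro add_mono U We)
        also have "\<dots> = ennreal ((5 / c + 1 / d\<^sup>2) * e k)"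
          using c by (simp add: e_def distrib_right flip: ennreal_plus)
        finally show ?thesis .
      qed
      show "(\<lambda>k. (5 / c + 1 / d\<^sup>2) * e k) \<longlonglongrightarrow> 0"
        using e0 by (rule tendsto_mult_right_zero)
    qed
    then show ?thesis
    proof eventually_elim
      case (elim v)
      then obtain k where k: "v \<notin> U k" "v \<notin> W k" by blast
      have 1: "cmod (\<Phi>' k v) \<le> d"
        using k(2) d unfolding W_def by (simp add: not_le power2_less_imp_less less_imp_le)
      have 2: "cmod (lap (f' k) (Complex x v)) \<le> d" if x: "x > 0" for x
      proof -
        have "ennreal ((cmod (lap (f' k) (Complex x v)))\<^sup>2)
            \<le> (\<integral>\<^sup>+y. ennreal (poisson x (y - v)) * ennreal ((cmod (\<Phi>' k y))\<^sup>2) \<partial>lborel)"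
          by (rule boundary_trace_poisson_sq[OF tr' x])
        also have "\<dots> \<le> ennreal (6 * c)"
          by (rule poisson_le_maximal) (use U k c x in auto)
        finally have "(cmod (lap (f' k) (Complex x v)))\<^sup>2 \<le> d\<^sup>2" using d by (simp add: c_def)
        then show ?thesis by (rule power2_le_imp_le) (use d in simp)
      qed
      have "((\<lambda>x. powsum_tr (xs k) (Complex x v)) \<longlongrightarrow> powsum_tr (xs k) (Complex 0 v)) (at_right 0)"
      proof -
        have "continuous_on {0..} (\<lambda>x. powsum_tr (xs k) (Complex x v))"
          by (rule continuous_on_compose2[OF holomorphic_on_imp_continuous_on[OF powsum_tr_holomorphic[OF xs(1)]]])
            (auto intro!: continuous_intros)
        from this[unfolded continuous_on_def, rule_format, of 0] show ?thesis
          by (simp add: at_within_Ici_at_right)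
      qed
      then have "eventually (\<lambda>x. dist (powsum_tr (xs k) (Complex x v)) (powsum_tr (xs k) (Complex 0 v)) < d) (at_right 0)"
        using d by (rule tendstoD)
      then show "eventually (\<lambda>x. cmod (lap f (Complex x v) - \<Phi> v) \<le> 3 * d) (at_right 0)"
        using eventually_at_right_less[of 0]
      proof eventually_elim
        case (elim x)
        have "lap (f' k) (Complex x v) = lap f (Complex x v) - powsum_tr (xs k) (Complex x v)"
          unfolding f'_def[abs_def] using elim boundary_trace_Lsq(1)[OF tr] xs(1)
          by (simp add: lap_diff powsum_Lsq lap_powsum)
        then have "lap f (Complex x v) - \<Phi> v = lap (f' k) (Complex x v)
            + ((powsum_tr (xs k) (Complex x v) - powsum_tr (xs k) (Complex 0 v)) + - \<Phi>' k v)"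
          by (simp add: \<Phi>'_def)
        also have "cmod \<dots> \<le> d + (d + d)"
          using 1 2[of x] elim
          by (intro norm_triangle_mono) (auto simp: dist_norm)
        finally show ?case by simp
      qed
    qed
  qed
  have "AE v in lborel. \<forall>n::nat. eventually (\<lambda>x. cmod (lap f (Complex x v) - \<Phi> v) \<le> 3 * inverse (real (Suc n))) (at_right 0)"
    unfolding AE_all_countable by (intro allI key) simp
  then show ?thesis
  proof eventually_elim
    case (elim v)
    show ?case
    proof (rule tendstoI)
      fix e :: real assume "e > 0"
      then obtain n where n: "inverse (real (Suc n)) < e / 3" using reals_Archimedean[of "e/3"] by auto
      from elim[rule_format, of n]
      show "\<forall>\<^sub>F x in at_right 0. dist (lap f (Complex x v)) (\<Phi> v) < e"
        by eventually_elim (use n in \<open>simp add: dist_norm\<close>)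
    qed
  qed
qed

section \<open>The Paley--Wiener theorem and the adjoint\<close>

lemma ip_powsum_right_eq_0:
  assumes f: "f \<in> Lsq unit_interval" and 0: "\<And>w. Re w > 0 \<Longrightarrow> lap f w = 0" and ok: "powsum_ok xs"
  shows "ip unit_interval f (powsum xs) = 0"
  using ok
proof (induction xs)
  case Nil
  then show ?case by (simp add: ip_def)
next
  case (Cons a xs)
  obtain k z where a: "a = (k, z)" by force
  have z: "Re z > -1/2" "powsum_ok xs" using Cons.prems by (auto simp: a)
  have "(\<lambda>u. complex_of_real u powr z) = kern (cnj z + 1/2)" by (auto simp: kern_def)
  then have "ip unit_interval f (\<lambda>u. of_real u powr z) = 0"
    using 0[of "cnj z + 1/2"] z by (simp add: lap_def)
  then have "ip unit_interval f (\<lambda>u. k * of_real u powr z + powsum xs u) = 0"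
    using Cons.IH z f by (simp add: ip_add_right Lsq_scale powr_Lsq powsum_Lsq ip_scale_right)
  moreover have "powsum (a # xs) = (\<lambda>u. k * of_real u powr z + powsum xs u)" by (auto simp: a)
  ultimately show ?case by simp
qed

text \<open>Every admissible power is a reproducing kernel, so f is orthogonal to a dense subspace
  and hence to itself.\<close>

lemma lap_eq_0_imp:
  assumes f: "f \<in> Lsq unit_interval" and 0: "\<And>w. Re w > 0 \<Longrightarrow> lap f w = 0"
  shows "sqnorm unit_interval f = 0"
proof -
  obtain xs where xs: "\<And>n. powsum_ok (xs n)" "(\<lambda>n. sqnorm unit_interval (\<lambda>u. powsum (xs n) u - f u)) \<longlonglongrightarrow> 0"
    using powsum_dense_seq[OF f] by blast
  have "(\<lambda>n. ip unit_interval (powsum (xs n)) f) \<longlonglongrightarrow> ip unit_interval f f"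
    using xs by (intro ip_LIMSEQ powsum_Lsq f) auto
  moreover have "ip unit_interval (powsum (xs n)) f = 0" for n
    using ip_powsum_right_eq_0[OF f 0 xs(1)[of n]] ip_commute[of unit_interval "powsum (xs n)" f] by simp
  ultimately have "ip unit_interval f f = 0" by (simp add: LIMSEQ_const_iff)
  then show ?thesis by (simp add: ip_self)
qed

lemma lap_inj_AE:
  assumes f: "f \<in> Lsq unit_interval" "g \<in> Lsq unit_interval" and eq: "\<And>w. Re w > 0 \<Longrightarrow> lap f w = lap g w"
  shows "AE u in unit_interval. f u = g u"
proof -
  have "sqnorm unit_interval (\<lambda>u. f u - g u) = 0"
    using f eq by (intro lap_eq_0_imp Lsq_diff) (auto simp: lap_diff)
  from sqnorm_eq_0_imp_AE[OF Lsq_diff[OF f] this] show ?thesis by simp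
qed

lemma lap_upowr: "lap (\<lambda>u. of_real (u powr x) * f u) w = lap f (w + of_real x)"
proof -
  have "of_real (u powr x) * f u * cnj (kern w u) = f u * cnj (kern (w + of_real x) u)" if "u \<in> space unit_interval" for u
  proof -
    have "of_real u powr of_real x * of_real u powr (w - 1/2) = (of_real u :: complex) powr (w + of_real x - 1/2)"
      by (subst powr_add[symmetric]) (simp add: algebra_simps)
    moreover have "complex_of_real (u powr x) = of_real u powr of_real x"
      using that by (simp add: powr_of_real)
    ultimately show ?thesis using that by (simp add: cnj_kern mult_ac)
  qed
  then show ?thesis
    unfolding lap_def ip_def by (intro Bochner_Integration.integral_cong) auto
qed

lemma ip_eq_0_if_minimal:
  assumes E: "E \<in> Lsq M" and G: "G \<in> Lsq M" and min: "\<And>c. sqnorm M E \<le> sqnorm M (\<lambda>x. E x - c * G x)"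
  shows "ip M E G = 0"
proof (rule ccontr)
  assume nz: "ip M E G \<noteq> 0"
  \<comment> \<open>Keeps t ||G||^2 below 1, which contradicts the lower bound 2 reached at the end;
    the summand 1 covers ||G|| = 0.\<close>
  define t where "t = 1 / (sqnorm M G + 1)"
  have t: "t > 0" by (simp add: t_def add_nonneg_pos)
  define c where "c = of_real t * ip M E G"
  have "sqnorm M (\<lambda>x. E x - c * G x) = sqnorm M E + (cmod c)\<^sup>2 * sqnorm M G - 2 * Re (cnj c * ip M E G)"
    using E G by (simp add: sqnorm_diff Lsq_scale sqnorm_scale ip_scale_right)
  moreover have "Re (cnj c * ip M E G) = t * (cmod (ip M E G))\<^sup>2"
    unfolding cmod_power2 by (simp add: c_def power2_eq_square algebra_simps)
  moreover have "(cmod c)\<^sup>2 = t\<^sup>2 * (cmod (ip M E G))\<^sup>2"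
    by (simp add: c_def norm_mult power_mult_distrib)
  ultimately have "2 * (t * (cmod (ip M E G))\<^sup>2) \<le> t\<^sup>2 * (cmod (ip M E G))\<^sup>2 * sqnorm M G"
    using min[of c] by simp
  then have "(t * (cmod (ip M E G))\<^sup>2) * 2 \<le> (t * (cmod (ip M E G))\<^sup>2) * (t * sqnorm M G)"
    by (simp add: power2_eq_square mult_ac)
  moreover have "t * (cmod (ip M E G))\<^sup>2 > 0" using t nz by simp
  ultimately have "2 \<le> t * sqnorm M G" by (simp only: mult_le_cancel_left_pos)
  then show False using sqnorm_nonneg[of M G] by (simp add: t_def divide_simps split: if_splits)
qed

text \<open>On a line inside the half-plane F is a square integrable function obeying Cauchy's
  formula. It is projected onto the closed span of rational transforms; as this span contains the
  Cauchy kernels, the residual does not affect Cauchy integrals, and the projection reproduces F.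
  The norm bound does not depend on x, which later allows x to tend to 0.\<close>

lemma paley_wiener_shifted:
  fixes F :: "complex \<Rightarrow> complex"
  assumes F: "H2_bound F K" and x: "x > 0"
  shows "\<exists>f\<in>Lsq unit_interval. sqnorm unit_interval f \<le> K / (2 * pi) \<and> (\<forall>w. Re w > 0 \<longrightarrow> lap f w = F (w + of_real x))"
proof -
  define \<Phi> where "\<Phi> y = F (Complex x y)" for y
  have \<Phi>: "\<Phi> \<in> Lsq lborel" "sqnorm lborel \<Phi> \<le> K"
    using H2_bound_line[OF F x] by (auto simp: \<Phi>_def[abs_def])
  define G where "G xs y = powsum_tr xs (Complex 0 y)" for xs y
  have G: "G xs \<in> Lsq lborel" if "powsum_ok xs" for xs
    unfolding G_def[abs_def] using that by (intro powsum_tr_line_Lsq) auto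
  define A where "A = (\<lambda>xs. sqnorm lborel (\<lambda>y. \<Phi> y - G xs y)) ` {xs. powsum_ok xs}"
  define d where "d = Inf A"
  have A: "A \<noteq> {}" "bdd_below A"
    unfolding A_def by (auto intro!: exI[of _ "[]"] bdd_belowI[of _ 0])
  have dle: "d \<le> sqnorm lborel (\<lambda>y. \<Phi> y - G xs y)" if "powsum_ok xs" for xs
    unfolding d_def using A that by (intro cInf_lower) (auto simp: A_def)
  have "\<exists>xs. powsum_ok xs \<and> sqnorm lborel (\<lambda>y. \<Phi> y - G xs y) < d + 1 / real (Suc n)" for n
    using cInf_lessD[OF A(1), of "d + 1 / real (Suc n)"] by (auto simp: d_def A_def)
  then obtain xs where xs: "\<And>n. powsum_ok (xs n)"
    "\<And>n. sqnorm lborel (\<lambda>y. \<Phi> y - G (xs n) y) < d + 1 / real (Suc n)" by metis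
  have GG: "sqnorm lborel (\<lambda>y. G (xs m) y - G (xs n) y) \<le> 2 / real (Suc m) + 2 / real (Suc n)" for m n
  proof -
    define P where "P y = \<Phi> y - G (xs m) y" for y
    define Q where "Q y = \<Phi> y - G (xs n) y" for y
    have PQ: "P \<in> Lsq lborel" "Q \<in> Lsq lborel"
      unfolding P_def[abs_def] Q_def[abs_def] by (intro Lsq_diff \<Phi> G xs)+
    \<comment> \<open>The midpoint of two near-minimisers is again a competitor; with the
      parallelogram law this forces near-minimisers together.\<close>
    have "powsum_ok (powsum_scale (1/2) (xs m @ xs n))" using xs by simp
    from dle[OF this] have "4 * d \<le> (cmod 2)\<^sup>2 * sqnorm lborel (\<lambda>y. \<Phi> y - G (powsum_scale (1/2) (xs m @ xs n)) y)" by simp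
    also have "\<dots> = sqnorm lborel (\<lambda>y. 2 * (\<Phi> y - G (powsum_scale (1/2) (xs m @ xs n)) y))"
      by (rule sqnorm_scale[symmetric])
    also have "(\<lambda>y. 2 * (\<Phi> y - G (powsum_scale (1/2) (xs m @ xs n)) y)) = (\<lambda>y. P y + Q y)"
      by (auto simp: P_def Q_def G_def algebra_simps)
    finally have "4 * d \<le> sqnorm lborel (\<lambda>y. P y + Q y)" .
    moreover have "sqnorm lborel (\<lambda>y. P y + Q y) + sqnorm lborel (\<lambda>y. P y - Q y) = 2 * sqnorm lborel P + 2 * sqnorm lborel Q"
      using PQ by (simp add: sqnorm_add sqnorm_diff)
    moreover have "sqnorm lborel P < d + 1 / real (Suc m)" "sqnorm lborel Q < d + 1 / real (Suc n)"
      unfolding P_def[abs_def] Q_def[abs_def] by (rule xs(2))+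
    moreover have "sqnorm lborel (\<lambda>y. P y - Q y) = sqnorm lborel (\<lambda>y. G (xs m) y - G (xs n) y)"
      unfolding sqnorm_diff_commute[of lborel P Q] by (simp add: P_def Q_def)
    moreover have "2 / real (Suc m) = 2 * (1 / real (Suc m))" "2 / real (Suc n) = 2 * (1 / real (Suc n))" by simp_all
    ultimately show ?thesis by linarith
  qed
  have "\<exists>f\<in>Lsq unit_interval. (\<lambda>n. sqnorm unit_interval (\<lambda>u. powsum (xs n) u - f u)) \<longlonglongrightarrow> 0"
  proof (rule Lsq_complete)
    show "powsum (xs n) \<in> Lsq unit_interval" for n by (rule powsum_Lsq[OF xs(1)])
    fix e :: real assume e: "e > 0"
    then obtain N where N: "inverse (real (Suc N)) < e / 4" using reals_Archimedean[of "e/4"] by auto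
    have "sqnorm unit_interval (\<lambda>u. powsum (xs m) u - powsum (xs n) u) < e" if mn: "m \<ge> N" "n \<ge> N" for m n
    proof -
      have "sqnorm unit_interval (\<lambda>u. powsum (xs m) u - powsum (xs n) u) \<le> 2 * pi * sqnorm unit_interval (\<lambda>u. powsum (xs m) u - powsum (xs n) u)"
        using mult_right_mono[of 1 "2 * pi" "sqnorm unit_interval (\<lambda>u. powsum (xs m) u - powsum (xs n) u)"] pi_gt3
        by simp
      also have "\<dots> \<le> 2 / real (Suc m) + 2 / real (Suc n)"
        using GG[of m n] powsum_tr_isometry_diff[OF xs(1) xs(1), of m n] by (simp add: G_def)
      also have "\<dots> \<le> 2 / real (Suc N) + 2 / real (Suc N)"
        using mn by (intro add_mono divide_left_mono) auto
        also have "\<dots> < e" using N divide_inverse[of 2 "real (Suc N)"] by linarith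
      finally show ?thesis .
    qed
    then show "\<exists>N. \<forall>m\<ge>N. \<forall>n\<ge>N. sqnorm unit_interval (\<lambda>u. powsum (xs m) u - powsum (xs n) u) < e" by blast
  qed
  then obtain f where f: "f \<in> Lsq unit_interval" "(\<lambda>n. sqnorm unit_interval (\<lambda>u. powsum (xs n) u - f u)) \<longlonglongrightarrow> 0" by blast
  obtain \<Psi> where \<Psi>: "boundary_trace f \<Psi>" "(\<lambda>n. sqnorm lborel (\<lambda>y. powsum_tr (xs n) (Complex 0 y) - \<Psi> y)) \<longlonglongrightarrow> 0"
    using boundary_trace_exists_seq[OF f(1) xs(1) f(2)] by blast
  have \<Psi>L: "\<Psi> \<in> Lsq lborel" by (rule boundary_trace_Lsq[OF \<Psi>(1)])
  have G\<Psi>: "(\<lambda>n. sqnorm lborel (\<lambda>y. G (xs n) y - \<Psi> y)) \<longlonglongrightarrow> 0" using \<Psi>(2) by (simp add: G_def)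
  define E where "E y = \<Phi> y - \<Psi> y" for y
  have E: "E \<in> Lsq lborel" unfolding E_def[abs_def] by (intro Lsq_diff \<Phi> \<Psi>L)
  have lim: "(\<lambda>n. sqnorm lborel (\<lambda>y. \<Phi> y - G (xs n) y - c * G ys y)) \<longlonglongrightarrow> sqnorm lborel (\<lambda>y. E y - c * G ys y)"
    if "powsum_ok ys" for c ys
  proof (rule sqnorm_LIMSEQ)
    have "sqnorm lborel (\<lambda>y. (\<Phi> y - G (xs n) y - c * G ys y) - (E y - c * G ys y)) = sqnorm lborel (\<lambda>y. G (xs n) y - \<Psi> y)" for n
      unfolding sqnorm_diff_commute[of lborel "G (xs n)" \<Psi>] by (simp add: E_def)
    then show "(\<lambda>n. sqnorm lborel (\<lambda>y. (\<Phi> y - G (xs n) y - c * G ys y) - (E y - c * G ys y))) \<longlonglongrightarrow> 0"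
      using G\<Psi> by simp
  qed (use that in \<open>auto intro!: Lsq_diff Lsq_scale \<Phi> G xs E\<close>)
  have Ed: "sqnorm lborel E \<le> d"
  proof (rule LIMSEQ_le)
    show "(\<lambda>n. sqnorm lborel (\<lambda>y. \<Phi> y - G (xs n) y)) \<longlonglongrightarrow> sqnorm lborel E"
      using lim[of "[]" 0] by simp
    have "(\<lambda>n. d + inverse (real (Suc n))) \<longlonglongrightarrow> d + 0"
      by (intro tendsto_intros LIMSEQ_inverse_real_of_nat)
    then show "(\<lambda>n. d + 1 / real (Suc n)) \<longlonglongrightarrow> d" by (simp add: divide_inverse)
    show "\<exists>N. \<forall>n\<ge>N. sqnorm lborel (\<lambda>y. \<Phi> y - G (xs n) y) \<le> d + 1 / real (Suc n)"
      using xs(2) by (auto intro: less_imp_le)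
  qed
  \<comment> \<open>Adding c times \<open>ys\<close> to the approximants gives competitors, so in
    the limit \<open>E\<close> has minimal norm along every direction \<open>G ys\<close>.\<close>
  have orth: "ip lborel E (G ys) = 0" if ys: "powsum_ok ys" for ys
  proof (rule ip_eq_0_if_minimal[OF E G[OF ys]])
    fix c
    have "d \<le> sqnorm lborel (\<lambda>y. \<Phi> y - G (xs n) y - c * G ys y)" for n
      using dle[of "xs n @ powsum_scale c ys"] xs ys by (simp add: G_def diff_diff_eq)
    then have "d \<le> sqnorm lborel (\<lambda>y. E y - c * G ys y)"
      by (intro LIMSEQ_le_const[OF lim[OF ys]]) auto
    with Ed show "sqnorm lborel E \<le> sqnorm lborel (\<lambda>y. E y - c * G ys y)" by linarith
  qed
  have "lap f w = F (w + of_real x)" if w: "Re w > 0" for w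
  proof -
    define ys where "ys = [(1 :: complex, cnj w - 1/2)]"
    have ys: "powsum_ok ys" using w by (simp add: ys_def)
    have Gys: "cnj (G ys y) = 1 / (w - Complex 0 y)" for y
    proof -
      have "cnj (Complex 0 y + (cnj w - 1/2) + 1/2) = w - Complex 0 y" by (simp add: complex_eq_iff)
      then show ?thesis by (simp add: G_def ys_def)
    qed
    have ipG: "ip lborel X (G ys) = (\<integral>y. X y / (w - Complex 0 y) \<partial>lborel)" for X
      by (simp add: ip_def Gys)
    have "0 = ip lborel E (G ys)" using orth[OF ys] by simp
    also have "\<dots> = ip lborel \<Phi> (G ys) - ip lborel \<Psi> (G ys)"
      unfolding E_def[abs_def] by (intro ip_diff_left \<Phi> \<Psi>L G ys)
    finally have "ip lborel \<Psi> (G ys) = ip lborel \<Phi> (G ys)" by simp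
    moreover have "ip lborel \<Psi> (G ys) = 2 * pi * lap f w"
      using boundary_trace_Cauchy[OF \<Psi>(1), of w] w by (simp add: ipG)
    moreover have "ip lborel \<Phi> (G ys) = 2 * pi * F (w + of_real x)"
    proof -
      have e: "w + of_real x - Complex x y = w - Complex 0 y" for y by (simp add: complex_eq_iff)
      have "Re (w + of_real x) \<noteq> x" using w by simp
      from H2_Cauchy[OF F x this] show ?thesis
        using w unfolding e by (simp add: ipG \<Phi>_def)
    qed
    ultimately show ?thesis by simp
  qed
  \<comment> \<open>The projection is orthogonal to the residual, so Pythagoras bounds it by the
    norm of F on the line.\<close>
  moreover have "sqnorm unit_interval f \<le> K / (2 * pi)"
  proof -
    have "(\<lambda>n. ip lborel (G (xs n)) E) \<longlonglongrightarrow> ip lborel \<Psi> E"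
      by (intro ip_LIMSEQ G xs \<Psi>L E G\<Psi>)
    moreover have "ip lborel (G (xs n)) E = 0" for n
      using orth[OF xs(1)[of n]] ip_commute[of lborel "G (xs n)" E] by simp
    ultimately have "ip lborel \<Psi> E = 0" by (simp add: LIMSEQ_const_iff)
    then have "sqnorm lborel (\<lambda>y. \<Psi> y + E y) = sqnorm lborel \<Psi> + sqnorm lborel E"
      using sqnorm_add[OF \<Psi>L E] by simp
    moreover have "(\<lambda>y. \<Psi> y + E y) = \<Phi>" by (auto simp: E_def)
    ultimately have "sqnorm lborel \<Phi> = sqnorm lborel \<Psi> + sqnorm lborel E" by simp
    then have "2 * pi * sqnorm unit_interval f \<le> K"
      using \<Phi>(2) sqnorm_nonneg[of lborel E] boundary_trace_sqnorm[OF \<Psi>(1)] by linarith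
    then show ?thesis by (simp add: field_simps)
  qed
  ultimately show ?thesis using f(1) by blast
qed

text \<open>By injectivity the functions found on the different lines are u^x f for one and the same
  f. Their norms are bounded independently of x, so Fatou's lemma puts f itself into
  L^2(0,1).\<close>

theorem paley_wiener:
  assumes "F \<in> H2"
  shows "\<exists>f\<in>Lsq unit_interval. \<forall>s\<in>RHP. lap f s = F s"
proof -
  obtain K where K: "H2_bound F K" using assms by (auto simp: H2_iff_bound)
  then have K0: "K \<ge> 0" by (simp add: H2_bound_def)
  have "\<forall>x\<in>{0<..}. \<exists>f. f \<in> Lsq unit_interval \<and> sqnorm unit_interval f \<le> K / (2 * pi) \<and>
      (\<forall>w. Re w > 0 \<longrightarrow> lap f w = F (w + of_real x))"
    using paley_wiener_shifted[OF K] by auto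
  from bchoice[OF this] obtain g where g: "\<And>x. x > 0 \<Longrightarrow> g x \<in> Lsq unit_interval"
    "\<And>x. x > 0 \<Longrightarrow> sqnorm unit_interval (g x) \<le> K / (2 * pi)"
    "\<And>x w. x > 0 \<Longrightarrow> Re w > 0 \<Longrightarrow> lap (g x) w = F (w + of_real x)" by auto
  \<comment> \<open>Division by u undoes the shift by 1; whether the quotient is square integrable
    is the point still to be settled.\<close>
  define f where "f u = g 1 u / of_real u" for u
  have [measurable]: "g 1 \<in> borel_measurable unit_interval" using g(1)[of 1] by (simp add: Lsq_def)
  have ofr [measurable]: "(\<lambda>u. complex_of_real u) \<in> borel_measurable unit_interval"
    by (intro borel_measurable_unit_interval) measurable
  have f_meas [measurable]: "f \<in> borel_measurable unit_interval"
    unfolding f_def[abs_def] by measurable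
  have upow_meas: "(\<lambda>u. of_real (u powr x) * f u) \<in> borel_measurable unit_interval" for x
  proof -
    have "(\<lambda>u. complex_of_real (u powr x)) \<in> borel_measurable unit_interval"
      by (intro borel_measurable_unit_interval) measurable
    then show ?thesis by measurable
  qed
  \<comment> \<open>x < 1 keeps the exponent 1 - x nonnegative, so that multiplying by u^(1 - x)
    stays within L^2.\<close>
  have ae: "AE u in unit_interval. g x u = of_real (u powr x) * f u" if x: "0 < x" "x < 1" for x
  proof -
    have L: "(\<lambda>u. of_real (u powr (1 - x)) * g x u) \<in> Lsq unit_interval"
      using x g by (intro upowr_Lsq) auto
    have "AE u in unit_interval. of_real (u powr (1 - x)) * g x u = g 1 u"
    proof (rule lap_inj_AE[OF L])
      show "lap (\<lambda>u. of_real (u powr (1 - x)) * g x u) w = lap (g 1) w" if "Re w > 0" for w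
        unfolding lap_upowr using that x g(3)[of x "w + of_real (1 - x)"] g(3)[of 1 w] by simp
    qed (use g in simp)
    then show ?thesis
      using AE_space
    proof eventually_elim
      case (elim u)
      then have u: "u > 0" by simp
      have "of_real (u powr x) * f u = of_real (u powr x * u powr (1 - x) / u) * g x u"
        using elim u by (simp add: f_def flip: elim(1))
      also have "u powr x * u powr (1 - x) / u = 1" using u by (simp flip: powr_add)
      finally show ?case by simp
    qed
  qed
  \<comment> \<open>The double successor keeps X n strictly below 1, the range covered by
    \<open>ae\<close>.\<close>
  define X where "X n = inverse (real (Suc (Suc n)))" for n
  have X: "0 < X n" "X n < 1" for n by (auto simp: X_def inverse_less_1_iff)
  have Xlim: "X \<longlonglongrightarrow> 0"
    unfolding X_def[abs_def] using LIMSEQ_Suc[OF LIMSEQ_inverse_real_of_nat] by simp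
  have fX: "(\<lambda>u. of_real (u powr X n) * f u) \<in> Lsq unit_interval"
    "sqnorm unit_interval (\<lambda>u. of_real (u powr X n) * f u) \<le> K / (2 * pi)" for n
  proof -
    show L: "(\<lambda>u. of_real (u powr X n) * f u) \<in> Lsq unit_interval"
      using g(1)[OF X(1)[of n]] upow_meas ae[OF X] by (rule Lsq_cong_AE)
    show "sqnorm unit_interval (\<lambda>u. of_real (u powr X n) * f u) \<le> K / (2 * pi)"
      using sqnorm_cong_AE[OF Lsq_measurable[OF g(1)[OF X(1)[of n]]] upow_meas ae[OF X]] g(2)[OF X(1)[of n]] by simp
  qed
  have fL: "f \<in> Lsq unit_interval"
  proof (rule sqnorm_Fatou(1)[OF fX(1) f_meas])
    show "AE u in unit_interval. (\<lambda>n. of_real (u powr X n) * f u) \<longlonglongrightarrow> f u"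
    proof (rule AE_I2)
      fix u assume "u \<in> space unit_interval"
      then have "(\<lambda>n. u powr X n) \<longlonglongrightarrow> u powr 0"
        by (intro tendsto_powr Xlim tendsto_const) auto
      from tendsto_mult[OF tendsto_of_real[OF this] tendsto_const]
      have "(\<lambda>n. of_real (u powr X n) * f u) \<longlonglongrightarrow> of_real (u powr 0) * f u" .
      then show "(\<lambda>n. of_real (u powr X n) * f u) \<longlonglongrightarrow> f u"
        using \<open>u \<in> space unit_interval\<close> by simp
    qed
    show "\<forall>\<^sub>F n in sequentially. sqnorm unit_interval (\<lambda>u. of_real (u powr X n) * f u) \<le> K / (2 * pi)"
      using fX by simp
  qed (use K0 in simp)
  have "lap f s = F s" if s: "s \<in> RHP" for s
  proof -
    \<comment> \<open>Below 1 for \<open>ae\<close>, and below Re s so that s - x is still in the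
      half-plane.\<close>
    define x where "x = min (1/2) (Re s / 2)"
    have x: "0 < x" "x < 1" "Re (s - of_real x) > 0" using s by (auto simp: x_def)
    have "lap f s = lap (\<lambda>u. of_real (u powr x) * f u) (s - of_real x)"
      unfolding lap_upowr by simp
    also have "\<dots> = lap (g x) (s - of_real x)"
      unfolding lap_def
    proof (rule ip_cong_AE)
      show "AE u in unit_interval. of_real (u powr x) * f u = g x u"
        using ae[OF x(1,2)] by eventually_elim simp
    qed (use x g fL in \<open>auto intro!: upowr_Lsq kern_Lsq\<close>)
    also have "\<dots> = F s" using g(3)[OF x(1) x(3)] by simp
    finally show ?thesis .
  qed
  then show ?thesis using fL by blast
qed

section \<open>Inner products on the Hardy space and the adjoint\<close>

lemma Re_lap_line_ip:
  assumes f: "f \<in> Lsq unit_interval" "g \<in> Lsq unit_interval" and x: "x > 0"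
  shows "Re (ip lborel (\<lambda>y. lap f (Complex x y)) (\<lambda>y. lap g (Complex x y)))
    = 2 * pi * Re (ip unit_interval (\<lambda>u. of_real (u powr x) * f u) (\<lambda>u. of_real (u powr x) * g u))"
proof -
  have U: "(\<lambda>u. of_real (u powr x) * f u) \<in> Lsq unit_interval" "(\<lambda>u. of_real (u powr x) * g u) \<in> Lsq unit_interval"
    using f x by (auto intro!: upowr_Lsq)
  have "sqnorm lborel (\<lambda>y. lap f (Complex x y) + lap g (Complex x y))
      = 2 * pi * sqnorm unit_interval (\<lambda>u. of_real (u powr x) * f u + of_real (u powr x) * g u)"
    using lap_line(2)[OF Lsq_add[OF f] x] f x by (simp add: lap_add distrib_left)
  then show ?thesis
    unfolding sqnorm_add[OF lap_line(1)[OF f(1) x] lap_line(1)[OF f(2) x]] sqnorm_add[OF U]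
    by (simp add: lap_line(2)[OF f(1) x] lap_line(2)[OF f(2) x] algebra_simps)
qed

text \<open>Polarisation: \<open>Re_lap_line_ip\<close> comes from the norm identity for f + g, and
  replacing g by \<i> g in it supplies the imaginary part.\<close>

lemma lap_line_ip:
  assumes f: "f \<in> Lsq unit_interval" "g \<in> Lsq unit_interval" and x: "x > 0"
  shows "ip lborel (\<lambda>y. lap f (Complex x y)) (\<lambda>y. lap g (Complex x y))
    = 2 * pi * ip unit_interval (\<lambda>u. of_real (u powr x) * f u) (\<lambda>u. of_real (u powr x) * g u)"
proof -
  have "(\<lambda>u. of_real (u powr x) * (\<i> * g u)) = (\<lambda>u. \<i> * (of_real (u powr x) * g u))" by auto
  then have "Re (cnj \<i> * ip lborel (\<lambda>y. lap f (Complex x y)) (\<lambda>y. lap g (Complex x y)))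
    = 2 * pi * Re (cnj \<i> * ip unit_interval (\<lambda>u. of_real (u powr x) * f u) (\<lambda>u. of_real (u powr x) * g u))"
    using Re_lap_line_ip[OF f(1) Lsq_scale[OF f(2), of \<i>] x]
    by (simp only: lap_scale ip_scale_right)
  with Re_lap_line_ip[OF f x] show ?thesis by (simp add: complex_eq_iff)
qed

text \<open>At distance x from the axis the integral is the inner product weighted by u^x in both
  arguments; dominated convergence shows that the limit defining \<open>H2_inner\<close> exists.
  Agreement on the half-plane is all that is asked of F and G, whose other values are
  arbitrary.\<close>

lemma H2_inner_lap:
  assumes f: "f \<in> Lsq unit_interval" "g \<in> Lsq unit_interval"
    and F: "\<And>s. s \<in> RHP \<Longrightarrow> F s = lap f s" and G: "\<And>s. s \<in> RHP \<Longrightarrow> G s = lap g s"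
  shows "H2_inner F G = ip unit_interval f g"
proof -
  define I where "I x = ip unit_interval (\<lambda>u. of_real (u powr x) * f u) (\<lambda>u. of_real (u powr x) * g u)" for x
  have [measurable]: "f \<in> borel_measurable unit_interval" "g \<in> borel_measurable unit_interval"
    using f by (auto simp: Lsq_def)
  have I: "(I \<longlongrightarrow> ip unit_interval f g) (at_right 0)"
  proof (rule tendsto_at_right_sequentially[of 0 1])
    fix S :: "nat \<Rightarrow> real" assume S: "\<And>n. 0 < S n" "S \<longlonglongrightarrow> 0"
    show "(\<lambda>n. I (S n)) \<longlonglongrightarrow> ip unit_interval f g"
      unfolding I_def ip_def
    proof (rule integral_dominated_convergence[where w = "\<lambda>u. norm (f u * cnj (g u))"])
      have pm: "(\<lambda>u. complex_of_real (u powr S n)) \<in> borel_measurable unit_interval" for n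
        by (intro borel_measurable_unit_interval) measurable
      show "(\<lambda>u. of_real (u powr S n) * f u * cnj (of_real (u powr S n) * g u)) \<in> borel_measurable unit_interval" for n
        using pm[of n] by measurable
      show "AE u in unit_interval. (\<lambda>n. of_real (u powr S n) * f u * cnj (of_real (u powr S n) * g u)) \<longlonglongrightarrow> f u * cnj (g u)"
      proof (rule AE_I2)
        fix u assume u: "u \<in> space unit_interval"
        then have "(\<lambda>n. u powr S n) \<longlonglongrightarrow> u powr 0"
          by (intro tendsto_powr S tendsto_const) auto
        note l = tendsto_mult[OF tendsto_of_real[OF this] tendsto_const]
        from tendsto_mult[OF l tendsto_cnj[OF l]]
        have "(\<lambda>n. of_real (u powr S n) * f u * cnj (of_real (u powr S n) * g u))
            \<longlonglongrightarrow> of_real (u powr 0) * f u * cnj (of_real (u powr 0) * g u)" .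
        then show "(\<lambda>n. of_real (u powr S n) * f u * cnj (of_real (u powr S n) * g u)) \<longlonglongrightarrow> f u * cnj (g u)"
          using u by simp
      qed
      show "AE u in unit_interval. norm (of_real (u powr S n) * f u * cnj (of_real (u powr S n) * g u)) \<le> norm (f u * cnj (g u))" for n
      proof (rule AE_I2)
        fix u assume u: "u \<in> space unit_interval"
        then have p: "u powr S n \<le> 1" "0 \<le> u powr S n" using S(1)[of n] by (auto intro: powr_le_one_if_nonneg less_imp_le)
        have "norm (of_real (u powr S n) * f u * cnj (of_real (u powr S n) * g u))
            = (u powr S n * u powr S n) * norm (f u * cnj (g u))"
          using p by (simp add: norm_mult)
        also have "\<dots> \<le> 1 * norm (f u * cnj (g u))"
          using p by (intro mult_right_mono mult_le_one) auto
        finally show "norm (of_real (u powr S n) * f u * cnj (of_real (u powr S n) * g u)) \<le> norm (f u * cnj (g u))" by simp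
      qed
    qed (use ip_integrable[OF f] in auto)
  qed simp
  have "eventually (\<lambda>x. I x = of_real (1 / (2 * pi)) * (\<integral>y. F (Complex x y) * cnj (G (Complex x y)) \<partial>lborel)) (at_right 0)"
    using eventually_at_right_less[of 0]
  proof eventually_elim
    case (elim x)
    have "(\<integral>y. F (Complex x y) * cnj (G (Complex x y)) \<partial>lborel) = 2 * pi * I x"
      using lap_line_ip[OF f elim] elim by (simp add: ip_def F G I_def)
    then show ?case by simp
  qed
  from Lim_transform_eventually[OF I this] show ?thesis
    unfolding H2_inner_def by (intro tendsto_Lim) auto
qed

lemma lap_H2: "f \<in> Lsq unit_interval \<Longrightarrow> lap f \<in> H2"
  using lap_H2_bound by (auto simp: H2_iff_bound)

lemma bounded_operator_Lsq: "bounded_operator_L2 T \<Longrightarrow> f \<in> Lsq unit_interval \<Longrightarrow> T f \<in> Lsq unit_interval"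
  by (auto simp: bounded_operator_L2_def L2_eq_Lsq)

lemma bounded_operator_bound:
  assumes "bounded_operator_L2 T"
  obtains K where "K \<ge> 0" "\<And>f. f \<in> Lsq unit_interval \<Longrightarrow> sqrt (sqnorm unit_interval (T f)) \<le> K * sqrt (sqnorm unit_interval f)"
proof -
  have "\<exists>K. \<forall>f\<in>L2. L2_norm (T f) \<le> K * L2_norm f"
    using assms by (simp add: bounded_operator_L2_def)
  then obtain K where K: "\<And>f. f \<in> Lsq unit_interval \<Longrightarrow> sqrt (sqnorm unit_interval (T f)) \<le> K * sqrt (sqnorm unit_interval f)"
    unfolding L2_eq_Lsq L2_norm_eq_sqnorm by blast
  show thesis
  proof
    fix f assume "f \<in> Lsq unit_interval"
    from K[OF this] show "sqrt (sqnorm unit_interval (T f)) \<le> max K 0 * sqrt (sqnorm unit_interval f)"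
      by (rule order_trans) (intro mult_right_mono, auto)
  qed simp
qed

lemma bounded_operator_diff_AE:
  assumes T: "bounded_operator_L2 T" and f: "f \<in> Lsq unit_interval" "g \<in> Lsq unit_interval"
  shows "AE u in unit_interval. T (\<lambda>x. f x - g x) u = T f u - T g u"
proof -
  have g': "(\<lambda>x. -1 * g x) \<in> Lsq unit_interval" using f by (intro Lsq_scale)
  have "\<forall>f\<in>Lsq unit_interval. \<forall>g\<in>Lsq unit_interval. AE x in unit_interval. T (\<lambda>u. f u + g u) x = T f x + T g x"
    and scale: "\<forall>k. \<forall>f\<in>Lsq unit_interval. AE x in unit_interval. T (\<lambda>u. k * f u) x = k * T f x"
    using T by (auto simp: bounded_operator_L2_def L2_eq_Lsq)
  from bspec[OF bspec[OF this(1) f(1)] g']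
  have "AE u in unit_interval. T (\<lambda>x. f x + -1 * g x) u = T f u + T (\<lambda>x. -1 * g x) u" .
  moreover from bspec[OF spec[OF scale, of "-1"] f(2)]
  have "AE u in unit_interval. T (\<lambda>x. -1 * g x) u = -1 * T g u" .
  ultimately show ?thesis by eventually_elim simp
qed

lemma bounded_operator_cong_AE:
  assumes T: "bounded_operator_L2 T" and f: "f \<in> Lsq unit_interval" "g \<in> Lsq unit_interval"
    and eq: "AE u in unit_interval. f u = g u"
  shows "AE u in unit_interval. T f u = T g u"
proof -
  obtain K where K: "\<And>f. f \<in> Lsq unit_interval \<Longrightarrow> sqrt (sqnorm unit_interval (T f)) \<le> K * sqrt (sqnorm unit_interval f)"
    using bounded_operator_bound[OF T] by metis
  define d where "d x = f x - g x" for x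
  have d: "d \<in> Lsq unit_interval" unfolding d_def[abs_def] by (intro Lsq_diff f)
  have "sqnorm unit_interval d = sqnorm unit_interval (\<lambda>x. 0)"
    by (rule sqnorm_cong_AE) (use d eq in \<open>auto simp: d_def Lsq_def\<close>)
  then have "sqnorm unit_interval (T d) = 0"
    using K[OF d] sqnorm_nonneg[of unit_interval "T d"] by simp
  from sqnorm_eq_0_imp_AE[OF bounded_operator_Lsq[OF T d] this] bounded_operator_diff_AE[OF T f]
  show ?thesis unfolding d_def[abs_def] by eventually_elim simp
qed

text \<open>The preimage chosen by \<open>SOME\<close> differs from f on a null set only, by
  injectivity of the transform, and a bounded operator respects this.\<close>

lemma hardy_transfer_lap:
  assumes T: "bounded_operator_L2 T" and f: "f \<in> Lsq unit_interval" and s: "s \<in> RHP"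
  shows "hardy_transfer T (lap f) s = lap (T f) s"
proof -
  define f' where "f' = (SOME f'. f' \<in> L2 \<and> (\<forall>s\<in>RHP. laplace_L2 f' s = lap f s))"
  have "\<exists>f'. f' \<in> L2 \<and> (\<forall>s\<in>RHP. laplace_L2 f' s = lap f s)"
    using f by (intro exI[of _ f]) (simp add: L2_eq_Lsq laplace_L2_eq_lap)
  then have "f' \<in> L2 \<and> (\<forall>s\<in>RHP. laplace_L2 f' s = lap f s)"
    unfolding f'_def by (rule someI_ex)
  then have f': "f' \<in> Lsq unit_interval" "\<And>s. s \<in> RHP \<Longrightarrow> lap f' s = lap f s"
    by (auto simp: L2_eq_Lsq laplace_L2_eq_lap)
  then have "AE u in unit_interval. f' u = f u"
    using f by (intro lap_inj_AE) auto
  from bounded_operator_cong_AE[OF T f'(1) f this] have ae: "AE u in unit_interval. T f' u = T f u" .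
  have "hardy_transfer T (lap f) s = laplace_L2 (T f') s"
    by (simp add: hardy_transfer_def f'_def)
  also have "\<dots> = lap (T f') s"
    using s bounded_operator_Lsq[OF T f'(1)] by (simp add: laplace_L2_eq_lap)
  also have "\<dots> = lap (T f) s"
    unfolding lap_def using s f f' ae by (intro ip_cong_AE bounded_operator_Lsq[OF T] kern_Lsq) auto
  finally show ?thesis .
qed

text \<open>Pulls the adjoint relation back to (0,1), where compactness is defined; Paley--Wiener
  supplies the preimage of the weighted composition.\<close>

lemma adjoint_pair:
  assumes T: "bounded_operator_L2 T" and adj: "H2_adjoint (hardy_transfer T) B" and g: "g \<in> Lsq unit_interval"
  shows "\<exists>k\<in>Lsq unit_interval. (\<forall>s\<in>RHP. lap k s = B (lap g) s) \<and>
    (\<forall>f\<in>Lsq unit_interval. ip unit_interval (T f) g = ip unit_interval f k)"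
proof -
  have B: "B (lap g) \<in> H2"
    "\<And>F. F \<in> H2 \<Longrightarrow> H2_inner (hardy_transfer T F) (lap g) = H2_inner F (B (lap g))"
    using adj lap_H2[OF g] by (auto simp: H2_adjoint_def)
  obtain k where k: "k \<in> Lsq unit_interval" "\<forall>s\<in>RHP. lap k s = B (lap g) s"
    using paley_wiener[OF B(1)] by blast
  have "ip unit_interval (T f) g = ip unit_interval f k" if f: "f \<in> Lsq unit_interval" for f
  proof -
    have "ip unit_interval (T f) g = H2_inner (hardy_transfer T (lap f)) (lap g)"
      using bounded_operator_Lsq[OF T f] g hardy_transfer_lap[OF T f] by (intro H2_inner_lap[symmetric]) auto
    also have "\<dots> = H2_inner (lap f) (B (lap g))" by (intro B lap_H2 f)
    also have "\<dots> = ip unit_interval f k" using f k by (intro H2_inner_lap) auto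
    finally show ?thesis .
  qed
  with k show ?thesis by blast
qed

section \<open>Carleson embedding and weak convergence of kernels\<close>

lemma affine_symbol_Complex:
  "affine_symbol a b (Complex x y) = Complex (a * x + (b + (1 - a) / 2)) (a * y)"
  by (simp add: affine_symbol_def complex_eq_iff field_simps)

lemma Re_affine_symbol: "Re (affine_symbol a b s) = a * Re s + (b + (1 - a) / 2)"
  by (simp add: affine_symbol_def field_simps)

lemma H2_cong:
  assumes "F \<in> H2" "\<And>s. s \<in> RHP \<Longrightarrow> F s = G s"
  shows "G \<in> H2"
proof -
  obtain K where K: "H2_bound F K" using assms(1) by (auto simp: H2_iff_bound)
  have "G holomorphic_on RHP"
    using K assms(2) by (intro holomorphic_transform[of F RHP G]) (auto simp: H2_bound_def)
  moreover have "(\<integral>\<^sup>+y. ennreal ((cmod (G (Complex x y)))\<^sup>2) \<partial>lborel) = (\<integral>\<^sup>+y. ennreal ((cmod (F (Complex x y)))\<^sup>2) \<partial>lborel)"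
    if "x > 0" for x using that by (intro nn_integral_cong) (simp add: assms(2))
  ultimately have "H2_bound G K" using K by (simp add: H2_bound_def)
  then show ?thesis by (auto simp: H2_iff_bound)
qed

text \<open>A test function whose transform 1/(s + 1) has no zero in the half-plane, so that the
  weight h can be recovered by division.\<close>

definition cauchy_exp :: "real \<Rightarrow> complex" where
  "cauchy_exp = powsum [(1, 1/2)]"

lemma cauchy_exp_Lsq: "cauchy_exp \<in> Lsq unit_interval"
  unfolding cauchy_exp_def by (rule powsum_Lsq) simp

lemma lap_cauchy_exp: "Re s > 0 \<Longrightarrow> lap cauchy_exp s = 1 / (s + 1)"
  unfolding cauchy_exp_def by (simp add: lap_powsum add.assoc)

text \<open>The representative of 1/(s + 1) that is 0 off the half-plane makes h times the
  composition vanish on the strip 0 < Re s < c, which the symbol maps out of the half-plane. The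
  product is holomorphic, hence 0 everywhere; to the right of c its second factor has no zero, so h
  vanishes there and, by the identity theorem, throughout.\<close>

lemma weight_eq_0_if_symbol_escapes:
  assumes adj: "H2_adjoint A (weighted_composition h (affine_symbol a b))"
    and h: "h holomorphic_on RHP" and a: "a > 0" and neg: "b + (1 - a) / 2 < 0" and s: "s \<in> RHP"
  shows "h s = 0"
proof -
  \<comment> \<open>The real part at which the symbol crosses the imaginary axis.\<close>
  define c where "c = - (b + (1 - a) / 2) / a"
  have "- (b + (1 - a) / 2) > 0" using neg by linarith
  then have c: "c > 0" unfolding c_def using a by (rule divide_pos_pos)
  have Re: "Re (affine_symbol a b s) > 0 \<longleftrightarrow> Re s > c" "Re (affine_symbol a b s) = a * (Re s - c)" for s
    using a by (auto simp: Re_affine_symbol c_def field_simps)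
  define G where "G s = (if Re s > 0 then lap cauchy_exp s else 0)" for s
  have "G \<in> H2"
    by (rule H2_cong[OF lap_H2[OF cauchy_exp_Lsq]]) (simp add: G_def)
  then have "weighted_composition h (affine_symbol a b) G \<in> H2"
    using adj by (simp add: H2_adjoint_def)
  then have hol: "(\<lambda>s. h s * G (affine_symbol a b s)) holomorphic_on RHP"
    by (simp add: H2_def weighted_composition_def)
  have conn: "connected RHP" by (intro convex_connected convex_halfspace_Re_gt)
  have zero: "h s * G (affine_symbol a b s) = 0" if "s \<in> RHP" for s
  proof (rule analytic_continuation_open[of "{s. 0 < Re s} \<inter> {s. Re s < c}" RHP
        "\<lambda>s. h s * G (affine_symbol a b s)" "\<lambda>_. 0"])
    show "open ({s. 0 < Re s} \<inter> {s. Re s < c})"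
      by (intro open_Int open_halfspace_Re_gt open_halfspace_Re_lt)
    show "{s. 0 < Re s} \<inter> {s. Re s < c} \<noteq> {}"
    proof -
      have "of_real (c / 2) \<in> {s. 0 < Re s} \<inter> {s. Re s < c}" using c by simp
      then show ?thesis by blast
    qed
    show "h z * G (affine_symbol a b z) = 0" if "z \<in> {s. 0 < Re s} \<inter> {s. Re s < c}" for z
      using that Re(1)[of z] by (auto simp: G_def)
  qed (use hol conn that in \<open>auto simp: open_halfspace_Re_gt\<close>)
  have "of_real (c + 1) \<in> {s. c < Re s}" by simp
  then have ne: "{s. c < Re s} \<noteq> {}" by blast
  show ?thesis
  proof (rule analytic_continuation_open[of "{s. c < Re s}" RHP h "\<lambda>_. 0"])
    show "{s. c < Re s} \<noteq> {}" by (rule ne)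
    show "h z = 0" if "z \<in> {s. c < Re s}" for z
    proof -
      have z: "Re z > 0" "Re (affine_symbol a b z) > 0" using that c Re(1)[of z] by auto
      then have "affine_symbol a b z + 1 \<noteq> 0" by (auto simp: complex_eq_iff)
      then show ?thesis using zero[of z] z by (simp add: G_def lap_cauchy_exp)
    qed
  qed (use h conn c s in \<open>auto simp: open_halfspace_Re_gt\<close>)
qed

text \<open>The adjoint annihilates Tf, and ||Tf||^2 is the inner product of f with the adjoint
  applied to Tf.\<close>

lemma operator_eq_0_if_weight_0:
  assumes T: "bounded_operator_L2 T" and adj: "H2_adjoint (hardy_transfer T) (weighted_composition h \<phi>)"
    and h: "\<And>s. s \<in> RHP \<Longrightarrow> h s = 0" and f: "f \<in> Lsq unit_interval"
  shows "sqnorm unit_interval (T f) = 0"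
proof -
  have Tf: "T f \<in> Lsq unit_interval" by (rule bounded_operator_Lsq[OF T f])
  obtain k where k: "k \<in> Lsq unit_interval" "\<And>s. s \<in> RHP \<Longrightarrow> lap k s = 0"
    "ip unit_interval (T f) (T f) = ip unit_interval f k"
    using adjoint_pair[OF T adj Tf] f h by (auto simp: weighted_composition_def)
  then have "sqnorm unit_interval k = 0" by (intro lap_eq_0_imp) auto
  then have "ip unit_interval f k = 0" using ip_le[OF f k(1)] by simp
  then show ?thesis using k(3) by (simp add: ip_self)
qed

lemma compact_operator_if_0:
  assumes "\<And>f. f \<in> Lsq unit_interval \<Longrightarrow> sqnorm unit_interval (T f) = 0"
  shows "compact_operator_L2 T"
  unfolding compact_operator_L2_def L2_eq_Lsq L2_norm_eq_sqnorm
proof (intro allI impI exI[of _ "\<lambda>n. n"] exI[of _ "\<lambda>x. 0"])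
  fix f :: "nat \<Rightarrow> real \<Rightarrow> complex"
  assume "(\<forall>k. f k \<in> Lsq unit_interval) \<and> (\<exists>B. \<forall>k. sqrt (sqnorm unit_interval (f k)) \<le> B)"
  then show "strict_mono (\<lambda>n::nat. n) \<and> (\<lambda>x. 0) \<in> Lsq unit_interval
      \<and> (\<lambda>k. sqrt (sqnorm unit_interval (\<lambda>x. T (f k) x - 0))) \<longlonglongrightarrow> 0"
    using assms by (simp add: strict_mono_def)
qed

text \<open>From t'^2 \<le> 2 t^2 + 2 (t' - t)^2. The constant involves only \<delta>/\<beta>, so at
  fixed height the kernel may be replaced by its average over a window of fixed width.\<close>

lemma poisson_Harnack:
  assumes \<beta>: "\<beta> > 0" and close: "\<bar>t - t'\<bar> \<le> \<delta>"
  shows "poisson \<beta> t \<le> (2 + 2 * \<delta>\<^sup>2 / \<beta>\<^sup>2) * poisson \<beta> t'"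
proof -
  have "t'\<^sup>2 \<le> 2 * t\<^sup>2 + 2 * (t' - t)\<^sup>2"
    using sum_squares_bound[of t "t' - t"] by (simp add: power2_eq_square algebra_simps)
  moreover have "(t' - t)\<^sup>2 \<le> \<delta>\<^sup>2"
    using close by (intro abs_le_square_iff[THEN iffD1]) linarith
  ultimately have "\<beta>\<^sup>2 + t'\<^sup>2 \<le> 2 * (\<beta>\<^sup>2 + t\<^sup>2) + 2 * \<delta>\<^sup>2"
    using zero_le_power2[of \<beta>] unfolding distrib_left by linarith
  also have "\<dots> \<le> (2 + 2 * \<delta>\<^sup>2 / \<beta>\<^sup>2) * (\<beta>\<^sup>2 + t\<^sup>2)"
    using \<beta> by (simp add: distrib_left distrib_right)
  finally have *: "\<beta>\<^sup>2 + t'\<^sup>2 \<le> (2 + 2 * \<delta>\<^sup>2 / \<beta>\<^sup>2) * (\<beta>\<^sup>2 + t\<^sup>2)" .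
  define C where "C = 2 + 2 * \<delta>\<^sup>2 / \<beta>\<^sup>2"
  have pos: "pi * (\<beta>\<^sup>2 + t\<^sup>2) > 0" "pi * (\<beta>\<^sup>2 + t'\<^sup>2) > 0" using \<beta> by (auto intro!: mult_pos_pos add_pos_nonneg)
  have "\<beta> * (pi * (\<beta>\<^sup>2 + t'\<^sup>2)) \<le> \<beta> * (pi * (C * (\<beta>\<^sup>2 + t\<^sup>2)))"
    using * \<beta> by (intro mult_left_mono) (auto simp: C_def)
  then have "\<beta> * (pi * (\<beta>\<^sup>2 + t'\<^sup>2)) \<le> C * \<beta> * (pi * (\<beta>\<^sup>2 + t\<^sup>2))"
    by (simp add: mult_ac)
  then have "\<beta> / (pi * (\<beta>\<^sup>2 + t\<^sup>2)) \<le> C * \<beta> / (pi * (\<beta>\<^sup>2 + t'\<^sup>2))"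
    using pos by (simp only: pos_divide_le_eq[OF pos(1)] times_divide_eq_left pos_le_divide_eq[OF pos(2)])
  then show ?thesis by (simp add: poisson_def C_def)
qed

text \<open>Averaging the Poisson kernel over a window of fixed width replaces the measure by its windowed
  masses.\<close>

lemma windowed_carleson:
  fixes H :: "real \<Rightarrow> complex"
  assumes [measurable]: "H \<in> borel_measurable borel" and a: "a > 0" and \<beta>: "\<beta> > 0" and \<delta>: "\<delta> > 0" and e: "e \<ge> 0"
    and window: "\<And>s. \<bar>s\<bar> \<ge> M \<Longrightarrow> (\<integral>\<^sup>+y\<in>{(s - \<delta>) / a..(s + \<delta>) / a}. ennreal ((cmod (H y))\<^sup>2) \<partial>lborel) \<le> ennreal (e * \<delta>)"
    and g: "g \<in> Lsq unit_interval"
  shows "(\<integral>\<^sup>+y. ennreal ((cmod (H y * lap g (Complex \<beta> (a * y))))\<^sup>2) * indicator {y. \<bar>a * y\<bar> \<ge> M + \<delta>} y \<partial>lborel)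
     \<le> ennreal (pi * (2 + 2 * \<delta>\<^sup>2 / \<beta>\<^sup>2) * e * sqnorm unit_interval g)"
proof -
  obtain \<Phi> where \<Phi>: "boundary_trace g \<Phi>" using boundary_trace_exists[OF g] by blast
  have \<Phi>L: "\<Phi> \<in> Lsq lborel" by (rule boundary_trace_Lsq[OF \<Phi>])
  then have [measurable]: "\<Phi> \<in> borel_measurable borel" by (simp add: Lsq_def)
  define C where "C = 2 + 2 * \<delta>\<^sup>2 / \<beta>\<^sup>2"
  have C: "C \<ge> 0" by (simp add: C_def)
  \<comment> \<open>Cutting off at M + \<delta> rather than M ensures that a window of half-width
    \<delta> meeting the support has its centre beyond M, where the hypothesis applies.\<close>
  define w where "w y = ennreal ((cmod (H y))\<^sup>2) * indicator {y. \<bar>a * y\<bar> \<ge> M + \<delta>} y" for y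
  have [measurable]: "w \<in> borel_measurable borel" unfolding w_def[abs_def] by measurable
  \<comment> \<open>Incidence of a point y with the window centred at s, as a function of both
    variables for the sake of Fubini.\<close>
  define I where "I = (\<lambda>(s, y). indicator {p. \<bar>fst p - a * snd p\<bar> \<le> \<delta>} (s, y) :: ennreal)"
  have [measurable]: "I \<in> borel_measurable (borel \<Otimes>\<^sub>M borel)"
    unfolding I_def by measurable
  have pm [measurable]: "(\<lambda>p. poisson \<beta> (fst p - snd p)) \<in> borel_measurable (borel \<Otimes>\<^sub>M borel)"
    unfolding poisson_def by measurable
  \<comment> \<open>Harnack on the window, integrated over its centre s; 2\<delta> is its
    length.\<close>
  have smooth: "ennreal (poisson \<beta> (v - a * y)) \<le> ennreal (C / (2 * \<delta>)) * (\<integral>\<^sup>+s. ennreal (poisson \<beta> (v - s)) * I (s, y) \<partial>lborel)" for v y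
  proof -
    have "ennreal (poisson \<beta> (v - a * y)) * ennreal (2 * \<delta>)
        = (\<integral>\<^sup>+s. ennreal (poisson \<beta> (v - a * y)) * indicator {a * y - \<delta>..a * y + \<delta>} s \<partial>lborel)"
      using \<delta> by (subst nn_integral_cmult_indicator) auto
    also have "\<dots> \<le> (\<integral>\<^sup>+s. ennreal C * (ennreal (poisson \<beta> (v - s)) * I (s, y)) \<partial>lborel)"
    proof (rule nn_integral_mono)
      fix s :: real
      show "ennreal (poisson \<beta> (v - a * y)) * indicator {a * y - \<delta>..a * y + \<delta>} s
          \<le> ennreal C * (ennreal (poisson \<beta> (v - s)) * I (s, y))"
      proof (cases "\<bar>s - a * y\<bar> \<le> \<delta>")
        case True
        then have "poisson \<beta> (v - a * y) \<le> C * poisson \<beta> (v - s)"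
          unfolding C_def by (intro poisson_Harnack \<beta>) simp
        then show ?thesis
          using True C poisson_nonneg[OF \<beta>] by (auto simp: I_def indicator_def ennreal_leI simp flip: ennreal_mult)
      next
        case False
        then have "s \<notin> {a * y - \<delta>..a * y + \<delta>}" by (auto simp: abs_le_iff)
        then show ?thesis by simp
      qed
    qed
    also have "\<dots> = ennreal C * (\<integral>\<^sup>+s. ennreal (poisson \<beta> (v - s)) * I (s, y) \<partial>lborel)"
      by (rule nn_integral_cmult) measurable
    finally have "ennreal (1 / (2 * \<delta>)) * (ennreal (poisson \<beta> (v - a * y)) * ennreal (2 * \<delta>))
        \<le> ennreal (1 / (2 * \<delta>)) * (ennreal C * (\<integral>\<^sup>+s. ennreal (poisson \<beta> (v - s)) * I (s, y) \<partial>lborel))"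
      by (intro mult_left_mono) auto
    moreover have "ennreal (1 / (2 * \<delta>)) * (ennreal (poisson \<beta> (v - a * y)) * ennreal (2 * \<delta>)) = ennreal (poisson \<beta> (v - a * y))"
      using \<delta> poisson_nonneg[OF \<beta>] by (simp flip: ennreal_mult)
    moreover have "ennreal (1 / (2 * \<delta>)) * (ennreal C * X) = ennreal (C / (2 * \<delta>)) * X" for X
      using \<delta> C by (simp add: mult.assoc[symmetric] flip: ennreal_mult)
    ultimately show ?thesis by simp
  qed
  have mass: "(\<integral>\<^sup>+y. w y * I (s, y) \<partial>lborel) \<le> ennreal (e * \<delta>)" for s
  proof (cases "\<bar>s\<bar> \<ge> M")
    case True
    have "(\<integral>\<^sup>+y. w y * I (s, y) \<partial>lborel) \<le> (\<integral>\<^sup>+y\<in>{(s - \<delta>) / a..(s + \<delta>) / a}. ennreal ((cmod (H y))\<^sup>2) \<partial>lborel)"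
      using a by (intro nn_integral_mono)
        (auto simp: w_def I_def indicator_def abs_le_iff pos_le_divide_eq pos_divide_le_eq algebra_simps split: if_splits)
    with window[OF True] show ?thesis by (rule order_trans[rotated])
  next
    case False
    have "w y * I (s, y) = 0" for y
      using False by (auto simp: w_def I_def indicator_def)
    then have "(\<integral>\<^sup>+y. w y * I (s, y) \<partial>lborel) = (\<integral>\<^sup>+(y::real). 0 \<partial>lborel)"
      by (simp only:)
    then show ?thesis by simp
  qed
  \<comment> \<open>After exchanging the integrals, each window contributes at most e \<delta> and
    the Poisson kernel has mass 1. The bound is uniform in v, which then pairs with the integral of
    |\<Phi>|^2.\<close>
  have J: "(\<integral>\<^sup>+y. w y * ennreal (poisson \<beta> (v - a * y)) \<partial>lborel) \<le> ennreal (C * e / 2)" for v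
  proof -
    have "(\<integral>\<^sup>+y. w y * ennreal (poisson \<beta> (v - a * y)) \<partial>lborel)
        \<le> (\<integral>\<^sup>+y. w y * (ennreal (C / (2 * \<delta>)) * (\<integral>\<^sup>+s. ennreal (poisson \<beta> (v - s)) * I (s, y) \<partial>lborel)) \<partial>lborel)"
      by (intro nn_integral_mono mult_left_mono smooth) auto
    also have "\<dots> = (\<integral>\<^sup>+y. ennreal (C / (2 * \<delta>)) * (\<integral>\<^sup>+s. w y * (ennreal (poisson \<beta> (v - s)) * I (s, y)) \<partial>lborel) \<partial>lborel)"
      by (intro nn_integral_cong, subst nn_integral_cmult) (auto simp: mult_ac)
    also have "\<dots> = ennreal (C / (2 * \<delta>)) * (\<integral>\<^sup>+y. \<integral>\<^sup>+s. w y * (ennreal (poisson \<beta> (v - s)) * I (s, y)) \<partial>lborel \<partial>lborel)"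
      by (rule nn_integral_cmult) measurable
    also have "(\<integral>\<^sup>+y. \<integral>\<^sup>+s. w y * (ennreal (poisson \<beta> (v - s)) * I (s, y)) \<partial>lborel \<partial>lborel)
        = (\<integral>\<^sup>+s. \<integral>\<^sup>+y. w y * (ennreal (poisson \<beta> (v - s)) * I (s, y)) \<partial>lborel \<partial>lborel)"
      by (rule lborel_pair.Fubini') measurable
    also have "\<dots> = (\<integral>\<^sup>+s. ennreal (poisson \<beta> (v - s)) * (\<integral>\<^sup>+y. w y * I (s, y) \<partial>lborel) \<partial>lborel)"
      by (intro nn_integral_cong, subst nn_integral_cmult[symmetric]) (auto simp: mult_ac)
    also have "\<dots> \<le> (\<integral>\<^sup>+s. ennreal (poisson \<beta> (s - v)) * ennreal (e * \<delta>) \<partial>lborel)"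
    proof (intro nn_integral_mono mult_mono mass)
      show "ennreal (poisson \<beta> (v - s)) \<le> ennreal (poisson \<beta> (s - v))" for s
        by (simp add: poisson_def power2_commute)
    qed auto
    also have "\<dots> = ennreal (e * \<delta>)"
      by (subst nn_integral_multc) (auto simp: poisson_nn_integral \<beta>)
    finally have "(\<integral>\<^sup>+y. w y * ennreal (poisson \<beta> (v - a * y)) \<partial>lborel) \<le> ennreal (C / (2 * \<delta>)) * ennreal (e * \<delta>)"
      by (simp add: mult_left_mono)
    also have "\<dots> = ennreal (C * e / 2)" using \<delta> C e by (simp flip: ennreal_mult)
    finally show ?thesis .
  qed
  have "(\<integral>\<^sup>+y. ennreal ((cmod (H y * lap g (Complex \<beta> (a * y))))\<^sup>2) * indicator {y. \<bar>a * y\<bar> \<ge> M + \<delta>} y \<partial>lborel)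
      = (\<integral>\<^sup>+y. w y * ennreal ((cmod (lap g (Complex \<beta> (a * y))))\<^sup>2) \<partial>lborel)"
    by (intro nn_integral_cong) (simp add: w_def norm_mult power_mult_distrib ennreal_mult mult_ac)
  also have "\<dots> \<le> (\<integral>\<^sup>+y. w y * (\<integral>\<^sup>+v. ennreal (poisson \<beta> (v - a * y)) * ennreal ((cmod (\<Phi> v))\<^sup>2) \<partial>lborel) \<partial>lborel)"
    by (intro nn_integral_mono mult_left_mono boundary_trace_poisson_sq[OF \<Phi> \<beta>]) auto
  also have "\<dots> = (\<integral>\<^sup>+y. \<integral>\<^sup>+v. w y * (ennreal (poisson \<beta> (v - a * y)) * ennreal ((cmod (\<Phi> v))\<^sup>2)) \<partial>lborel \<partial>lborel)"
    by (intro nn_integral_cong nn_integral_cmult[symmetric]) measurable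
  also have "\<dots> = (\<integral>\<^sup>+v. \<integral>\<^sup>+y. w y * (ennreal (poisson \<beta> (v - a * y)) * ennreal ((cmod (\<Phi> v))\<^sup>2)) \<partial>lborel \<partial>lborel)"
    by (rule lborel_pair.Fubini') measurable
  also have "\<dots> = (\<integral>\<^sup>+v. (\<integral>\<^sup>+y. w y * ennreal (poisson \<beta> (v - a * y)) \<partial>lborel) * ennreal ((cmod (\<Phi> v))\<^sup>2) \<partial>lborel)"
    by (intro nn_integral_cong, subst nn_integral_multc[symmetric]) (auto simp: mult_ac)
  also have "\<dots> \<le> (\<integral>\<^sup>+v. ennreal (C * e / 2) * ennreal ((cmod (\<Phi> v))\<^sup>2) \<partial>lborel)"
    by (intro nn_integral_mono mult_right_mono J) auto
  also have "\<dots> = ennreal (C * e / 2) * (\<integral>\<^sup>+v. ennreal ((cmod (\<Phi> v))\<^sup>2) \<partial>lborel)"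
    by (rule nn_integral_cmult) measurable
  also have "\<dots> = ennreal (C * e / 2) * ennreal (2 * pi * sqnorm unit_interval g)"
    by (simp only: sqnorm_eq_nn_integral[OF \<Phi>L] boundary_trace_sqnorm[OF \<Phi>])
  also have "\<dots> = ennreal (pi * C * e * sqnorm unit_interval g)"
    using C e by (simp flip: ennreal_mult add: mult_ac)
  finally show ?thesis by (simp only: C_def)
qed

text \<open>The denominator is at least L and at least |t| - |Im z| in modulus, hence at least their
  geometric mean. The factor sqrt(L) cancels, and what remains decays in |t| uniformly in L; no
  bound on L is available where this is applied.\<close>

lemma powsum_tr_kernel_LIMSEQ_0:
  fixes t L :: "nat \<Rightarrow> real"
  assumes "powsum_ok xs" and L: "\<And>n. L n > 0" and t: "filterlim (\<lambda>n. \<bar>t n\<bar>) at_top sequentially"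
  shows "(\<lambda>n. of_real (sqrt (2 * L n)) * powsum_tr xs (Complex (L n) (t n))) \<longlonglongrightarrow> 0"
  using assms(1)
proof (induction xs)
  case Nil
  then show ?case by simp
next
  case (Cons p xs)
  obtain k z where p: "p = (k, z)" by force
  have z: "Re z > -1/2" "powsum_ok xs" using Cons.prems by (auto simp: p)
  have "(\<lambda>n. of_real (sqrt (2 * L n)) * (k / (Complex (L n) (t n) + z + 1/2))) \<longlonglongrightarrow> 0"
  proof (rule Lim_null_comparison)
    have "filterlim (\<lambda>n. - \<bar>Im z\<bar> + \<bar>t n\<bar>) at_top sequentially"
      by (rule filterlim_tendsto_add_at_top[OF tendsto_const t])
    then have lim: "filterlim (\<lambda>n. \<bar>t n\<bar> - \<bar>Im z\<bar>) at_top sequentially" by simp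
    have "filterlim (\<lambda>n. sqrt (\<bar>t n\<bar> - \<bar>Im z\<bar>)) at_top sequentially"
      by (rule filterlim_compose[OF sqrt_at_top lim])
    then show "(\<lambda>n. cmod k * sqrt 2 / sqrt (\<bar>t n\<bar> - \<bar>Im z\<bar>)) \<longlonglongrightarrow> 0"
      by (intro tendsto_divide_0[OF tendsto_const] filterlim_at_top_imp_at_infinity)
    have "eventually (\<lambda>n. \<bar>t n\<bar> - \<bar>Im z\<bar> > 0) sequentially"
      using lim unfolding filterlim_at_top_dense by blast
    then show "\<forall>\<^sub>F n in sequentially. norm (of_real (sqrt (2 * L n)) * (k / (Complex (L n) (t n) + z + 1/2)))
        \<le> cmod k * sqrt 2 / sqrt (\<bar>t n\<bar> - \<bar>Im z\<bar>)"
    proof eventually_elim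
      case (elim n)
      define q where "q = Complex (L n) (t n) + z + 1/2"
      have q1: "L n \<le> cmod q" using complex_Re_le_cmod[of q] z by (simp add: q_def)
      have q2: "\<bar>t n\<bar> - \<bar>Im z\<bar> \<le> cmod q" using abs_Im_le_cmod[of q] by (simp add: q_def)
      have "L n * (\<bar>t n\<bar> - \<bar>Im z\<bar>) \<le> cmod q * cmod q"
        using q1 q2 L[of n] elim by (intro mult_mono) auto
      then have "sqrt (L n * (\<bar>t n\<bar> - \<bar>Im z\<bar>)) \<le> cmod q"
        by (intro real_le_lsqrt) (auto simp: power2_eq_square)
      then have *: "sqrt (L n) * sqrt (\<bar>t n\<bar> - \<bar>Im z\<bar>) \<le> cmod q" by (simp add: real_sqrt_mult)
      have qpos: "cmod q > 0" using q1 L[of n] by linarith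
      have spos: "sqrt (\<bar>t n\<bar> - \<bar>Im z\<bar>) > 0" using elim by simp
      have "sqrt (L n) / cmod q \<le> 1 / sqrt (\<bar>t n\<bar> - \<bar>Im z\<bar>)"
        using * by (simp only: pos_divide_le_eq[OF qpos] times_divide_eq_left pos_le_divide_eq[OF spos] mult_1)
      then have "cmod k * sqrt 2 * (sqrt (L n) / cmod q) \<le> cmod k * sqrt 2 * (1 / sqrt (\<bar>t n\<bar> - \<bar>Im z\<bar>))"
        by (intro mult_left_mono) auto
      moreover have "norm (of_real (sqrt (2 * L n)) * (k / q)) = cmod k * sqrt 2 * (sqrt (L n) / cmod q)"
        using L[of n] by (simp add: norm_mult norm_divide real_sqrt_mult)
      ultimately show ?case by (simp add: q_def)
    qed
  qed
  from tendsto_add[OF this Cons.IH[OF z(2)]] show ?case by (simp add: p distrib_left)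
qed

text \<open>The quantity is the inner product of f with a kernel of norm 1, so replacing f by a
  generalised polynomial costs at most the approximation error, for all n at once.\<close>

lemma normalized_kernel_weakly_null:
  fixes t L :: "nat \<Rightarrow> real"
  assumes f: "f \<in> Lsq unit_interval" and L: "\<And>n. L n > 0" and t: "filterlim (\<lambda>n. \<bar>t n\<bar>) at_top sequentially"
  shows "(\<lambda>n. of_real (sqrt (2 * L n)) * lap f (Complex (L n) (t n))) \<longlonglongrightarrow> 0"
proof (rule LIMSEQ_I)
  fix e :: real assume e: "e > 0"
  then have "(e / 2)\<^sup>2 > 0" by simp
  then obtain xs where xs: "powsum_ok xs" "sqnorm unit_interval (\<lambda>u. f u - powsum xs u) < (e / 2)\<^sup>2"
    using powsum_dense[OF f] by blast
  have "eventually (\<lambda>n. norm (of_real (sqrt (2 * L n)) * powsum_tr xs (Complex (L n) (t n))) < e / 2) sequentially"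
    using tendsto_norm_zero[OF powsum_tr_kernel_LIMSEQ_0[where L = L and t = t, OF xs(1) L t]] e
    by (intro order_tendstoD) auto
  then obtain N where N: "\<And>n. n \<ge> N \<Longrightarrow> norm (of_real (sqrt (2 * L n)) * powsum_tr xs (Complex (L n) (t n))) < e / 2"
    by (auto simp: eventually_sequentially)
  have "norm (of_real (sqrt (2 * L n)) * lap f (Complex (L n) (t n))) < e" if n: "n \<ge> N" for n
  proof -
    define s where "s = Complex (L n) (t n)"
    have s: "Re s > 0" using L by (simp add: s_def)
    have "(cmod (of_real (sqrt (2 * L n)) * lap (\<lambda>u. f u - powsum xs u) s))\<^sup>2
        = 2 * L n * (cmod (lap (\<lambda>u. f u - powsum xs u) s))\<^sup>2"
      using L[of n] by (simp add: norm_mult power_mult_distrib)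
    also have "\<dots> \<le> 2 * L n * (sqnorm unit_interval (\<lambda>u. f u - powsum xs u) / (2 * Re s))"
      using L[of n] s by (intro mult_left_mono lap_le Lsq_diff f powsum_Lsq xs) auto
    also have "\<dots> < (e / 2)\<^sup>2" using xs(2) L[of n] by (simp add: s_def)
    finally have "cmod (of_real (sqrt (2 * L n)) * lap (\<lambda>u. f u - powsum xs u) s) < e / 2"
      by (rule power2_less_imp_less) (use e in simp)
    moreover have "of_real (sqrt (2 * L n)) * lap f s
        = of_real (sqrt (2 * L n)) * lap (\<lambda>u. f u - powsum xs u) s + of_real (sqrt (2 * L n)) * powsum_tr xs s"
      using s f xs by (simp add: lap_diff powsum_Lsq lap_powsum algebra_simps)
    ultimately show ?thesis
      using N[OF n] norm_triangle_ineq[of "of_real (sqrt (2 * L n)) * lap (\<lambda>u. f u - powsum xs u) s" "of_real (sqrt (2 * L n)) * powsum_tr xs s"]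
      by (simp add: s_def)
  qed
  then show "\<exists>no. \<forall>n\<ge>no. norm (of_real (sqrt (2 * L n)) * lap f (Complex (L n) (t n)) - 0) < e"
    by auto
qed

section \<open>The compactness criterion\<close>

text \<open>The case where the symbol maps even the imaginary axis into the open half-plane, so that
  transforms are evaluated at interior points over the boundary.\<close>

locale affine_weight =
  fixes T :: "(real \<Rightarrow> complex) \<Rightarrow> (real \<Rightarrow> complex)" and h :: "complex \<Rightarrow> complex" and a b \<beta> :: real
  assumes T: "bounded_operator_L2 T"
    and adj: "H2_adjoint (hardy_transfer T) (weighted_composition h (affine_symbol a b))"
    and a_pos: "a > 0" and b_pos: "b > 0" and \<beta>_eq: "\<beta> = b + (1 - a) / 2" and \<beta>_pos: "\<beta> > 0"
begin

text \<open>A relation, as the adjoint is determined only up to null sets.\<close>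

definition adjoint_of :: "(real \<Rightarrow> complex) \<Rightarrow> (real \<Rightarrow> complex) \<Rightarrow> bool" where
  "adjoint_of g k \<longleftrightarrow> k \<in> Lsq unit_interval \<and> (\<forall>s\<in>RHP. lap k s = h s * lap g (affine_symbol a b s)) \<and>
     (\<forall>f\<in>Lsq unit_interval. ip unit_interval (T f) g = ip unit_interval f k)"

lemma adjoint_of_exists: "g \<in> Lsq unit_interval \<Longrightarrow> \<exists>k. adjoint_of g k"
  using adjoint_pair[OF T adj, of g] unfolding adjoint_of_def weighted_composition_def by blast

text \<open>One H has to serve all g. It is obtained from the single test function with transform
  1/(s + 1), as a boundary function times an affine factor. For other g the limits multiply, since
  the transform of g is continuous at the image points. The affine factor is unbounded, so square
  integrability of H is claimed only locally.\<close>

lemma boundary_function: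
  "\<exists>H\<in>borel_measurable borel. (AE y in lborel. boundary_value h y = H y) \<and>
     (\<forall>g k. g \<in> Lsq unit_interval \<longrightarrow> adjoint_of g k \<longrightarrow>
       (\<integral>\<^sup>+y. ennreal ((cmod (H y * lap g (Complex \<beta> (a * y))))\<^sup>2) \<partial>lborel) = ennreal (2 * pi * sqnorm unit_interval k)) \<and>
     (\<forall>R. (\<integral>\<^sup>+y. ennreal ((cmod (H y))\<^sup>2) * indicator {y. \<bar>y\<bar> \<le> R} y \<partial>lborel) < \<infinity>)"
proof -
  have sym: "affine_symbol a b (Complex x y) = Complex (a * x + \<beta>) (a * y)" for x y
    by (simp add: affine_symbol_Complex \<beta>_eq)
  obtain k0 where k0: "adjoint_of cauchy_exp k0"
    using adjoint_of_exists[OF cauchy_exp_Lsq] by blast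
  then have k0L: "k0 \<in> Lsq unit_interval" by (simp add: adjoint_of_def)
  obtain \<Phi>0 where \<Phi>0: "boundary_trace k0 \<Phi>0" using boundary_trace_exists[OF k0L] by blast
  have \<Phi>0L: "\<Phi>0 \<in> Lsq lborel" by (rule boundary_trace_Lsq[OF \<Phi>0])
  then have [measurable]: "\<Phi>0 \<in> borel_measurable borel" by (simp add: Lsq_def)
  define E where "E y = Complex \<beta> (a * y) + 1" for y
  have contE: "continuous_on UNIV E" unfolding E_def[abs_def] by (intro continuous_intros)
  then have [measurable]: "E \<in> borel_measurable borel" by (rule borel_measurable_continuous_onI)
  define H where "H y = \<Phi>0 y * E y" for y
  have H_meas [measurable]: "H \<in> borel_measurable borel" unfolding H_def[abs_def] by measurable
  have Re_sym: "a * x + \<beta> > 0" if "x > 0" for x using that a_pos \<beta>_pos by (simp add: add_pos_pos)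
  have h_eq: "h (Complex x y) = lap k0 (Complex x y) * (Complex (a * x + \<beta>) (a * y) + 1)" if x: "x > 0" for x y
  proof -
    have nz: "Complex (a * x + \<beta>) (a * y) + 1 \<noteq> 0" using Re_sym[OF x] by (simp add: complex_eq_iff)
    have "lap k0 (Complex x y) = h (Complex x y) * (1 / (Complex (a * x + \<beta>) (a * y) + 1))"
      using k0 x Re_sym[OF x] unfolding adjoint_of_def by (simp add: sym lap_cauchy_exp)
    then show ?thesis using nz by simp
  qed
  have h_lim: "AE y in lborel. ((\<lambda>x. h (Complex x y)) \<longlongrightarrow> H y) (at_right 0)"
    using lap_boundary_limit[OF \<Phi>0]
  proof eventually_elim
    case (elim y)
    have "((\<lambda>x. Complex (a * x + \<beta>) (a * y) + 1) \<longlongrightarrow> Complex (a * 0 + \<beta>) (a * y) + 1) (at_right 0)"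
      by (intro tendsto_intros)
    from tendsto_mult[OF elim this]
    have lim: "((\<lambda>x. lap k0 (Complex x y) * (Complex (a * x + \<beta>) (a * y) + 1)) \<longlongrightarrow> H y) (at_right 0)"
      by (simp add: H_def E_def)
    show ?case
      by (rule Lim_transform_eventually[OF lim])
        (use eventually_at_right_less[of 0] in \<open>eventually_elim; simp add: h_eq\<close>)
  qed
  then have "AE y in lborel. boundary_value h y = H y"
    unfolding boundary_value_def by eventually_elim (rule tendsto_Lim; simp)
  moreover have "(\<integral>\<^sup>+y. ennreal ((cmod (H y * lap g (Complex \<beta> (a * y))))\<^sup>2) \<partial>lborel) = ennreal (2 * pi * sqnorm unit_interval k)"
    if g: "g \<in> Lsq unit_interval" and k: "adjoint_of g k" for g k
  proof -
    have kL: "k \<in> Lsq unit_interval" using k by (simp add: adjoint_of_def)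
    obtain \<Psi> where \<Psi>: "boundary_trace k \<Psi>" using boundary_trace_exists[OF kL] by blast
    have "AE y in lborel. H y * lap g (Complex \<beta> (a * y)) = \<Psi> y"
      using lap_boundary_limit[OF \<Psi>] h_lim
    proof eventually_elim
      case (elim y)
      have "isCont (lap g) (Complex \<beta> (a * y))"
        using lap_holomorphic[OF g] \<beta>_pos
        by (intro continuous_on_interior[OF holomorphic_on_imp_continuous_on])
          (auto simp: interior_open open_halfspace_Re_gt)
      moreover have "((\<lambda>x. Complex (a * x + \<beta>) (a * y)) \<longlongrightarrow> Complex (a * 0 + \<beta>) (a * y)) (at_right 0)"
        by (intro tendsto_intros)
      ultimately have "((\<lambda>x. lap g (Complex (a * x + \<beta>) (a * y))) \<longlongrightarrow> lap g (Complex \<beta> (a * y))) (at_right 0)"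
        by (intro isCont_tendsto_compose[where g = "lap g"]) simp_all
      from tendsto_mult[OF elim(2) this]
      have "((\<lambda>x. h (Complex x y) * lap g (Complex (a * x + \<beta>) (a * y))) \<longlongrightarrow> H y * lap g (Complex \<beta> (a * y))) (at_right 0)" .
      moreover have "\<forall>\<^sub>F x in at_right 0. h (Complex x y) * lap g (Complex (a * x + \<beta>) (a * y)) = lap k (Complex x y)"
        using eventually_at_right_less[of 0]
        by eventually_elim (use k in \<open>simp add: adjoint_of_def sym\<close>)
      ultimately have "((\<lambda>x. lap k (Complex x y)) \<longlongrightarrow> H y * lap g (Complex \<beta> (a * y))) (at_right 0)"
        by (rule Lim_transform_eventually)
      from tendsto_unique[OF _ this elim(1)] show ?case by simp
    qed
    note ae = this
    have "(\<integral>\<^sup>+y. ennreal ((cmod (H y * lap g (Complex \<beta> (a * y))))\<^sup>2) \<partial>lborel) = (\<integral>\<^sup>+y. ennreal ((cmod (\<Psi> y))\<^sup>2) \<partial>lborel)"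
      by (rule nn_integral_cong_AE, use ae in eventually_elim) simp
    also have "\<dots> = ennreal (2 * pi * sqnorm unit_interval k)"
      by (simp only: sqnorm_eq_nn_integral[OF boundary_trace_Lsq(2)[OF \<Psi>]] boundary_trace_sqnorm[OF \<Psi>])
    finally show ?thesis .
  qed
  moreover have "(\<integral>\<^sup>+y. ennreal ((cmod (H y))\<^sup>2) * indicator {y. \<bar>y\<bar> \<le> R} y \<partial>lborel) < \<infinity>" for R
  proof -
    \<comment> \<open>Bounds |E|^2 on |y| \<le> R by the sum of the moduli of real and imaginary
      part; |R| admits negative R.\<close>
    define B where "B = (\<beta> + a * \<bar>R\<bar> + 1)\<^sup>2"
    have "(\<integral>\<^sup>+y. ennreal ((cmod (H y))\<^sup>2) * indicator {y. \<bar>y\<bar> \<le> R} y \<partial>lborel)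
        \<le> (\<integral>\<^sup>+y. ennreal B * ennreal ((cmod (\<Phi>0 y))\<^sup>2) \<partial>lborel)"
    proof (rule nn_integral_mono)
      fix y :: real
      show "ennreal ((cmod (H y))\<^sup>2) * indicator {y. \<bar>y\<bar> \<le> R} y \<le> ennreal B * ennreal ((cmod (\<Phi>0 y))\<^sup>2)"
      proof (cases "\<bar>y\<bar> \<le> R")
        case True
        have "cmod (E y) \<le> \<bar>Re (E y)\<bar> + \<bar>Im (E y)\<bar>" by (rule cmod_le)
        also have "\<dots> \<le> \<beta> + a * \<bar>R\<bar> + 1"
          using a_pos \<beta>_pos True mult_left_mono[of "\<bar>y\<bar>" "\<bar>R\<bar>" a] by (simp add: E_def abs_mult)
        finally have "(cmod (E y))\<^sup>2 \<le> B" unfolding B_def by (rule power_mono) simp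
        from mult_right_mono[OF this, of "(cmod (\<Phi>0 y))\<^sup>2"]
        have "(cmod (H y))\<^sup>2 \<le> B * (cmod (\<Phi>0 y))\<^sup>2"
          by (simp add: H_def norm_mult power_mult_distrib mult.commute)
        then show ?thesis using True by (simp add: ennreal_leI B_def flip: ennreal_mult)
      qed simp
    qed
    also have "\<dots> = ennreal B * ennreal (sqnorm lborel \<Phi>0)"
      by (subst nn_integral_cmult) (auto simp: sqnorm_eq_nn_integral[OF \<Phi>0L])
    also have "\<dots> < \<infinity>" by (simp add: ennreal_mult_less_top)
    finally show ?thesis .
  qed
  ultimately show ?thesis using H_meas by blast
qed

end

text \<open>Fixes one Borel measurable version of the boundary values, since the pointwise limit
  with its arbitrary values on a null set comes without measurability.\<close>

locale affine_weight_boundary = affine_weight +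
  fixes H :: "real \<Rightarrow> complex"
  assumes H_measurable [measurable]: "H \<in> borel_measurable borel"
    and H_boundary: "AE y in lborel. boundary_value h y = H y"
    and H_isometry: "\<And>g k. g \<in> Lsq unit_interval \<Longrightarrow> adjoint_of g k \<Longrightarrow>
       (\<integral>\<^sup>+y. ennreal ((cmod (H y * lap g (Complex \<beta> (a * y))))\<^sup>2) \<partial>lborel) = ennreal (2 * pi * sqnorm unit_interval k)"
    and H_local: "\<And>R. (\<integral>\<^sup>+y. ennreal ((cmod (H y))\<^sup>2) * indicator {y. \<bar>y\<bar> \<le> R} y \<partial>lborel) < \<infinity>"
begin

lemma boundary_integral_eq:
  "(\<integral>\<^sup>+y\<in>A. ennreal ((cmod (boundary_value h y))\<^sup>2) \<partial>lborel) = (\<integral>\<^sup>+y\<in>A. ennreal ((cmod (H y))\<^sup>2) \<partial>lborel)"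
  by (rule nn_integral_cong_AE, use H_boundary in eventually_elim) simp

lemma adjoint_of_sqnorm: "adjoint_of g k \<Longrightarrow> complex_of_real (sqnorm unit_interval k) = ip unit_interval (T k) g"
  by (simp add: adjoint_of_def ip_self)

text \<open>Failure of the condition gives windows with |t n| tending to infinity and no upper
  control of L n. The test kernels are therefore placed at height L n: on the window the squared
  transform is at least of order 1/L n, which balances a mass of order \<epsilon> L n.\<close>

lemma compact_imp_vanishing:
  assumes compact: "compact_operator_L2 T"
  shows "vanishing_mean_condition a b h"
proof (rule ccontr)
  assume "\<not> vanishing_mean_condition a b h"
  then obtain \<epsilon> where \<epsilon>: "\<epsilon> > 0" and ex: "\<And>M. M > 0 \<Longrightarrow> \<exists>t L. \<bar>t\<bar> \<ge> M \<and> L \<ge> b / 2 \<and>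
      ennreal (\<epsilon> * L) \<le> (\<integral>\<^sup>+y\<in>{(t - L) / a..(t + L) / a}. ennreal ((cmod (H y))\<^sup>2) \<partial>lborel)"
    unfolding vanishing_mean_condition_def boundary_integral_eq not_less[symmetric] by blast
  have "\<exists>t L. \<bar>t\<bar> \<ge> real (Suc n) \<and> L \<ge> b / 2 \<and>
      ennreal (\<epsilon> * L) \<le> (\<integral>\<^sup>+y\<in>{(t - L) / a..(t + L) / a}. ennreal ((cmod (H y))\<^sup>2) \<partial>lborel)" for n
    by (rule ex) simp
  then have "\<forall>n. \<exists>p. \<bar>fst p\<bar> \<ge> real (Suc n) \<and> snd p \<ge> b / 2 \<and> ennreal (\<epsilon> * snd p) \<le>
      (\<integral>\<^sup>+y\<in>{(fst p - snd p) / a..(fst p + snd p) / a}. ennreal ((cmod (H y))\<^sup>2) \<partial>lborel)"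
    unfolding split_paired_Ex fst_conv snd_conv by blast
  from choice[OF this] obtain p where p: "\<And>n. \<bar>fst (p n)\<bar> \<ge> real (Suc n) \<and> snd (p n) \<ge> b / 2 \<and> ennreal (\<epsilon> * snd (p n)) \<le>
      (\<integral>\<^sup>+y\<in>{(fst (p n) - snd (p n)) / a..(fst (p n) + snd (p n)) / a}. ennreal ((cmod (H y))\<^sup>2) \<partial>lborel)"
    by blast
  define t where "t n = fst (p n)" for n
  define L where "L n = snd (p n)" for n
  have t: "\<bar>t n\<bar> \<ge> real (Suc n)" and Lb: "L n \<ge> b / 2"
    and big: "ennreal (\<epsilon> * L n) \<le> (\<integral>\<^sup>+y\<in>{(t n - L n) / a..(t n + L n) / a}. ennreal ((cmod (H y))\<^sup>2) \<partial>lborel)" for n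
    using p[of n] unfolding t_def L_def by blast+
  have L: "L n > 0" for n using Lb[of n] b_pos by linarith
  define w where "w n = Complex (L n) (t n)" for n
  have w: "Re (w n) > 0" for n using L by (simp add: w_def)
  define g where "g n u = of_real (sqrt (2 * L n)) * kern (w n) u" for n u
  have g: "g n \<in> Lsq unit_interval" for n
    unfolding g_def[abs_def] by (intro Lsq_scale kern_Lsq w)
  have g1: "sqnorm unit_interval (g n) = 1" for n
  proof -
    have "sqnorm unit_interval (g n) = (cmod (of_real (sqrt (2 * L n))))\<^sup>2 * sqnorm unit_interval (kern (w n))"
      unfolding g_def[abs_def] by (rule sqnorm_scale)
    then show ?thesis using L[of n] kern_Lsq(2)[OF w] by (simp add: w_def)
  qed
  have ipg: "ip unit_interval f (g n) = of_real (sqrt (2 * L n)) * lap f (w n)" for f n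
    unfolding g_def[abs_def] ip_scale_right by (simp add: lap_def)
  have lapg: "lap (g n) s = of_real (sqrt (2 * L n)) / (s + cnj (w n))" if s: "Re s > 0" for s n
  proof -
    have "kern (w n) = (\<lambda>u. of_real u powr (cnj (w n) - 1/2))" by (auto simp: kern_def)
    then have "lap (kern (w n)) s = 1 / (s + (cnj (w n) - 1/2) + 1/2)"
      unfolding lap_def using ip_powr_kern[OF s, of "cnj (w n) - 1/2"] w[of n] by simp
    then show ?thesis unfolding g_def[abs_def] lap_scale by simp
  qed
  obtain k where k: "\<And>n. adjoint_of (g n) (k n)"
    using adjoint_of_exists[OF g] by metis
  have kL: "k n \<in> Lsq unit_interval" for n using k by (simp add: adjoint_of_def)
  \<comment> \<open>For L \<ge> b/2 one has \<beta> \<le> (2\<beta>/b) L, so on the window (\<beta>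
    + L)^2 + (a y - t)^2 \<le> \<kappa> L^2.\<close>
  define \<kappa> where "\<kappa> = (1 + 2 * \<beta> / b)\<^sup>2 + 1"
  have \<kappa>: "\<kappa> > 0" by (simp add: \<kappa>_def add_nonneg_pos)
  \<comment> \<open>Solves 2/(\<kappa> L) * \<epsilon> L = 2 pi \<eta>; the dependence on L has
    cancelled.\<close>
  define \<eta> where "\<eta> = \<epsilon> / (pi * \<kappa>)"
  have \<eta>: "\<eta> > 0" using \<epsilon> \<kappa> by (simp add: \<eta>_def)
  have lower: "\<eta> \<le> sqnorm unit_interval (k n)" for n
  proof -
    have pt: "2 / (\<kappa> * L n) \<le> (cmod (lap (g n) (Complex \<beta> (a * y))))\<^sup>2" if y: "y \<in> {(t n - L n) / a..(t n + L n) / a}" for y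
    proof -
      have "\<bar>a * y - t n\<bar> \<le> L n"
        using y a_pos by (simp add: pos_divide_le_eq pos_le_divide_eq abs_le_iff mult.commute)
      then have 1: "(a * y - t n)\<^sup>2 \<le> (L n)\<^sup>2" using L[of n] by (intro abs_le_square_iff[THEN iffD1]) simp
      have "\<beta> * b \<le> 2 * \<beta> * L n" using Lb[of n] \<beta>_pos by simp
      then have "\<beta> + L n \<le> (1 + 2 * \<beta> / b) * L n" using b_pos by (simp add: field_simps)
      then have "(\<beta> + L n)\<^sup>2 \<le> ((1 + 2 * \<beta> / b) * L n)\<^sup>2" using \<beta>_pos L[of n] by (intro power_mono) auto
      then have 2: "(\<beta> + L n)\<^sup>2 + (a * y - t n)\<^sup>2 \<le> \<kappa> * (L n)\<^sup>2"
      proof -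
        have "\<kappa> * (L n)\<^sup>2 = ((1 + 2 * \<beta> / b) * L n)\<^sup>2 + (L n)\<^sup>2"
          unfolding \<kappa>_def power_mult_distrib by (simp only: distrib_right mult_1)
        then show ?thesis using 1 \<open>(\<beta> + L n)\<^sup>2 \<le> ((1 + 2 * \<beta> / b) * L n)\<^sup>2\<close> by linarith
      qed
      have 3: "(\<beta> + L n)\<^sup>2 + (a * y - t n)\<^sup>2 > 0" using \<beta>_pos L[of n] by (intro add_pos_nonneg) auto
      have "Complex \<beta> (a * y) + cnj (w n) = Complex (\<beta> + L n) (a * y - t n)" by (simp add: w_def complex_eq_iff)
      then have "(cmod (lap (g n) (Complex \<beta> (a * y))))\<^sup>2 = 2 * L n / ((\<beta> + L n)\<^sup>2 + (a * y - t n)\<^sup>2)"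
        using lapg[of "Complex \<beta> (a * y)" n] \<beta>_pos L[of n]
        by (simp add: norm_divide power_divide) (simp add: cmod_def)
      moreover have "2 * L n / (\<kappa> * (L n)\<^sup>2) \<le> 2 * L n / ((\<beta> + L n)\<^sup>2 + (a * y - t n)\<^sup>2)"
        using 2 3 L[of n] \<kappa> by (intro divide_left_mono) auto
      moreover have "2 * L n / (\<kappa> * (L n)\<^sup>2) = 2 / (\<kappa> * L n)" using L[of n] by (simp add: power2_eq_square)
      ultimately show ?thesis by simp
    qed
    have "ennreal (2 / (\<kappa> * L n) * (\<epsilon> * L n)) = ennreal (2 / (\<kappa> * L n)) * ennreal (\<epsilon> * L n)"
      using \<kappa> L[of n] \<epsilon> by (intro ennreal_mult) auto
    also have "\<dots> \<le> ennreal (2 / (\<kappa> * L n)) * (\<integral>\<^sup>+y\<in>{(t n - L n) / a..(t n + L n) / a}. ennreal ((cmod (H y))\<^sup>2) \<partial>lborel)"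
      by (intro mult_left_mono big) auto
    also have "\<dots> = (\<integral>\<^sup>+y. ennreal (2 / (\<kappa> * L n)) * (ennreal ((cmod (H y))\<^sup>2) * indicator {(t n - L n) / a..(t n + L n) / a} y) \<partial>lborel)"
      by (rule nn_integral_cmult[symmetric]) measurable
    also have "\<dots> \<le> (\<integral>\<^sup>+y. ennreal ((cmod (H y * lap (g n) (Complex \<beta> (a * y))))\<^sup>2) \<partial>lborel)"
    proof (rule nn_integral_mono)
      fix y :: real
      show "ennreal (2 / (\<kappa> * L n)) * (ennreal ((cmod (H y))\<^sup>2) * indicator {(t n - L n) / a..(t n + L n) / a} y)
          \<le> ennreal ((cmod (H y * lap (g n) (Complex \<beta> (a * y))))\<^sup>2)"
      proof (cases "y \<in> {(t n - L n) / a..(t n + L n) / a}")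
        case True
        from pt[OF True] have "2 / (\<kappa> * L n) * (cmod (H y))\<^sup>2 \<le> (cmod (H y * lap (g n) (Complex \<beta> (a * y))))\<^sup>2"
          by (subst norm_mult, subst power_mult_distrib, subst mult.commute, intro mult_left_mono) auto
        moreover have "ennreal (2 / (\<kappa> * L n)) * ennreal ((cmod (H y))\<^sup>2) = ennreal (2 / (\<kappa> * L n) * (cmod (H y))\<^sup>2)"
          using \<kappa> L[of n] by (intro ennreal_mult[symmetric]) auto
        ultimately show ?thesis using True by (simp add: ennreal_leI)
      qed simp
    qed
    also have "\<dots> = ennreal (2 * pi * sqnorm unit_interval (k n))" by (rule H_isometry[OF g k])
    finally have "2 / (\<kappa> * L n) * (\<epsilon> * L n) \<le> 2 * pi * sqnorm unit_interval (k n)" by simp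
    moreover have "2 / (\<kappa> * L n) * (\<epsilon> * L n) = 2 * pi * \<eta>" using L[of n] \<kappa> by (simp add: \<eta>_def)
    ultimately show ?thesis by simp
  qed
  obtain K where K: "K \<ge> 0" "\<And>f. f \<in> Lsq unit_interval \<Longrightarrow> sqrt (sqnorm unit_interval (T f)) \<le> K * sqrt (sqnorm unit_interval f)"
    using bounded_operator_bound[OF T] by metis
  have TL: "T f \<in> Lsq unit_interval" if "f \<in> Lsq unit_interval" for f by (rule bounded_operator_Lsq[OF T that])
  \<comment> \<open>||k||^2 is the inner product of Tk with g, hence at most K ||k||; division by
    ||k|| is legitimate by \<open>lower\<close>.\<close>
  have upper: "sqrt (sqnorm unit_interval (k n)) \<le> K" for n
  proof -
    have "sqnorm unit_interval (k n) = cmod (ip unit_interval (T (k n)) (g n))"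
      unfolding adjoint_of_sqnorm[OF k, symmetric] by simp
    also have "\<dots> \<le> sqrt (sqnorm unit_interval (T (k n))) * sqrt (sqnorm unit_interval (g n))"
      by (rule ip_le_sqrt[OF TL[OF kL] g])
    also have "\<dots> \<le> K * sqrt (sqnorm unit_interval (k n))" using K(2)[OF kL] by (simp add: g1)
    finally have "sqrt (sqnorm unit_interval (k n)) * sqrt (sqnorm unit_interval (k n)) \<le> K * sqrt (sqnorm unit_interval (k n))"
      by simp
    moreover have "sqrt (sqnorm unit_interval (k n)) > 0" using lower[of n] \<eta> by simp
    ultimately show ?thesis by (simp only: mult_le_cancel_right_pos)
  qed
  have "\<exists>r f. strict_mono r \<and> f \<in> L2 \<and> (\<lambda>n. L2_norm (\<lambda>x. T (k (r n)) x - f x)) \<longlonglongrightarrow> 0"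
    using compact kL upper unfolding compact_operator_L2_def L2_eq_Lsq L2_norm_eq_sqnorm by blast
  then obtain r f where r: "strict_mono r" and f: "f \<in> Lsq unit_interval"
    and lim: "(\<lambda>n. sqrt (sqnorm unit_interval (\<lambda>x. T (k (r n)) x - f x))) \<longlonglongrightarrow> 0"
    unfolding L2_eq_Lsq L2_norm_eq_sqnorm by blast
  have weak: "(\<lambda>n. of_real (sqrt (2 * L (r n))) * lap f (Complex (L (r n)) (t (r n)))) \<longlonglongrightarrow> 0"
  proof (rule normalized_kernel_weakly_null[where L = "\<lambda>n. L (r n)" and t = "\<lambda>n. t (r n)", OF f L])
    show "filterlim (\<lambda>n. \<bar>t (r n)\<bar>) at_top sequentially"
    proof (rule filterlim_at_top_mono[OF filterlim_real_sequentially always_eventually], rule allI)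
      fix n
      have "real n \<le> real (Suc (r n))" using seq_suble[OF r, of n] by simp
      with t[of "r n"] show "real n \<le> \<bar>t (r n)\<bar>" by linarith
    qed
  qed
  have "(\<lambda>n. sqrt (sqnorm unit_interval (\<lambda>x. T (k (r n)) x - f x))
      + norm (of_real (sqrt (2 * L (r n))) * lap f (Complex (L (r n)) (t (r n))))) \<longlonglongrightarrow> 0 + 0"
    by (intro tendsto_add lim tendsto_norm_zero weak)
  \<comment> \<open>The inner product of T(k) with g is split at the limit f: the first part tends
    to 0 in norm, the second because the kernels are weakly null.\<close>
  moreover have "\<eta> \<le> sqrt (sqnorm unit_interval (\<lambda>x. T (k (r n)) x - f x))
      + norm (of_real (sqrt (2 * L (r n))) * lap f (Complex (L (r n)) (t (r n))))" for n
  proof -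
    have "\<eta> \<le> sqnorm unit_interval (k (r n))" by (rule lower)
    also have "\<dots> = cmod (ip unit_interval (T (k (r n))) (g (r n)))"
      unfolding adjoint_of_sqnorm[OF k, symmetric] by simp
    also have "ip unit_interval (T (k (r n))) (g (r n))
        = ip unit_interval (\<lambda>x. T (k (r n)) x - f x) (g (r n)) + ip unit_interval f (g (r n))"
      by (simp add: ip_diff_left TL kL f g)
    also have "cmod \<dots> \<le> cmod (ip unit_interval (\<lambda>x. T (k (r n)) x - f x) (g (r n))) + cmod (ip unit_interval f (g (r n)))"
      by (rule norm_triangle_ineq)
    also have "cmod (ip unit_interval (\<lambda>x. T (k (r n)) x - f x) (g (r n)))
        \<le> sqrt (sqnorm unit_interval (\<lambda>x. T (k (r n)) x - f x)) * sqrt (sqnorm unit_interval (g (r n)))"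
      by (intro ip_le_sqrt Lsq_diff TL kL f g)
    finally show ?thesis by (simp add: g1 ipg w_def)
  qed
  ultimately have "\<eta> \<le> 0 + 0" by (intro LIMSEQ_le_const) auto
  with \<eta> show False by simp
qed

text \<open>Reduces smallness of the adjoint to smallness of the transform on one segment of the
  line of real part \<beta>. R and \<zeta> do not depend on g, so uniform convergence on compact
  sets can be inserted.\<close>

lemma adjoint_small:
  assumes van: "vanishing_mean_condition a b h" and \<eta>: "\<eta> > 0" and Q: "Q \<ge> 0"
  shows "\<exists>R \<zeta>. \<zeta> > 0 \<and> (\<forall>g k. g \<in> Lsq unit_interval \<longrightarrow> adjoint_of g k \<longrightarrow> sqnorm unit_interval g \<le> Q \<longrightarrow>
     (\<forall>v. \<bar>v\<bar> \<le> R \<longrightarrow> cmod (lap g (Complex \<beta> v)) \<le> \<zeta>) \<longrightarrow> sqnorm unit_interval k < \<eta>)"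
proof -
  define C where "C = 2 + 2 * (b / 2)\<^sup>2 / \<beta>\<^sup>2"
  have C: "C \<ge> 0" by (simp add: C_def)
  \<comment> \<open>Makes the tail at most pi \<eta> / 2; the summand 1 avoids division by zero when
    Q = 0.\<close>
  define \<epsilon> where "\<epsilon> = \<eta> / (2 * (C * Q + 1))"
  have CQ: "C * Q + 1 > 0" using C Q by (simp add: add_nonneg_pos)
  have \<epsilon>: "\<epsilon> > 0" using CQ \<eta> by (simp add: \<epsilon>_def)
  obtain M where M: "M > 0" "\<And>t L. \<bar>t\<bar> \<ge> M \<Longrightarrow> L \<ge> b / 2 \<Longrightarrow>
      (\<integral>\<^sup>+y\<in>{(t - L) / a..(t + L) / a}. ennreal ((cmod (H y))\<^sup>2) \<partial>lborel) < ennreal (\<epsilon> * L)"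
    using van \<epsilon> unfolding vanishing_mean_condition_def boundary_integral_eq by blast
  \<comment> \<open>The threshold M + \<delta> of \<open>windowed_carleson\<close> for \<delta> =
    b/2.\<close>
  define R where "R = M + b / 2"
  define I where "I = enn2real (\<integral>\<^sup>+y. ennreal ((cmod (H y))\<^sup>2) * indicator {y. \<bar>y\<bar> \<le> R / a} y \<partial>lborel)"
  have I: "(\<integral>\<^sup>+y. ennreal ((cmod (H y))\<^sup>2) * indicator {y. \<bar>y\<bar> \<le> R / a} y \<partial>lborel) = ennreal I" "I \<ge> 0"
    unfolding I_def using H_local[of "R / a"] by auto
  \<comment> \<open>Makes the central part at most pi \<eta> / 2 as well. Together 2 pi ||k||^2
    \<le> pi \<eta>, which leaves the strict inequality with a factor 2 to spare.\<close>
  define \<zeta> where "\<zeta> = sqrt (pi * \<eta> / (2 * (I + 1)))"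
  have \<zeta>: "\<zeta> > 0" using \<eta> I(2) by (simp add: \<zeta>_def)
  have "sqnorm unit_interval k < \<eta>"
    if g: "g \<in> Lsq unit_interval" and k: "adjoint_of g k" and gQ: "sqnorm unit_interval g \<le> Q"
      and small: "\<And>v. \<bar>v\<bar> \<le> R \<Longrightarrow> cmod (lap g (Complex \<beta> v)) \<le> \<zeta>" for g k
  proof -
    have cont: "continuous_on UNIV (\<lambda>y. lap g (Complex \<beta> (a * y)))"
      by (rule continuous_on_compose2[OF holomorphic_on_imp_continuous_on[OF lap_holomorphic[OF g]]])
        (use \<beta>_pos in \<open>auto intro!: continuous_intros\<close>)
    then have [measurable]: "(\<lambda>y. lap g (Complex \<beta> (a * y))) \<in> borel_measurable borel"
      by (rule borel_measurable_continuous_onI)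
    have tail: "(\<integral>\<^sup>+y. ennreal ((cmod (H y * lap g (Complex \<beta> (a * y))))\<^sup>2) * indicator {y. \<bar>a * y\<bar> \<ge> R} y \<partial>lborel)
        \<le> ennreal (pi * C * \<epsilon> * sqnorm unit_interval g)"
      unfolding R_def C_def
      by (rule windowed_carleson[OF H_measurable a_pos \<beta>_pos _ _ _ g])
        (use b_pos \<epsilon> M(2)[of _ "b / 2"] in \<open>auto intro: less_imp_le\<close>)
    have core: "(\<integral>\<^sup>+y. ennreal ((cmod (H y * lap g (Complex \<beta> (a * y))))\<^sup>2) * indicator {y. \<bar>y\<bar> \<le> R / a} y \<partial>lborel)
        \<le> ennreal (\<zeta>\<^sup>2 * I)"
    proof -
      have "(\<integral>\<^sup>+y. ennreal ((cmod (H y * lap g (Complex \<beta> (a * y))))\<^sup>2) * indicator {y. \<bar>y\<bar> \<le> R / a} y \<partial>lborel)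
          \<le> (\<integral>\<^sup>+y. ennreal (\<zeta>\<^sup>2) * (ennreal ((cmod (H y))\<^sup>2) * indicator {y. \<bar>y\<bar> \<le> R / a} y) \<partial>lborel)"
      proof (rule nn_integral_mono)
        fix y :: real
        show "ennreal ((cmod (H y * lap g (Complex \<beta> (a * y))))\<^sup>2) * indicator {y. \<bar>y\<bar> \<le> R / a} y
            \<le> ennreal (\<zeta>\<^sup>2) * (ennreal ((cmod (H y))\<^sup>2) * indicator {y. \<bar>y\<bar> \<le> R / a} y)"
        proof (cases "\<bar>y\<bar> \<le> R / a")
          case True
          then have "\<bar>a * y\<bar> \<le> R" using a_pos by (simp add: abs_mult pos_le_divide_eq mult.commute)
          from small[OF this] have "(cmod (lap g (Complex \<beta> (a * y))))\<^sup>2 \<le> \<zeta>\<^sup>2" by (rule power_mono) simp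
          from mult_right_mono[OF this, of "(cmod (H y))\<^sup>2"]
          have "(cmod (H y * lap g (Complex \<beta> (a * y))))\<^sup>2 \<le> \<zeta>\<^sup>2 * (cmod (H y))\<^sup>2"
            by (simp add: norm_mult power_mult_distrib mult.commute)
          then show ?thesis using True by (simp add: ennreal_leI flip: ennreal_mult)
        qed simp
      qed
      also have "\<dots> = ennreal (\<zeta>\<^sup>2) * ennreal I"
        unfolding I(1)[symmetric] by (rule nn_integral_cmult) measurable
      finally show ?thesis using I(2) by (simp add: ennreal_mult)
    qed
    have "ennreal (2 * pi * sqnorm unit_interval k) = (\<integral>\<^sup>+y. ennreal ((cmod (H y * lap g (Complex \<beta> (a * y))))\<^sup>2) \<partial>lborel)"
      by (rule H_isometry[OF g k, symmetric])
    also have "\<dots> \<le> (\<integral>\<^sup>+y. ennreal ((cmod (H y * lap g (Complex \<beta> (a * y))))\<^sup>2) * indicator {y. \<bar>y\<bar> \<le> R / a} y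
        + ennreal ((cmod (H y * lap g (Complex \<beta> (a * y))))\<^sup>2) * indicator {y. \<bar>a * y\<bar> \<ge> R} y \<partial>lborel)"
    proof (rule nn_integral_mono)
      fix y :: real
      have "\<bar>y\<bar> \<le> R / a \<or> \<bar>a * y\<bar> \<ge> R"
        using a_pos by (auto simp: abs_mult pos_le_divide_eq mult.commute)
      then show "ennreal ((cmod (H y * lap g (Complex \<beta> (a * y))))\<^sup>2)
          \<le> ennreal ((cmod (H y * lap g (Complex \<beta> (a * y))))\<^sup>2) * indicator {y. \<bar>y\<bar> \<le> R / a} y
          + ennreal ((cmod (H y * lap g (Complex \<beta> (a * y))))\<^sup>2) * indicator {y. \<bar>a * y\<bar> \<ge> R} y"
        by (auto simp: indicator_def)
    qed
    also have "\<dots> = (\<integral>\<^sup>+y. ennreal ((cmod (H y * lap g (Complex \<beta> (a * y))))\<^sup>2) * indicator {y. \<bar>y\<bar> \<le> R / a} y \<partial>lborel)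
        + (\<integral>\<^sup>+y. ennreal ((cmod (H y * lap g (Complex \<beta> (a * y))))\<^sup>2) * indicator {y. \<bar>a * y\<bar> \<ge> R} y \<partial>lborel)"
      by (rule nn_integral_add) measurable
    also have "\<dots> \<le> ennreal (\<zeta>\<^sup>2 * I) + ennreal (pi * C * \<epsilon> * sqnorm unit_interval g)"
      by (intro add_mono core tail)
    also have "\<dots> = ennreal (\<zeta>\<^sup>2 * I + pi * C * \<epsilon> * sqnorm unit_interval g)"
      using I(2) C \<epsilon> by (intro ennreal_plus[symmetric]) auto
    finally have "2 * pi * sqnorm unit_interval k \<le> \<zeta>\<^sup>2 * I + pi * C * \<epsilon> * sqnorm unit_interval g"
      using I(2) C \<epsilon> by (subst (asm) ennreal_le_iff) auto
    also have "\<zeta>\<^sup>2 * I \<le> pi * \<eta> / 2"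
    proof -
      have "\<zeta>\<^sup>2 * I = pi * \<eta> / 2 * (I / (I + 1))" using \<eta> I(2) by (simp add: \<zeta>_def)
      also have "\<dots> \<le> pi * \<eta> / 2 * 1" using \<eta> I(2) by (intro mult_left_mono) auto
      finally show ?thesis by simp
    qed
    also have "pi * C * \<epsilon> * sqnorm unit_interval g \<le> pi * \<eta> / 2"
    proof -
      have "pi * C * \<epsilon> * sqnorm unit_interval g \<le> pi * C * \<epsilon> * Q" using C \<epsilon> gQ by (intro mult_left_mono) auto
      also have "\<dots> = pi * \<eta> / 2 * (C * Q / (C * Q + 1))" by (simp add: \<epsilon>_def)
      also have "\<dots> \<le> pi * \<eta> / 2 * 1" using \<eta> CQ by (intro mult_left_mono) auto
      finally show ?thesis by simp
    qed
    finally have "pi * (2 * sqnorm unit_interval k) \<le> pi * \<eta>" by (simp add: algebra_simps)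
    then have "2 * sqnorm unit_interval k \<le> \<eta>" by simp
    with \<eta> show ?thesis by simp
  qed
  with \<zeta> show ?thesis by blast
qed

text \<open>Montel's theorem makes the transforms of T(f n) converge locally uniformly along a
  subsequence. The limit G itself is never identified: differences are small on the relevant
  segment, so the sequence is Cauchy in L^2 and completeness finishes.\<close>

lemma vanishing_imp_compact:
  assumes van: "vanishing_mean_condition a b h"
  shows "compact_operator_L2 T"
  unfolding compact_operator_L2_def L2_eq_Lsq L2_norm_eq_sqnorm
proof (intro allI impI)
  fix f :: "nat \<Rightarrow> real \<Rightarrow> complex"
  assume "(\<forall>k. f k \<in> Lsq unit_interval) \<and> (\<exists>B. \<forall>k. sqrt (sqnorm unit_interval (f k)) \<le> B)"
  then obtain B where f: "\<And>n. f n \<in> Lsq unit_interval" and B: "\<And>n. sqrt (sqnorm unit_interval (f n)) \<le> B" by blast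
  have B0: "B \<ge> 0" using B[of 0] real_sqrt_ge_zero[OF sqnorm_nonneg[of unit_interval "f 0"]] by linarith
  have fB: "sqnorm unit_interval (f n) \<le> B\<^sup>2" for n using sqrt_le_D[OF B[of n]] .
  obtain K where K: "K \<ge> 0" "\<And>f. f \<in> Lsq unit_interval \<Longrightarrow> sqrt (sqnorm unit_interval (T f)) \<le> K * sqrt (sqnorm unit_interval f)"
    using bounded_operator_bound[OF T] by metis
  define Q where "Q = (K * B)\<^sup>2"
  have TL: "T f \<in> Lsq unit_interval" if "f \<in> Lsq unit_interval" for f by (rule bounded_operator_Lsq[OF T that])
  have TfQ: "sqnorm unit_interval (T (f n)) \<le> Q" for n
  proof -
    have "sqrt (sqnorm unit_interval (T (f n))) \<le> K * B"
      using K(2)[OF f] mult_left_mono[OF B[of n] K(1)] by (rule order_trans)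
    then show ?thesis unfolding Q_def by (rule sqrt_le_D)
  qed
  have "range (\<lambda>n. lap (T (f n))) \<subseteq> lap ` {g \<in> Lsq unit_interval. sqnorm unit_interval g \<le> Q}"
    using TL[OF f] TfQ by auto
  moreover have "\<exists>B. \<forall>F\<in>lap ` {g \<in> Lsq unit_interval. sqnorm unit_interval g \<le> Q}. \<forall>z\<in>S. cmod (F z) \<le> B"
    if S: "compact S" "S \<subseteq> RHP" for S
  proof (cases "S = {}")
    case False
    obtain s0 where s0: "s0 \<in> S" "\<And>s. s \<in> S \<Longrightarrow> Re s0 \<le> Re s"
      using continuous_attains_inf[OF S(1) False continuous_on_Re[OF continuous_on_id]] by auto
    have "cmod (lap g s) \<le> sqrt (Q / (2 * Re s0))"
      if g: "g \<in> Lsq unit_interval" "sqnorm unit_interval g \<le> Q" and s: "s \<in> S" for g s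
    proof (rule real_le_rsqrt)
      have pos: "Re s0 > 0" "Re s > 0" using s0(1) s S(2) by auto
      have "(cmod (lap g s))\<^sup>2 \<le> sqnorm unit_interval g / (2 * Re s)" by (rule lap_le[OF g(1) pos(2)])
      also have "\<dots> \<le> Q / (2 * Re s0)" using g(2) pos s0(2)[OF s] order_trans[OF sqnorm_nonneg g(2)]
        by (intro frac_le) auto
      finally show "(cmod (lap g s))\<^sup>2 \<le> Q / (2 * Re s0)" .
    qed
    then show ?thesis by blast
  qed auto
  ultimately obtain G r where r: "strict_mono (r :: nat \<Rightarrow> nat)"
    and unif: "\<And>S. compact S \<Longrightarrow> S \<subseteq> RHP \<Longrightarrow> uniform_limit S ((\<lambda>n. lap (T (f n))) \<circ> r) G sequentially"
    using Montel[of RHP "lap ` {g \<in> Lsq unit_interval. sqnorm unit_interval g \<le> Q}" "\<lambda>n. lap (T (f n))"]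
      lap_holomorphic open_halfspace_Re_gt[of 0] by (metis (no_types, lifting) imageE mem_Collect_eq)
  have cauchy: "\<exists>N. \<forall>m\<ge>N. \<forall>n\<ge>N. sqnorm unit_interval (\<lambda>x. T (f (r m)) x - T (f (r n)) x) < e" if e: "e > 0" for e
  proof -
    \<comment> \<open>From (\<open>sqnorm\<close> of D)^2 \<le> 4 B^2 \<open>sqnorm\<close> of k;
      the summand 1 covers B = 0 and makes the inequality strict.\<close>
    define \<eta> where "\<eta> = e\<^sup>2 / (4 * B\<^sup>2 + 1)"
    have B1: "4 * B\<^sup>2 + 1 > 0" by (simp add: add_nonneg_pos)
    have \<eta>: "\<eta> > 0" using e B1 by (simp add: \<eta>_def)
    have "4 * Q \<ge> 0" by (simp add: Q_def)
    from adjoint_small[OF van \<eta> this] obtain R \<zeta> where \<zeta>: "\<zeta> > 0"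
      and small: "\<And>g k. g \<in> Lsq unit_interval \<Longrightarrow> adjoint_of g k \<Longrightarrow> sqnorm unit_interval g \<le> 4 * Q \<Longrightarrow>
        (\<And>v. \<bar>v\<bar> \<le> R \<Longrightarrow> cmod (lap g (Complex \<beta> v)) \<le> \<zeta>) \<Longrightarrow> sqnorm unit_interval k < \<eta>"
      by blast
    define S where "S = (\<lambda>v. Complex \<beta> v) ` {-R..R}"
    have "compact S" unfolding S_def by (intro compact_continuous_image continuous_intros) auto
    moreover have "S \<subseteq> RHP" using \<beta>_pos by (auto simp: S_def)
    ultimately have "uniform_limit S ((\<lambda>n. lap (T (f n))) \<circ> r) G sequentially" by (rule unif)
    then have "\<forall>\<^sub>F n in sequentially. \<forall>s\<in>S. dist (lap (T (f (r n))) s) (G s) < \<zeta> / 2"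
      using \<zeta> by (auto dest!: uniform_limitD[where e = "\<zeta> / 2"])
    then obtain N where N: "\<And>n s. n \<ge> N \<Longrightarrow> s \<in> S \<Longrightarrow> dist (lap (T (f (r n))) s) (G s) < \<zeta> / 2"
      by (auto simp: eventually_sequentially)
    have "sqnorm unit_interval (\<lambda>x. T (f (r m)) x - T (f (r n)) x) < e" if mn: "m \<ge> N" "n \<ge> N" for m n
    proof -
      define D where "D x = T (f (r m)) x - T (f (r n)) x" for x
      define d where "d x = f (r m) x - f (r n) x" for x
      have D: "D \<in> Lsq unit_interval" unfolding D_def[abs_def] by (intro Lsq_diff TL f)
      have d: "d \<in> Lsq unit_interval" unfolding d_def[abs_def] by (intro Lsq_diff f)
      obtain k where k: "adjoint_of D k" using adjoint_of_exists[OF D] by blast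
      then have kL: "k \<in> Lsq unit_interval" by (simp add: adjoint_of_def)
      have DQ: "sqnorm unit_interval D \<le> 4 * Q"
        using sqnorm_diff_le[OF TL[OF f[of "r m"]] TL[OF f[of "r n"]]] TfQ[of "r m"] TfQ[of "r n"]
        unfolding D_def[abs_def] by linarith
      have dB: "sqnorm unit_interval d \<le> 4 * B\<^sup>2"
        using sqnorm_diff_le[OF f[of "r m"] f[of "r n"]] fB[of "r m"] fB[of "r n"]
        unfolding d_def[abs_def] by linarith
      have "sqnorm unit_interval k < \<eta>"
      proof (rule small[OF D k DQ])
        fix v :: real assume "\<bar>v\<bar> \<le> R"
        then have v: "Complex \<beta> v \<in> S" by (auto simp: S_def abs_le_iff)
        have "lap D (Complex \<beta> v) = lap (T (f (r m))) (Complex \<beta> v) - lap (T (f (r n))) (Complex \<beta> v)"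
          unfolding D_def[abs_def] using \<beta>_pos by (intro lap_diff TL f) auto
        then have "cmod (lap D (Complex \<beta> v)) = dist (lap (T (f (r m))) (Complex \<beta> v)) (lap (T (f (r n))) (Complex \<beta> v))"
          by (simp add: dist_norm)
        also have "\<dots> \<le> dist (lap (T (f (r m))) (Complex \<beta> v)) (G (Complex \<beta> v)) + dist (lap (T (f (r n))) (Complex \<beta> v)) (G (Complex \<beta> v))"
          by (rule dist_triangle2)
        also have "\<dots> \<le> \<zeta>" using N[OF mn(1) v] N[OF mn(2) v] by linarith
        finally show "cmod (lap D (Complex \<beta> v)) \<le> \<zeta>" .
      qed
      \<comment> \<open>With D = Td almost everywhere, ||D||^2 is the inner product of d with k;
        Cauchy--Schwarz, squared, yields the fourth power of the norm on the left.\<close>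
      moreover have "(sqnorm unit_interval D)\<^sup>2 \<le> 4 * B\<^sup>2 * sqnorm unit_interval k"
      proof -
        have "AE u in unit_interval. T d u = D u"
          using bounded_operator_diff_AE[OF T f f] unfolding d_def[abs_def] D_def .
        then have "ip unit_interval D D = ip unit_interval (T d) D"
          by (intro ip_cong_AE D TL d) auto
        also have "\<dots> = ip unit_interval d k" using k d by (simp add: adjoint_of_def)
        finally have "(sqnorm unit_interval D)\<^sup>2 = (cmod (ip unit_interval d k))\<^sup>2"
          by (metis ip_self norm_of_real power2_abs)
        also have "\<dots> \<le> sqnorm unit_interval d * sqnorm unit_interval k" by (rule ip_le[OF d kL])
        also have "\<dots> \<le> 4 * B\<^sup>2 * sqnorm unit_interval k" by (intro mult_right_mono dB) simp
        finally show ?thesis .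
      qed
      ultimately have "(sqnorm unit_interval D)\<^sup>2 \<le> 4 * B\<^sup>2 * \<eta>"
        by (meson less_imp_le mult_left_mono order_trans mult_nonneg_nonneg zero_le_numeral zero_le_power2)
      also have "\<dots> < (4 * B\<^sup>2 + 1) * \<eta>" using \<eta> by simp
      also have "\<dots> = e\<^sup>2" using B1 by (simp add: \<eta>_def)
      finally have "sqnorm unit_interval D < e" by (rule power2_less_imp_less) (use e in simp)
      then show ?thesis by (simp add: D_def[abs_def])
    qed
    then show ?thesis by blast
  qed
  have "\<exists>g\<in>Lsq unit_interval. (\<lambda>n. sqnorm unit_interval (\<lambda>x. T (f (r n)) x - g x)) \<longlonglongrightarrow> 0"
    by (rule Lsq_complete[where f = "\<lambda>n. T (f (r n))", OF TL[OF f] cauchy])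
  then obtain g where g: "g \<in> Lsq unit_interval" "(\<lambda>n. sqnorm unit_interval (\<lambda>x. T (f (r n)) x - g x)) \<longlonglongrightarrow> 0" by blast
  from tendsto_real_sqrt[OF g(2)] have "(\<lambda>n. sqrt (sqnorm unit_interval (\<lambda>x. T (f (r n)) x - g x))) \<longlonglongrightarrow> 0" by simp
  with r g(1) show "\<exists>r g. strict_mono r \<and> g \<in> Lsq unit_interval \<and>
      (\<lambda>k. sqrt (sqnorm unit_interval (\<lambda>x. T (f (r k)) x - g x))) \<longlonglongrightarrow> 0" by blast
qed

text \<open>L is unbounded, so a window with |t| large may still contain the origin. Long windows
  are handled by the total mass, which is below \<epsilon> L; short ones stay in the tail.\<close>

lemma square_integrable_imp_vanishing:
  assumes "square_integrable_boundary h"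
  shows "vanishing_mean_condition a b h"
proof -
  define N where "N = enn2real (\<integral>\<^sup>+y. ennreal ((cmod (H y))\<^sup>2) \<partial>lborel)"
  have "(\<integral>\<^sup>+y. ennreal ((cmod (H y))\<^sup>2) \<partial>lborel) < \<infinity>"
    using assms boundary_integral_eq[of UNIV] by (simp add: square_integrable_boundary_def)
  then have N: "(\<integral>\<^sup>+y. ennreal ((cmod (H y))\<^sup>2) \<partial>lborel) = ennreal N" "N \<ge> 0"
    unfolding N_def by auto
  have "(\<lambda>n. \<integral>\<^sup>+y. ennreal ((cmod (H y))\<^sup>2) * indicator {y. real n \<le> \<bar>y\<bar>} y \<partial>lborel) \<longlonglongrightarrow> (\<integral>\<^sup>+(y::real). 0 \<partial>lborel)"
  proof (rule nn_integral_dominated_convergence[where w = "\<lambda>y. ennreal ((cmod (H y))\<^sup>2)"])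
    show "AE y in lborel. (\<lambda>n. ennreal ((cmod (H y))\<^sup>2) * indicator {y. real n \<le> \<bar>y\<bar>} y) \<longlonglongrightarrow> 0"
    proof (rule AE_I2)
      fix y :: real
      obtain n0 where "\<bar>y\<bar> < real n0" using reals_Archimedean2 by blast
      then have "\<forall>n\<ge>n0. ennreal ((cmod (H y))\<^sup>2) * indicator {y. real n \<le> \<bar>y\<bar>} y = 0"
        by (auto simp: indicator_def)
      then show "(\<lambda>n. ennreal ((cmod (H y))\<^sup>2) * indicator {y. real n \<le> \<bar>y\<bar>} y) \<longlonglongrightarrow> 0"
        by (intro tendsto_eventually) (auto simp: eventually_sequentially)
    qed
    show "AE y in lborel. ennreal ((cmod (H y))\<^sup>2) * indicator {y. real n \<le> \<bar>y\<bar>} y \<le> ennreal ((cmod (H y))\<^sup>2)" for n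
      by (auto simp: indicator_def)
  qed (use N in auto)
  then have tail: "(\<lambda>n. \<integral>\<^sup>+y. ennreal ((cmod (H y))\<^sup>2) * indicator {y. real n \<le> \<bar>y\<bar>} y \<partial>lborel) \<longlonglongrightarrow> 0" by simp
  show ?thesis
    unfolding vanishing_mean_condition_def boundary_integral_eq
  proof (intro allI impI)
    fix \<epsilon> :: real assume \<epsilon>: "\<epsilon> > 0"
    have "ennreal (\<epsilon> * (b / 2)) > 0" using \<epsilon> b_pos by simp
    from order_tendstoD(2)[OF tail this] obtain n0 where
      n0: "(\<integral>\<^sup>+y. ennreal ((cmod (H y))\<^sup>2) * indicator {y. real n0 \<le> \<bar>y\<bar>} y \<partial>lborel) < ennreal (\<epsilon> * (b / 2))"
      by (auto simp: eventually_sequentially)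
    \<comment> \<open>Chosen for N < \<epsilon> L0.\<close>
    define L0 where "L0 = N / \<epsilon> + 1"
    have L0: "L0 > 0" using N(2) \<epsilon> by (simp add: L0_def add_nonneg_pos)
    show "\<exists>M>0. \<forall>t L. M \<le> \<bar>t\<bar> \<and> b / 2 \<le> L \<longrightarrow>
        (\<integral>\<^sup>+y\<in>{(t - L) / a..(t + L) / a}. ennreal ((cmod (H y))\<^sup>2) \<partial>lborel) < ennreal (\<epsilon> * L)"
    \<comment> \<open>For L < L0 a point y of the window satisfies a |y| \<ge> |t| - L \<ge> a
      n0.\<close>
    proof (intro exI[of _ "a * real n0 + L0"] conjI allI impI)
      show "a * real n0 + L0 > 0" using a_pos L0 by (simp add: add_nonneg_pos)
      fix t L :: real assume tL: "a * real n0 + L0 \<le> \<bar>t\<bar> \<and> b / 2 \<le> L"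
      show "(\<integral>\<^sup>+y\<in>{(t - L) / a..(t + L) / a}. ennreal ((cmod (H y))\<^sup>2) \<partial>lborel) < ennreal (\<epsilon> * L)"
      proof (cases "L \<ge> L0")
        case True
        have "(\<integral>\<^sup>+y\<in>{(t - L) / a..(t + L) / a}. ennreal ((cmod (H y))\<^sup>2) \<partial>lborel) \<le> (\<integral>\<^sup>+y. ennreal ((cmod (H y))\<^sup>2) \<partial>lborel)"
          by (intro nn_integral_mono) (auto simp: indicator_def)
        also have "\<dots> = ennreal N" by (rule N)
        also have "\<dots> < ennreal (\<epsilon> * L)"
        proof (rule ennreal_lessI)
          have "N < \<epsilon> * L0" using \<epsilon> by (simp add: L0_def distrib_left)
          also have "\<dots> \<le> \<epsilon> * L" using True \<epsilon> by simp
          finally show "N < \<epsilon> * L" .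
          then show "0 < \<epsilon> * L" using N(2) by linarith
        qed
        finally show ?thesis .
      next
        case False
        have "y \<in> {y. real n0 \<le> \<bar>y\<bar>}" if y: "y \<in> {(t - L) / a..(t + L) / a}" for y
        proof -
          have "\<bar>a * y - t\<bar> \<le> L"
            using y a_pos by (simp add: pos_divide_le_eq pos_le_divide_eq abs_le_iff mult.commute)
          then have "a * real n0 \<le> \<bar>a * y\<bar>" using tL False by linarith
          then show ?thesis using a_pos by (simp add: abs_mult)
        qed
        then have "(\<integral>\<^sup>+y\<in>{(t - L) / a..(t + L) / a}. ennreal ((cmod (H y))\<^sup>2) \<partial>lborel)
            \<le> (\<integral>\<^sup>+y. ennreal ((cmod (H y))\<^sup>2) * indicator {y. real n0 \<le> \<bar>y\<bar>} y \<partial>lborel)"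
          by (intro nn_integral_mono mult_left_mono) (auto simp: indicator_def)
        also have "\<dots> < ennreal (\<epsilon> * (b / 2))" by (rule n0)
        also have "\<dots> \<le> ennreal (\<epsilon> * L)" using tL \<epsilon> by (intro ennreal_leI) auto
        finally show ?thesis .
      qed
    qed
  qed
qed

end

lemma vanishing_mean_condition_if_0:
  assumes h: "\<And>s. s \<in> RHP \<Longrightarrow> h s = 0" and b: "b > 0"
  shows "vanishing_mean_condition a b h"
proof -
  have bv: "boundary_value h y = 0" for y
  proof -
    have "\<forall>\<^sub>F x in at_right 0. h (Complex x y) = 0"
      using eventually_at_right_less[of 0] by eventually_elim (simp add: h)
    then show ?thesis
      unfolding boundary_value_def by (intro tendsto_Lim tendsto_eventually) auto
  qed
  \<comment> \<open>The condition is a strict inequality, so even a vanishing integral needs a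
    positive right-hand side.\<close>
  have "0 < \<epsilon> * L" if "\<epsilon> > 0" "L \<ge> b / 2" for \<epsilon> L :: real
    using that b by (intro mult_pos_pos) auto
  then show ?thesis
    unfolding vanishing_mean_condition_def by (auto simp: bv intro!: exI[of _ 1])
qed

theorem corollary2p7:
  fixes T :: "(real \<Rightarrow> complex) \<Rightarrow> (real \<Rightarrow> complex)"
    and c p :: "nat \<Rightarrow> complex"
    and a b :: real
    and h :: "complex \<Rightarrow> complex"
  assumes "monomial_operator T c p"
    and "affine_index p a b"
    and "a > 0" and "b > 0"
    and "a \<noteq> 2 * b + 1"
    and "associated_function T c a b h"
  shows "(compact_operator_L2 T \<longleftrightarrow> vanishing_mean_condition a b h) \<and>
         (square_integrable_boundary h \<longrightarrow> vanishing_mean_condition a b h)"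
proof -
  have T: "bounded_operator_L2 T" using assms(1) by (simp add: monomial_operator_def)
  have h: "h holomorphic_on RHP"
    and adj: "H2_adjoint (hardy_transfer T) (weighted_composition h (affine_symbol a b))"
    using assms(6) by (auto simp: associated_function_def)
  define \<beta> where "\<beta> = b + (1 - a) / 2"
  \<comment> \<open>2\<beta> = 2b + 1 - a.\<close>
  have "\<beta> \<noteq> 0" using assms(5) by (simp add: \<beta>_def field_simps)
  then consider "\<beta> < 0" | "\<beta> > 0" by linarith
  then show ?thesis
  proof cases
    case 1
    \<comment> \<open>The symbol leaves the half-plane, so h and T vanish and both sides of the
      equivalence hold.\<close>
    have h0: "h s = 0" if "s \<in> RHP" for s
      using weight_eq_0_if_symbol_escapes[OF adj h assms(3) _ that] 1 by (simp add: \<beta>_def)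
    have "compact_operator_L2 T"
      by (intro compact_operator_if_0 operator_eq_0_if_weight_0[OF T adj h0])
    moreover have "vanishing_mean_condition a b h"
      by (rule vanishing_mean_condition_if_0[OF h0 assms(4)])
    ultimately show ?thesis by blast
  next
    case 2
    interpret affine_weight T h a b \<beta>
      by unfold_locales (rule T adj assms \<beta>_def 2)+
    obtain H where H: "H \<in> borel_measurable borel" "AE y in lborel. boundary_value h y = H y"
      "\<And>g k. g \<in> Lsq unit_interval \<Longrightarrow> adjoint_of g k \<Longrightarrow>
       (\<integral>\<^sup>+y. ennreal ((cmod (H y * lap g (Complex \<beta> (a * y))))\<^sup>2) \<partial>lborel) = ennreal (2 * pi * sqnorm unit_interval k)"
      "\<And>R. (\<integral>\<^sup>+y. ennreal ((cmod (H y))\<^sup>2) * indicator {y. \<bar>y\<bar> \<le> R} y \<partial>lborel) < \<infinity>"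
    proof -
      from boundary_function obtain H where "H \<in> borel_measurable borel" and
        "(AE y in lborel. boundary_value h y = H y) \<and>
         (\<forall>g k. g \<in> Lsq unit_interval \<longrightarrow> adjoint_of g k \<longrightarrow>
           (\<integral>\<^sup>+y. ennreal ((cmod (H y * lap g (Complex \<beta> (a * y))))\<^sup>2) \<partial>lborel) = ennreal (2 * pi * sqnorm unit_interval k)) \<and>
         (\<forall>R. (\<integral>\<^sup>+y. ennreal ((cmod (H y))\<^sup>2) * indicator {y. \<bar>y\<bar> \<le> R} y \<partial>lborel) < \<infinity>)"
        by (rule bexE)
      then show thesis by (intro that[of H]) simp_all
    qed
    interpret affine_weight_boundary T h a b \<beta> H
      by unfold_locales (fact H)+
    show ?thesis
      using compact_imp_vanishing vanishing_imp_compact square_integrable_imp_vanishing by blast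
  qed
qed

end
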